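(* Let $G$ be a finite group and let $\mathcal C=\bigoplus_{h\in G}\mathcal C_h$ be a modular $G$-equivariant fusion category with extended Verlinde algebra $\widetilde{\mathcal V}=\bigoplus_{gh=hg}\widetilde{\mathcal V}_{g,h}$. Fix a generic basis $\{{}^g\lambda_i\}$ of $\widetilde{\mathcal V}$. Fix $g\in G$ and $i\in I_1$. Let $L_i\colon \widetilde{\mathcal V}_{1,g}\to\widetilde{\mathcal V}_{1,g}$ be the operator of left multiplication (for the tensor product) by $\lambda_i$. Define the linear operator $D_i\colon \widetilde{\mathcal V}_{g^{-1},1}\to\widetilde{\mathcal V}_{g^{-1},1}$ by $$D_i\,{}^{g^{-1}}\!\lambda_k=\frac{(s\lambda_i,\lambda_k)}{(s\lambda_0,\lambda_k)}\;{}^{g^{-1}}\!\lambda_k,\qquad k\in{}^{g^{-1}}I_1 .$$ Then $$sL_i=D_is$$ as maps $\widetilde{\mathcal V}_{1,g}\to\widetilde{\mathcal V}_{g^{-1},1}$.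
   Context: $G$-equivariant fusion category: a semisimple $\mathbb C$-linear abelian rigid monoidal category $\mathcal C=\bigoplus_{h\in G}\mathcal C_h$ ($G$ finite, finitely many isomorphism classes of simple objects, unit object $\mathbf 1$ simple) with $\mathcal C_g\otimes\mathcal C_h\subset\mathcal C_{gh}$; an action of $G$ by tensor functors $R_g$ (written ${}^gV=R_g(V)$) with coherent isomorphisms $R_gR_h\simeq R_{gh}$, $R_1=\mathrm{id}$, $R_g\mathcal C_h\subset\mathcal C_{ghg^{-1}}$; functorial isomorphisms $\delta_V\colon V\to V^{**}$ (a pivotal structure satisfying the usual compatibilities of ribbon categories) with $R_g(\delta_V)=\delta_{R_g(V)}$; and functorial $G$-crossed braidings $c_{V,W}\colon V\otimes W\to{}^gW\otimes V$ for $V\in\mathcal C_g$, in the sense of Turaev. Extended Verlinde algebra: fix a representative $V_i$ of each isomorphism class of simple objects, $i\in I$, with $V_0=\mathbf 1$; $d_i=\dim V_i$ is the categorical dimension. $I_h$ denotes the classes in $\mathcal C_h$, and ${}^gI_h$ those classes of $I_h$ invariant under $g$. Set $\widetilde{\mathcal V}_{g,h}=\bigoplus_{i\in I_h}\mathrm{Mor}(V_i,{}^gV_i)$ and $\widetilde{\mathcal V}=\bigoplus_{gh=hg}\widetilde{\mathcal V}_{g,h}$. Any $\varphi\colon V\to{}^gV$ defines a class $[\varphi]\in\widetilde{\mathcal V}$, linear in $\varphi$, with $[R_g(T)\varphi T^{-1}]=[\varphi]$ for isomorphisms $T$, and $[\varphi]=\sum_i[\varphi_{ii}]$ for $\varphi=(\varphi_{ij})$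 on a direct sum of simple objects (only diagonal components contribute). Tensor product: for $\varphi\in\widetilde{\mathcal V}_{g,a}$, $\psi\in\widetilde{\mathcal V}_{h,b}$, $[\varphi]\otimes[\psi]=[\varphi\otimes\psi]\in\widetilde{\mathcal V}_{g,ab}$ if $g=h$, and $0$ otherwise. Involution and bilinear form: for $\varphi\colon V\to{}^gV$ the adjoint $\varphi^*\colon{}^gV^*\to V^*$ defines a linear map $*\colon\widetilde{\mathcal V}_{g,h}\to\widetilde{\mathcal V}_{g^{-1},h^{-1}}$. Let $[\ ]_0\colon\widetilde{\mathcal V}\to\mathbb C$ be the linear map which is $0$ on $\mathrm{Mor}(V_i,{}^gV_i)$ for $i\neq0$ and $1$ on the canonical isomorphisms $\mathbf 1\to{}^g\mathbf 1$. Put $(\varphi,\psi)=[\varphi\otimes\psi^*]_0$. $s$-matrix: $\tilde s\colon\widetilde{\mathcal V}_{g,h}\to\widetilde{\mathcal V}_{h^{-1},g}$, $\tilde s[\varphi]=\sum_{k\in{}^{h^{-1}}I_g}(\tilde s[\varphi])_k$, where for $\varphi\colon V\to{}^gV$, $V\in\mathcal C_h$, the morphism $(\tilde s[\varphi])_k\colon V_k\to{}^{h^{-1}}V_k$ is $d_k$ times the morphism obtained by encircling the strand $V_k$ by a closed $V$-coloured loop carrying $\varphi$, i.e. $d_k$ times the partial trace over $V$ of $$V\otimes V_k\xrightarrow{\varphi\otimes\mathrm{id}}{}^gV\otimes V_k\xrightarrow{c^{-1}}V_k\otimes V\xrightarrow{c^{-1}}V\otimes{}^{h^{-1}}V_k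 .$$ $\mathcal C$ is called modular if $\tilde s$ is invertible. The normalized operator is $s=D^{-1}\tilde s$, where $D=\sqrt{p^+p^-}$, $p^{\pm}=\sum_{i\in I_1}\theta_i^{\pm1}d_i^2$, and $\theta_i$ is the scalar by which the twist acts on $V_i$, $i\in I_1$. Generic basis: for every $g\in G$ and every $i\in I$ invariant under $g$, the space $\mathrm{Mor}(V_i,{}^gV_i)$ is one-dimensional; choose a nonzero element ${}^g\lambda_i$ in it, arbitrary except that for $g=1$ one takes $\lambda_i={}^1\lambda_i=\mathrm{id}_{V_i}$. *)

theory Defs
  imports Complex_Main "HOL-Algebra.Group"
begin

text \<open>
  Objects are the elements of the type \<open>'o\<close>.  Morphisms are elements of an additive group \<open>'m\<close>
  in which every hom-set \<open>Hom X Y\<close> is a complex subspace, so all zero morphisms are the same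
  element \<open>0\<close> and a morphism does not determine its source and target.  This is no restriction:
  for \<open>'m\<close> one may take the direct sum of all hom-spaces, composition and tensor product being
  only constrained on morphisms with matching types.  Composition is written in the usual order,
  \<open>f \<cdot> g\<close> meaning ``first \<open>g\<close>''.  Associativity, unit, duality and \<open>G\<close>-action constraints are
  all part of the data; no strictness is assumed except \<open>R\<^sub>1 = id\<close>.
\<close>

record ('o, 'm) linear_cat =
  Hom :: "'o \<Rightarrow> 'o \<Rightarrow> 'm set"
  Idm :: "'o \<Rightarrow> 'm"
  cmp :: "'m \<Rightarrow> 'm \<Rightarrow> 'm" (infixr "\<cdot>\<index>" 55)
  scl :: "complex \<Rightarrow> 'm \<Rightarrow> 'm" (infixr "\<bullet>\<index>" 75)

record ('o, 'm) pivotal_cat = "('o, 'm) linear_cat" +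
  tnO :: "'o \<Rightarrow> 'o \<Rightarrow> 'o" (infixr "\<boxtimes>\<index>" 70)
  tnM :: "'m \<Rightarrow> 'm \<Rightarrow> 'm" (infixr "\<boxtimes>\<^sub>m\<index>" 70)
  unit :: 'o
  assoc :: "'o \<Rightarrow> 'o \<Rightarrow> 'o \<Rightarrow> 'm"  \<comment> \<open>\<open>(X \<boxtimes> Y) \<boxtimes> Z \<rightarrow> X \<boxtimes> (Y \<boxtimes> Z)\<close>\<close>
  lun :: "'o \<Rightarrow> 'm"  \<comment> \<open>\<open>\<one> \<boxtimes> X \<rightarrow> X\<close>\<close>
  run :: "'o \<Rightarrow> 'm"  \<comment> \<open>\<open>X \<boxtimes> \<one> \<rightarrow> X\<close>\<close>
  dual :: "'o \<Rightarrow> 'o"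
  ev :: "'o \<Rightarrow> 'm"  \<comment> \<open>\<open>X\<^sup>* \<boxtimes> X \<rightarrow> \<one>\<close>\<close>
  coev :: "'o \<Rightarrow> 'm"  \<comment> \<open>\<open>\<one> \<rightarrow> X \<boxtimes> X\<^sup>*\<close>\<close>
  piv :: "'o \<Rightarrow> 'm"  \<comment> \<open>\<open>\<delta>\<^sub>X : X \<rightarrow> X\<^sup>*\<^sup>*\<close>\<close>

record ('g, 'o, 'm) equivariant_cat = "('o, 'm) pivotal_cat" +
  deg :: "'g \<Rightarrow> 'o set"  \<comment> \<open>the objects of \<open>\<C>\<^sub>g\<close>\<close>
  actO :: "'g \<Rightarrow> 'o \<Rightarrow> 'o"  \<comment> \<open>\<open>R\<^sub>g\<close> on objects\<close>
  actM :: "'g \<Rightarrow> 'm \<Rightarrow> 'm"  \<comment> \<open>\<open>R\<^sub>g\<close> on morphisms\<close>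
  mu :: "'g \<Rightarrow> 'o \<Rightarrow> 'o \<Rightarrow> 'm"  \<comment> \<open>\<open>R\<^sub>g X \<boxtimes> R\<^sub>g Y \<rightarrow> R\<^sub>g (X \<boxtimes> Y)\<close>\<close>
  eta :: "'g \<Rightarrow> 'm"  \<comment> \<open>\<open>\<one> \<rightarrow> R\<^sub>g \<one>\<close>\<close>
  alpha :: "'g \<Rightarrow> 'g \<Rightarrow> 'o \<Rightarrow> 'm"  \<comment> \<open>\<open>R\<^sub>g (R\<^sub>h X) \<rightarrow> R\<^sub>g\<^sub>h X\<close>\<close>
  braid :: "'g \<Rightarrow> 'o \<Rightarrow> 'o \<Rightarrow> 'm"  \<comment> \<open>\<open>braid g X Y : X \<boxtimes> Y \<rightarrow> R\<^sub>g Y \<boxtimes> X\<close> for \<open>X \<in> \<C>\<^sub>g\<close>\<close>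


section \<open>Semisimple abelian categories\<close>

context
  fixes C :: "('o, 'm::ab_group_add, 'z) linear_cat_scheme" (structure)
begin

definition is_iso :: "'o \<Rightarrow> 'o \<Rightarrow> 'm \<Rightarrow> bool" where
  "is_iso X Y f \<longleftrightarrow> f \<in> Hom C X Y \<and> (\<exists>h\<in>Hom C Y X. h \<cdot> f = Idm C X \<and> f \<cdot> h = Idm C Y)"

definition isomorphic :: "'o \<Rightarrow> 'o \<Rightarrow> bool" where
  "isomorphic X Y \<longleftrightarrow> (\<exists>f. is_iso X Y f)"

definition inv_mor :: "'o \<Rightarrow> 'o \<Rightarrow> 'm \<Rightarrow> 'm" where
  "inv_mor X Y f = (THE h. h \<in> Hom C Y X \<and> h \<cdot> f = Idm C X \<and> f \<cdot> h = Idm C Y)"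

definition is_mono :: "'o \<Rightarrow> 'o \<Rightarrow> 'm \<Rightarrow> bool" where
  "is_mono X Y f \<longleftrightarrow> f \<in> Hom C X Y \<and>
     (\<forall>W. \<forall>u\<in>Hom C W X. \<forall>v\<in>Hom C W X. f \<cdot> u = f \<cdot> v \<longrightarrow> u = v)"

definition is_epi :: "'o \<Rightarrow> 'o \<Rightarrow> 'm \<Rightarrow> bool" where
  "is_epi X Y f \<longleftrightarrow> f \<in> Hom C X Y \<and>
     (\<forall>W. \<forall>u\<in>Hom C Y W. \<forall>v\<in>Hom C Y W. u \<cdot> f = v \<cdot> f \<longrightarrow> u = v)"

definition is_kernel :: "'o \<Rightarrow> 'o \<Rightarrow> 'o \<Rightarrow> 'm \<Rightarrow> 'm \<Rightarrow> bool" where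
  "is_kernel K X Y k f \<longleftrightarrow> k \<in> Hom C K X \<and> f \<in> Hom C X Y \<and> f \<cdot> k = 0 \<and>
     (\<forall>W. \<forall>u\<in>Hom C W X. f \<cdot> u = 0 \<longrightarrow> (\<exists>!v. v \<in> Hom C W K \<and> k \<cdot> v = u))"

definition is_cokernel :: "'o \<Rightarrow> 'o \<Rightarrow> 'o \<Rightarrow> 'm \<Rightarrow> 'm \<Rightarrow> bool" where
  "is_cokernel X Y Q f q \<longleftrightarrow> f \<in> Hom C X Y \<and> q \<in> Hom C Y Q \<and> q \<cdot> f = 0 \<and>
     (\<forall>W. \<forall>u\<in>Hom C Y W. u \<cdot> f = 0 \<longrightarrow> (\<exists>!v. v \<in> Hom C Q W \<and> v \<cdot> q = u))"

definition is_direct_sum ::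
    "'o \<Rightarrow> 'a set \<Rightarrow> ('a \<Rightarrow> 'o) \<Rightarrow> ('a \<Rightarrow> 'm) \<Rightarrow> ('a \<Rightarrow> 'm) \<Rightarrow> bool" where
  "is_direct_sum X A F i p \<longleftrightarrow> finite A \<and>
     (\<forall>a\<in>A. i a \<in> Hom C (F a) X \<and> p a \<in> Hom C X (F a)) \<and>
     (\<forall>a\<in>A. \<forall>b\<in>A. p a \<cdot> i b = (if a = b then Idm C (F a) else 0)) \<and>
     (\<Sum>a\<in>A. i a \<cdot> p a) = Idm C X"

definition simple :: "'o \<Rightarrow> bool" where
  "simple S \<longleftrightarrow> Idm C S \<noteq> 0 \<and> (\<forall>X m. is_mono X S m \<longrightarrow> Idm C X = 0 \<or> is_iso X S m)"

end

locale linear_category =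
  fixes C :: "('o, 'm::ab_group_add, 'z) linear_cat_scheme" (structure)
  assumes scl_vector_space: "vector_space (scl C)"
    and Hom_subspace: "module.subspace (scl C) (Hom C X Y)"
    and Hom_finite_dim:
      "\<exists>B. finite B \<and> B \<subseteq> Hom C X Y \<and> module.span (scl C) B = Hom C X Y"
    and Idm_in: "Idm C X \<in> Hom C X X"
    and cmp_in: "\<lbrakk>g \<in> Hom C Y Z; f \<in> Hom C X Y\<rbrakk> \<Longrightarrow> g \<cdot> f \<in> Hom C X Z"
    and cmp_assoc: "\<lbrakk>h \<in> Hom C Y Z; g \<in> Hom C X Y; f \<in> Hom C W X\<rbrakk>
      \<Longrightarrow> (h \<cdot> g) \<cdot> f = h \<cdot> (g \<cdot> f)"
    and Idm_left: "f \<in> Hom C X Y \<Longrightarrow> Idm C Y \<cdot> f = f"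
    and Idm_right: "f \<in> Hom C X Y \<Longrightarrow> f \<cdot> Idm C X = f"
    and cmp_add_left: "\<lbrakk>g \<in> Hom C Y Z; g' \<in> Hom C Y Z; f \<in> Hom C X Y\<rbrakk>
      \<Longrightarrow> (g + g') \<cdot> f = (g \<cdot> f) + (g' \<cdot> f)"
    and cmp_add_right: "\<lbrakk>g \<in> Hom C Y Z; f \<in> Hom C X Y; f' \<in> Hom C X Y\<rbrakk>
      \<Longrightarrow> g \<cdot> (f + f') = (g \<cdot> f) + (g \<cdot> f')"
    and cmp_scl_left: "\<lbrakk>g \<in> Hom C Y Z; f \<in> Hom C X Y\<rbrakk> \<Longrightarrow> (c \<bullet> g) \<cdot> f = c \<bullet> (g \<cdot> f)"
    and cmp_scl_right: "\<lbrakk>g \<in> Hom C Y Z; f \<in> Hom C X Y\<rbrakk> \<Longrightarrow> g \<cdot> (c \<bullet> f) = c \<bullet> (g \<cdot> f)"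

locale semisimple_abelian_category = linear_category +
  assumes zero_object: "\<exists>N. Idm C N = 0"
    and biproducts: "\<exists>Z i p. is_direct_sum C Z UNIV (\<lambda>b. if b then X else Y) i p"
    and kernels: "f \<in> Hom C X Y \<Longrightarrow> \<exists>K k. is_kernel C K X Y k f"
    and cokernels: "f \<in> Hom C X Y \<Longrightarrow> \<exists>Q q. is_cokernel C X Y Q f q"
    and mono_kernel: "is_mono C X Y f \<Longrightarrow> \<exists>Z g. is_kernel C X Y Z f g"
    and epi_cokernel: "is_epi C X Y f \<Longrightarrow> \<exists>W g. is_cokernel C W X Y g f"
    and semisimple: "\<exists>(n::nat) F i p. (\<forall>a<n. simple C (F a)) \<and> is_direct_sum C X {..<n} F i p"
    and finitely_many_simples: "\<exists>S. finite S \<and> (\<forall>X. simple C X \<longrightarrow> (\<exists>Y\<in>S. isomorphic C X Y))"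


section \<open>Rigid monoidal and pivotal structure\<close>

context
  fixes C :: "('o, 'm::ab_group_add, 'z) pivotal_cat_scheme" (structure)
begin

definition assoc_inv :: "'o \<Rightarrow> 'o \<Rightarrow> 'o \<Rightarrow> 'm" where
  "assoc_inv X Y Z = inv_mor C ((X \<boxtimes> Y) \<boxtimes> Z) (X \<boxtimes> (Y \<boxtimes> Z)) (assoc C X Y Z)"

definition lun_inv :: "'o \<Rightarrow> 'm" where
  "lun_inv X = inv_mor C (unit C \<boxtimes> X) X (lun C X)"

definition run_inv :: "'o \<Rightarrow> 'm" where
  "run_inv X = inv_mor C (X \<boxtimes> unit C) X (run C X)"

text \<open>The morphism \<open>A \<rightarrow> X\<^sup>*\<close> corresponding to a pairing \<open>e : A \<boxtimes> X \<rightarrow> \<one>\<close>.\<close>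

definition to_dual :: "'o \<Rightarrow> 'o \<Rightarrow> 'm \<Rightarrow> 'm" where
  "to_dual A X e =
     lun C (dual C X) \<cdot> (e \<boxtimes>\<^sub>m Idm C (dual C X)) \<cdot> assoc_inv A X (dual C X) \<cdot>
     (Idm C A \<boxtimes>\<^sub>m coev C X) \<cdot> run_inv A"

text \<open>The transpose \<open>Y\<^sup>* \<rightarrow> X\<^sup>*\<close> of \<open>f : X \<rightarrow> Y\<close>.\<close>

definition transp :: "'o \<Rightarrow> 'o \<Rightarrow> 'm \<Rightarrow> 'm" where
  "transp X Y f = to_dual (dual C Y) X (ev C Y \<cdot> (Idm C (dual C Y) \<boxtimes>\<^sub>m f))"

text \<open>The canonical isomorphism \<open>Y\<^sup>* \<boxtimes> X\<^sup>* \<rightarrow> (X \<boxtimes> Y)\<^sup>*\<close>.\<close>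

definition dual_tn :: "'o \<Rightarrow> 'o \<Rightarrow> 'm" where
  "dual_tn X Y = to_dual (dual C Y \<boxtimes> dual C X) (X \<boxtimes> Y)
     (ev C Y \<cdot> (Idm C (dual C Y) \<boxtimes>\<^sub>m
        (lun C Y \<cdot> (ev C X \<boxtimes>\<^sub>m Idm C Y) \<cdot> assoc_inv (dual C X) X Y)) \<cdot>
      assoc C (dual C Y) (dual C X) (X \<boxtimes> Y))"

text \<open>The canonical isomorphism \<open>\<one> \<rightarrow> \<one>\<^sup>*\<close>.\<close>

definition dual_unit :: 'm where
  "dual_unit = to_dual (unit C) (unit C) (lun C (unit C))"

text \<open>The evaluation \<open>X \<boxtimes> X\<^sup>* \<rightarrow> \<one>\<close> and coevaluation \<open>\<one> \<rightarrow> X\<^sup>* \<boxtimes> X\<close> obtained from \<open>\<delta>\<close>.\<close>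

definition ev' :: "'o \<Rightarrow> 'm" where
  "ev' X = ev C (dual C X) \<cdot> (piv C X \<boxtimes>\<^sub>m Idm C (dual C X))"

definition coev' :: "'o \<Rightarrow> 'm" where
  "coev' X = (Idm C (dual C X) \<boxtimes>\<^sub>m inv_mor C X (dual C (dual C X)) (piv C X)) \<cdot> coev C (dual C X)"

definition dimc :: "'o \<Rightarrow> complex" where
  "dimc X = (THE c. ev' X \<cdot> coev C X = c \<bullet> Idm C (unit C))"

text \<open>For \<open>f : V \<boxtimes> X \<rightarrow> V \<boxtimes> Y\<close>, the morphism \<open>X \<rightarrow> Y\<close> obtained by closing the strand \<open>V\<close>.\<close>

definition ptrace :: "'o \<Rightarrow> 'o \<Rightarrow> 'o \<Rightarrow> 'm \<Rightarrow> 'm" where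
  "ptrace V X Y f =
     lun C Y \<cdot> (ev C V \<boxtimes>\<^sub>m Idm C Y) \<cdot> assoc_inv (dual C V) V Y \<cdot>
     (Idm C (dual C V) \<boxtimes>\<^sub>m f) \<cdot>
     assoc C (dual C V) V X \<cdot> (coev' V \<boxtimes>\<^sub>m Idm C X) \<cdot> lun_inv X"

end

locale pivotal_fusion_category = semisimple_abelian_category C
  for C :: "('o, 'm::ab_group_add, 'z) pivotal_cat_scheme" (structure) +
  assumes tn_in: "\<lbrakk>f \<in> Hom C X Y; g \<in> Hom C X' Y'\<rbrakk> \<Longrightarrow> f \<boxtimes>\<^sub>m g \<in> Hom C (X \<boxtimes> X') (Y \<boxtimes> Y')"
    and tn_Idm: "Idm C X \<boxtimes>\<^sub>m Idm C Y = Idm C (X \<boxtimes> Y)"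
    and tn_cmp: "\<lbrakk>f \<in> Hom C X Y; g \<in> Hom C Y Z; f' \<in> Hom C X' Y'; g' \<in> Hom C Y' Z'\<rbrakk>
      \<Longrightarrow> (g \<cdot> f) \<boxtimes>\<^sub>m (g' \<cdot> f') = (g \<boxtimes>\<^sub>m g') \<cdot> (f \<boxtimes>\<^sub>m f')"
    and tn_add_left: "\<lbrakk>f \<in> Hom C X Y; f' \<in> Hom C X Y; g \<in> Hom C X' Y'\<rbrakk>
      \<Longrightarrow> (f + f') \<boxtimes>\<^sub>m g = (f \<boxtimes>\<^sub>m g) + (f' \<boxtimes>\<^sub>m g)"
    and tn_add_right: "\<lbrakk>f \<in> Hom C X Y; g \<in> Hom C X' Y'; g' \<in> Hom C X' Y'\<rbrakk>
      \<Longrightarrow> f \<boxtimes>\<^sub>m (g + g') = (f \<boxtimes>\<^sub>m g) + (f \<boxtimes>\<^sub>m g')"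
    and tn_scl_left: "\<lbrakk>f \<in> Hom C X Y; g \<in> Hom C X' Y'\<rbrakk> \<Longrightarrow> (c \<bullet> f) \<boxtimes>\<^sub>m g = c \<bullet> (f \<boxtimes>\<^sub>m g)"
    and tn_scl_right: "\<lbrakk>f \<in> Hom C X Y; g \<in> Hom C X' Y'\<rbrakk> \<Longrightarrow> f \<boxtimes>\<^sub>m (c \<bullet> g) = c \<bullet> (f \<boxtimes>\<^sub>m g)"
    and assoc_iso: "is_iso C ((X \<boxtimes> Y) \<boxtimes> Z) (X \<boxtimes> (Y \<boxtimes> Z)) (assoc C X Y Z)"
    and assoc_nat: "\<lbrakk>f \<in> Hom C X X'; g \<in> Hom C Y Y'; h \<in> Hom C Z Z'\<rbrakk>
      \<Longrightarrow> assoc C X' Y' Z' \<cdot> ((f \<boxtimes>\<^sub>m g) \<boxtimes>\<^sub>m h) = (f \<boxtimes>\<^sub>m (g \<boxtimes>\<^sub>m h)) \<cdot> assoc C X Y Z"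
    and lun_iso: "is_iso C (unit C \<boxtimes> X) X (lun C X)"
    and lun_nat: "f \<in> Hom C X Y \<Longrightarrow> lun C Y \<cdot> (Idm C (unit C) \<boxtimes>\<^sub>m f) = f \<cdot> lun C X"
    and run_iso: "is_iso C (X \<boxtimes> unit C) X (run C X)"
    and run_nat: "f \<in> Hom C X Y \<Longrightarrow> run C Y \<cdot> (f \<boxtimes>\<^sub>m Idm C (unit C)) = f \<cdot> run C X"
    and pentagon: "assoc C W X (Y \<boxtimes> Z) \<cdot> assoc C (W \<boxtimes> X) Y Z =
      (Idm C W \<boxtimes>\<^sub>m assoc C X Y Z) \<cdot> assoc C W (X \<boxtimes> Y) Z \<cdot> (assoc C W X Y \<boxtimes>\<^sub>m Idm C Z)"
    and triangle: "(Idm C X \<boxtimes>\<^sub>m lun C Y) \<cdot> assoc C X (unit C) Y = run C X \<boxtimes>\<^sub>m Idm C Y"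
    and unit_simple: "simple C (unit C)"
    and ev_in: "ev C X \<in> Hom C (dual C X \<boxtimes> X) (unit C)"
    and coev_in: "coev C X \<in> Hom C (unit C) (X \<boxtimes> dual C X)"
    and zigzag: "run C X \<cdot> (Idm C X \<boxtimes>\<^sub>m ev C X) \<cdot> assoc C X (dual C X) X \<cdot>
      (coev C X \<boxtimes>\<^sub>m Idm C X) \<cdot> lun_inv C X = Idm C X"
    and zigzag_dual: "lun C (dual C X) \<cdot> (ev C X \<boxtimes>\<^sub>m Idm C (dual C X)) \<cdot>
      assoc_inv C (dual C X) X (dual C X) \<cdot> (Idm C (dual C X) \<boxtimes>\<^sub>m coev C X) \<cdot>
      run_inv C (dual C X) = Idm C (dual C X)"
    and piv_iso: "is_iso C X (dual C (dual C X)) (piv C X)"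
    and piv_nat: "f \<in> Hom C X Y \<Longrightarrow>
      piv C Y \<cdot> f = transp C (dual C Y) (dual C X) (transp C X Y f) \<cdot> piv C X"
    \<comment> \<open>\<open>\<delta>\<^sub>X\<^sub>\<boxtimes>\<^sub>Y = \<delta>\<^sub>X \<boxtimes> \<delta>\<^sub>Y\<close>, \<open>\<delta>\<^sub>\<one> = id\<close> (up to canonical isomorphisms) and \<open>\<delta>\<^sub>X\<^sub>* = (\<delta>\<^sub>X\<^sup>*)\<^sup>-\<^sup>1\<close>\<close>
    and piv_tn: "transp C (dual C Y \<boxtimes> dual C X) (dual C (X \<boxtimes> Y)) (dual_tn C X Y) \<cdot> piv C (X \<boxtimes> Y) =
      dual_tn C (dual C Y) (dual C X) \<cdot> (piv C X \<boxtimes>\<^sub>m piv C Y)"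
    and piv_unit: "transp C (unit C) (dual C (unit C)) (dual_unit C) \<cdot> piv C (unit C) = dual_unit C"
    and piv_dual: "transp C X (dual C (dual C X)) (piv C X) \<cdot> piv C (dual C X) = Idm C (dual C X)"


section \<open>Equivariant fusion categories\<close>

context
  fixes G :: "('g, 'y) monoid_scheme"
    and C :: "('g, 'o, 'm::ab_group_add, 'z) equivariant_cat_scheme" (structure)
begin

text \<open>The canonical isomorphism \<open>R\<^sub>g (X\<^sup>*) \<rightarrow> (R\<^sub>g X)\<^sup>*\<close>.\<close>

definition act_dual :: "'g \<Rightarrow> 'o \<Rightarrow> 'm" where
  "act_dual g X = to_dual C (actO C g (dual C X)) (actO C g X)
     (inv_mor C (unit C) (actO C g (unit C)) (eta C g) \<cdot> actM C g (ev C X) \<cdot> mu C g (dual C X) X)"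

text \<open>
  For \<open>f : X \<rightarrow> R\<^sub>g X\<close> the adjoint is \<open>R\<^sub>g (X\<^sup>*) \<cong> (R\<^sub>g X)\<^sup>* \<rightarrow> X\<^sup>*\<close>; applying \<open>R\<close> at \<open>g\<^sup>-\<^sup>1\<close> turns it
  into a morphism from \<open>X\<^sup>*\<close> to its translate by \<open>g\<^sup>-\<^sup>1\<close>.
\<close>

definition adjoint :: "'g \<Rightarrow> 'o \<Rightarrow> 'm \<Rightarrow> 'm" where
  "adjoint g X f =
     actM C (inv\<^bsub>G\<^esub> g) (transp C X (actO C g X) f \<cdot> act_dual g X) \<cdot>
     inv_mor C (actO C (inv\<^bsub>G\<^esub> g) (actO C g (dual C X))) (dual C X) (alpha C (inv\<^bsub>G\<^esub> g) g (dual C X))"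

text \<open>The twist \<open>\<theta>\<^sub>X : X \<rightarrow> R\<^sub>g X\<close> for \<open>X \<in> \<C>\<^sub>g\<close>: the right partial trace of the braiding of \<open>X\<close>
  with itself.\<close>

definition twist :: "'g \<Rightarrow> 'o \<Rightarrow> 'm" where
  "twist g X =
     run C (actO C g X) \<cdot> (Idm C (actO C g X) \<boxtimes>\<^sub>m ev' C X) \<cdot> assoc C (actO C g X) X (dual C X) \<cdot>
     (braid C g X X \<boxtimes>\<^sub>m Idm C (dual C X)) \<cdot>
     assoc_inv C X X (dual C X) \<cdot> (Idm C X \<boxtimes>\<^sub>m coev C X) \<cdot> run_inv C X"

text \<open>
  For \<open>X \<in> \<C>\<^sub>h\<close>, \<open>W \<in> \<C>\<^sub>g\<close> and \<open>f : X \<rightarrow> R\<^sub>g X\<close>, where \<open>g\<close> and \<open>h\<close> commute: the morphism from \<open>W\<close> to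
  its translate by \<open>h\<^sup>-\<^sup>1\<close> given by encircling the strand \<open>W\<close> by an \<open>X\<close>-coloured loop carrying \<open>f\<close>.
\<close>

definition loop :: "'g \<Rightarrow> 'g \<Rightarrow> 'o \<Rightarrow> 'm \<Rightarrow> 'o \<Rightarrow> 'm" where
  "loop g h X f W =
    (let W' = actO C (inv\<^bsub>G\<^esub> h) W in
     ptrace C X W W'
       (inv_mor C (X \<boxtimes> W') (W \<boxtimes> X) ((alpha C h (inv\<^bsub>G\<^esub> h) W \<boxtimes>\<^sub>m Idm C X) \<cdot> braid C h X W') \<cdot>
        inv_mor C (W \<boxtimes> X) (actO C g X \<boxtimes> W) (braid C g W X) \<cdot>
        (f \<boxtimes>\<^sub>m Idm C W)))"

end

locale equivariant_fusion_category = pivotal_fusion_category C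
  for C :: "('g, 'o, 'm::ab_group_add, 'z) equivariant_cat_scheme" (structure)
    and G :: "('g, 'y) monoid_scheme" +
  assumes group: "group G"
    and finite_group: "finite (carrier G)"
    \<comment> \<open>the grading\<close>
    and deg_replete: "\<lbrakk>g \<in> carrier G; X \<in> deg C g; isomorphic C X Y\<rbrakk> \<Longrightarrow> Y \<in> deg C g"
    and deg_orthogonal: "\<lbrakk>g \<in> carrier G; h \<in> carrier G; g \<noteq> h; X \<in> deg C g; Y \<in> deg C h\<rbrakk>
      \<Longrightarrow> Hom C X Y = {0}"
    and deg_decomp: "\<exists>F i p. (\<forall>g\<in>carrier G. F g \<in> deg C g) \<and> is_direct_sum C X (carrier G) F i p"
    and deg_tn: "\<lbrakk>g \<in> carrier G; h \<in> carrier G; X \<in> deg C g; Y \<in> deg C h\<rbrakk>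
      \<Longrightarrow> X \<boxtimes> Y \<in> deg C (g \<otimes>\<^bsub>G\<^esub> h)"
    \<comment> \<open>the linear functors \<open>R\<^sub>g\<close>\<close>
    and act_in: "\<lbrakk>g \<in> carrier G; f \<in> Hom C X Y\<rbrakk> \<Longrightarrow> actM C g f \<in> Hom C (actO C g X) (actO C g Y)"
    and act_Idm: "g \<in> carrier G \<Longrightarrow> actM C g (Idm C X) = Idm C (actO C g X)"
    and act_cmp: "\<lbrakk>g \<in> carrier G; f \<in> Hom C X Y; f' \<in> Hom C Y Z\<rbrakk>
      \<Longrightarrow> actM C g (f' \<cdot> f) = actM C g f' \<cdot> actM C g f"
    and act_add: "\<lbrakk>g \<in> carrier G; f \<in> Hom C X Y; f' \<in> Hom C X Y\<rbrakk>
      \<Longrightarrow> actM C g (f + f') = actM C g f + actM C g f'"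
    and act_scl: "\<lbrakk>g \<in> carrier G; f \<in> Hom C X Y\<rbrakk> \<Longrightarrow> actM C g (c \<bullet> f) = c \<bullet> actM C g f"
    and act_deg: "\<lbrakk>g \<in> carrier G; h \<in> carrier G; X \<in> deg C h\<rbrakk>
      \<Longrightarrow> actO C g X \<in> deg C (g \<otimes>\<^bsub>G\<^esub> h \<otimes>\<^bsub>G\<^esub> inv\<^bsub>G\<^esub> g)"
    \<comment> \<open>the monoidal structure of \<open>R\<^sub>g\<close>\<close>
    and mu_iso: "g \<in> carrier G
      \<Longrightarrow> is_iso C (actO C g X \<boxtimes> actO C g Y) (actO C g (X \<boxtimes> Y)) (mu C g X Y)"
    and mu_nat: "\<lbrakk>g \<in> carrier G; f \<in> Hom C X X'; f' \<in> Hom C Y Y'\<rbrakk>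
      \<Longrightarrow> mu C g X' Y' \<cdot> (actM C g f \<boxtimes>\<^sub>m actM C g f') = actM C g (f \<boxtimes>\<^sub>m f') \<cdot> mu C g X Y"
    and mu_assoc: "g \<in> carrier G \<Longrightarrow>
      actM C g (assoc C X Y Z) \<cdot> mu C g (X \<boxtimes> Y) Z \<cdot> (mu C g X Y \<boxtimes>\<^sub>m Idm C (actO C g Z)) =
      mu C g X (Y \<boxtimes> Z) \<cdot> (Idm C (actO C g X) \<boxtimes>\<^sub>m mu C g Y Z) \<cdot>
        assoc C (actO C g X) (actO C g Y) (actO C g Z)"
    and eta_iso: "g \<in> carrier G \<Longrightarrow> is_iso C (unit C) (actO C g (unit C)) (eta C g)"
    and mu_lun: "g \<in> carrier G \<Longrightarrow>
      actM C g (lun C X) \<cdot> mu C g (unit C) X \<cdot> (eta C g \<boxtimes>\<^sub>m Idm C (actO C g X)) =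
      lun C (actO C g X)"
    and mu_run: "g \<in> carrier G \<Longrightarrow>
      actM C g (run C X) \<cdot> mu C g X (unit C) \<cdot> (Idm C (actO C g X) \<boxtimes>\<^sub>m eta C g) =
      run C (actO C g X)"
    \<comment> \<open>the monoidal isomorphisms \<open>R\<^sub>g R\<^sub>h \<simeq> R\<^sub>g\<^sub>h\<close> and their coherence\<close>
    and alpha_iso: "\<lbrakk>g \<in> carrier G; h \<in> carrier G\<rbrakk>
      \<Longrightarrow> is_iso C (actO C g (actO C h X)) (actO C (g \<otimes>\<^bsub>G\<^esub> h) X) (alpha C g h X)"
    and alpha_nat: "\<lbrakk>g \<in> carrier G; h \<in> carrier G; f \<in> Hom C X Y\<rbrakk>
      \<Longrightarrow> alpha C g h Y \<cdot> actM C g (actM C h f) = actM C (g \<otimes>\<^bsub>G\<^esub> h) f \<cdot> alpha C g h X"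
    and alpha_mu: "\<lbrakk>g \<in> carrier G; h \<in> carrier G\<rbrakk> \<Longrightarrow>
      alpha C g h (X \<boxtimes> Y) \<cdot> actM C g (mu C h X Y) \<cdot> mu C g (actO C h X) (actO C h Y) =
      mu C (g \<otimes>\<^bsub>G\<^esub> h) X Y \<cdot> (alpha C g h X \<boxtimes>\<^sub>m alpha C g h Y)"
    and alpha_eta: "\<lbrakk>g \<in> carrier G; h \<in> carrier G\<rbrakk> \<Longrightarrow>
      alpha C g h (unit C) \<cdot> actM C g (eta C h) \<cdot> eta C g = eta C (g \<otimes>\<^bsub>G\<^esub> h)"
    and alpha_assoc: "\<lbrakk>g \<in> carrier G; h \<in> carrier G; k \<in> carrier G\<rbrakk> \<Longrightarrow>
      alpha C (g \<otimes>\<^bsub>G\<^esub> h) k X \<cdot> alpha C g h (actO C k X) =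
      alpha C g (h \<otimes>\<^bsub>G\<^esub> k) X \<cdot> actM C g (alpha C h k X)"
    and act_one: "actO C \<one>\<^bsub>G\<^esub> X = X" "f \<in> Hom C X Y \<Longrightarrow> actM C \<one>\<^bsub>G\<^esub> f = f"
    and alpha_one: "g \<in> carrier G \<Longrightarrow> alpha C \<one>\<^bsub>G\<^esub> g X = Idm C (actO C g X)"
      "g \<in> carrier G \<Longrightarrow> alpha C g \<one>\<^bsub>G\<^esub> X = Idm C (actO C g X)"
    \<comment> \<open>\<open>R\<^sub>g(\<delta>\<^sub>X) = \<delta>\<close> at \<open>R\<^sub>g X\<close>, both sides composed with the canonical isomorphism to \<open>(R\<^sub>g(X\<^sup>*))\<^sup>*\<close>\<close>
    and act_piv: "g \<in> carrier G \<Longrightarrow>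
      act_dual C g (dual C X) \<cdot> actM C g (piv C X) =
      transp C (actO C g (dual C X)) (dual C (actO C g X)) (act_dual C g X) \<cdot> piv C (actO C g X)"
    \<comment> \<open>the \<open>G\<close>-crossed braiding\<close>
    and braid_iso: "\<lbrakk>g \<in> carrier G; X \<in> deg C g\<rbrakk>
      \<Longrightarrow> is_iso C (X \<boxtimes> Y) (actO C g Y \<boxtimes> X) (braid C g X Y)"
    and braid_nat: "\<lbrakk>g \<in> carrier G; X \<in> deg C g; X' \<in> deg C g; f \<in> Hom C X X'; f' \<in> Hom C Y Y'\<rbrakk>
      \<Longrightarrow> braid C g X' Y' \<cdot> (f \<boxtimes>\<^sub>m f') = (actM C g f' \<boxtimes>\<^sub>m f) \<cdot> braid C g X Y"
    and braid_tn_right: "\<lbrakk>g \<in> carrier G; X \<in> deg C g\<rbrakk> \<Longrightarrow>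
      braid C g X (Y \<boxtimes> Z) =
      (mu C g Y Z \<boxtimes>\<^sub>m Idm C X) \<cdot> assoc_inv C (actO C g Y) (actO C g Z) X \<cdot>
      (Idm C (actO C g Y) \<boxtimes>\<^sub>m braid C g X Z) \<cdot> assoc C (actO C g Y) X Z \<cdot>
      (braid C g X Y \<boxtimes>\<^sub>m Idm C Z) \<cdot> assoc_inv C X Y Z"
    and braid_tn_left: "\<lbrakk>g \<in> carrier G; h \<in> carrier G; X \<in> deg C g; Y \<in> deg C h\<rbrakk> \<Longrightarrow>
      braid C (g \<otimes>\<^bsub>G\<^esub> h) (X \<boxtimes> Y) Z =
      (alpha C g h Z \<boxtimes>\<^sub>m Idm C (X \<boxtimes> Y)) \<cdot> assoc C (actO C g (actO C h Z)) X Y \<cdot>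
      (braid C g X (actO C h Z) \<boxtimes>\<^sub>m Idm C Y) \<cdot> assoc_inv C X (actO C h Z) Y \<cdot>
      (Idm C X \<boxtimes>\<^sub>m braid C h Y Z) \<cdot> assoc C X Y Z"
    and act_braid: "\<lbrakk>k \<in> carrier G; g \<in> carrier G; X \<in> deg C g\<rbrakk> \<Longrightarrow>
      actM C k (braid C g X Y) \<cdot> mu C k X Y =
      mu C k (actO C g Y) X \<cdot>
      ((inv_mor C (actO C k (actO C g Y)) (actO C (k \<otimes>\<^bsub>G\<^esub> g) Y) (alpha C k g Y) \<cdot>
        alpha C (k \<otimes>\<^bsub>G\<^esub> g \<otimes>\<^bsub>G\<^esub> inv\<^bsub>G\<^esub> k) k Y) \<boxtimes>\<^sub>m Idm C (actO C k X)) \<cdot>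
      braid C (k \<otimes>\<^bsub>G\<^esub> g \<otimes>\<^bsub>G\<^esub> inv\<^bsub>G\<^esub> k) (actO C k X) (actO C k Y)"
    \<comment> \<open>the ribbon condition \<open>\<theta>\<^sub>X\<^sub>* = \<theta>\<^sub>X\<^sup>*\<close>\<close>
    and twist_dual: "\<lbrakk>g \<in> carrier G; X \<in> deg C g\<rbrakk>
      \<Longrightarrow> twist C (inv\<^bsub>G\<^esub> g) (dual C X) = adjoint G C g X (twist C g X)"


section \<open>The extended Verlinde algebra\<close>

text \<open>
  \<open>I\<close> is the index set of the chosen representatives \<open>V i\<close> of the simple objects, with \<open>V i0 = \<one>\<close>.
  An element of the extended Verlinde algebra is a family \<open>x\<close> with \<open>x g h i : V i \<rightarrow> R\<^sub>g (V i)\<close> for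
  commuting \<open>g\<close>, \<open>h\<close> and \<open>i \<in> I\<^sub>h\<close>, extended by zero; it lies in the summand \<open>(g, h)\<close> if it is
  supported there.
\<close>

definition simple_reps ::
    "('o, 'm::ab_group_add, 'z) pivotal_cat_scheme \<Rightarrow> 'i set \<Rightarrow> ('i \<Rightarrow> 'o) \<Rightarrow> 'i \<Rightarrow> bool" where
  "simple_reps C I V i0 \<longleftrightarrow>
     (\<forall>i\<in>I. simple C (V i)) \<and>
     (\<forall>X. simple C X \<longrightarrow> (\<exists>!i. i \<in> I \<and> isomorphic C X (V i))) \<and>
     i0 \<in> I \<and> V i0 = unit C"

context
  fixes G :: "('g, 'y) monoid_scheme"
    and C :: "('g, 'o, 'm::ab_group_add, 'z) equivariant_cat_scheme" (structure)
    and I :: "'i set"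
    and V :: "'i \<Rightarrow> 'o"
begin

definition Ideg :: "'g \<Rightarrow> 'i set" where
  "Ideg h = {i \<in> I. V i \<in> deg C h}"

definition Iinv :: "'g \<Rightarrow> 'g \<Rightarrow> 'i set" where
  "Iinv g h = {i \<in> Ideg h. isomorphic C (actO C g (V i)) (V i)}"

definition commuting :: "'g \<Rightarrow> 'g \<Rightarrow> bool" where
  "commuting g h \<longleftrightarrow> g \<in> carrier G \<and> h \<in> carrier G \<and> g \<otimes>\<^bsub>G\<^esub> h = h \<otimes>\<^bsub>G\<^esub> g"

definition Verl :: "('g \<Rightarrow> 'g \<Rightarrow> 'i \<Rightarrow> 'm) set" where
  "Verl = {x. \<forall>g h i. if commuting g h \<and> i \<in> Ideg h
                       then x g h i \<in> Hom C (V i) (actO C g (V i)) else x g h i = 0}"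

definition Verl_comp :: "'g \<Rightarrow> 'g \<Rightarrow> ('g \<Rightarrow> 'g \<Rightarrow> 'i \<Rightarrow> 'm) set" where
  "Verl_comp g h = {x \<in> Verl. \<forall>g' h' i. (g', h') \<noteq> (g, h) \<longrightarrow> x g' h' i = 0}"

definition single :: "'g \<Rightarrow> 'g \<Rightarrow> 'i \<Rightarrow> 'm \<Rightarrow> ('g \<Rightarrow> 'g \<Rightarrow> 'i \<Rightarrow> 'm)" where
  "single g h i f = (\<lambda>g' h' i'. if g' = g \<and> h' = h \<and> i' = i then f else 0)"

definition vadd :: "('g \<Rightarrow> 'g \<Rightarrow> 'i \<Rightarrow> 'm) \<Rightarrow> ('g \<Rightarrow> 'g \<Rightarrow> 'i \<Rightarrow> 'm) \<Rightarrow> ('g \<Rightarrow> 'g \<Rightarrow> 'i \<Rightarrow> 'm)" where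
  "vadd x y = (\<lambda>g h i. x g h i + y g h i)"

definition vscl :: "complex \<Rightarrow> ('g \<Rightarrow> 'g \<Rightarrow> 'i \<Rightarrow> 'm) \<Rightarrow> ('g \<Rightarrow> 'g \<Rightarrow> 'i \<Rightarrow> 'm)" where
  "vscl c x = (\<lambda>g h i. c \<bullet> x g h i)"

definition linear_operator_on ::
    "('g \<Rightarrow> 'g \<Rightarrow> 'i \<Rightarrow> 'm) set \<Rightarrow> (('g \<Rightarrow> 'g \<Rightarrow> 'i \<Rightarrow> 'm) \<Rightarrow> ('g \<Rightarrow> 'g \<Rightarrow> 'i \<Rightarrow> 'm)) \<Rightarrow> bool" where
  "linear_operator_on A T \<longleftrightarrow>
     (\<forall>x\<in>A. T x \<in> A) \<and>
     (\<forall>x\<in>A. \<forall>y\<in>A. T (vadd x y) = vadd (T x) (T y)) \<and>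
     (\<forall>c. \<forall>x\<in>A. T (vscl c x) = vscl c (T x))"

text \<open>
  The class of \<open>f : X \<rightarrow> R\<^sub>g X\<close>: choose a decomposition of \<open>X\<close> into a direct sum of the \<open>V i\<close> and
  add up the diagonal components of \<open>f\<close>.  The result does not depend on the choice.
\<close>

definition cls :: "'g \<Rightarrow> 'o \<Rightarrow> 'm \<Rightarrow> 'i \<Rightarrow> 'm" where
  "cls g X f =
    (let (n, e, i, p) = (SOME (n::nat, e, i, p). (\<forall>a<n. e a \<in> I) \<and>
                            is_direct_sum C X {..<n} (\<lambda>a. V (e a)) i p)
     in (\<lambda>k. \<Sum>a | a < n \<and> e a = k. actM C g (p a) \<cdot> f \<cdot> i a))"

definition vtimes :: "('g \<Rightarrow> 'g \<Rightarrow> 'i \<Rightarrow> 'm) \<Rightarrow> ('g \<Rightarrow> 'g \<Rightarrow> 'i \<Rightarrow> 'm) \<Rightarrow> ('g \<Rightarrow> 'g \<Rightarrow> 'i \<Rightarrow> 'm)" where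
  "vtimes x y = (\<lambda>g c k. if commuting g c \<and> k \<in> Ideg c then
     \<Sum>(a, b) | commuting g a \<and> commuting g b \<and> a \<otimes>\<^bsub>G\<^esub> b = c.
       \<Sum>i\<in>Ideg a. \<Sum>j\<in>Ideg b.
         cls g (V i \<boxtimes> V j) (mu C g (V i) (V j) \<cdot> (x g a i \<boxtimes>\<^sub>m y g b j)) k
     else 0)"

definition vstar :: "('g \<Rightarrow> 'g \<Rightarrow> 'i \<Rightarrow> 'm) \<Rightarrow> ('g \<Rightarrow> 'g \<Rightarrow> 'i \<Rightarrow> 'm)" where
  "vstar x = (\<lambda>g h k. if commuting g h \<and> k \<in> Ideg h then
     \<Sum>i\<in>Ideg (inv\<^bsub>G\<^esub> h).
       cls g (dual C (V i)) (adjoint G C (inv\<^bsub>G\<^esub> g) (V i) (x (inv\<^bsub>G\<^esub> g) (inv\<^bsub>G\<^esub> h) i)) k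
     else 0)"

definition vcoeff0 :: "'i \<Rightarrow> ('g \<Rightarrow> 'g \<Rightarrow> 'i \<Rightarrow> 'm) \<Rightarrow> complex" where
  "vcoeff0 i0 x = (\<Sum>g\<in>carrier G. THE c. x g \<one>\<^bsub>G\<^esub> i0 = c \<bullet> eta C g)"

definition vform :: "'i \<Rightarrow> ('g \<Rightarrow> 'g \<Rightarrow> 'i \<Rightarrow> 'm) \<Rightarrow> ('g \<Rightarrow> 'g \<Rightarrow> 'i \<Rightarrow> 'm) \<Rightarrow> complex" where
  "vform i0 x y = vcoeff0 i0 (vtimes x (vstar y))"

text \<open>The component \<open>(g, h)\<close> of \<open>x\<close> contributes to the component \<open>(a, b) = (h\<^sup>-\<^sup>1, g)\<close> of the image.\<close>

definition s_tilde :: "('g \<Rightarrow> 'g \<Rightarrow> 'i \<Rightarrow> 'm) \<Rightarrow> ('g \<Rightarrow> 'g \<Rightarrow> 'i \<Rightarrow> 'm)" where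
  "s_tilde x = (\<lambda>a b k. if commuting a b \<and> k \<in> Iinv a b then
     \<Sum>i\<in>Ideg (inv\<^bsub>G\<^esub> a).
       dimc C (V k) \<bullet> loop G C b (inv\<^bsub>G\<^esub> a) (V i) (x b (inv\<^bsub>G\<^esub> a) i) (V k)
     else 0)"

definition modular :: bool where
  "modular \<longleftrightarrow> bij_betw s_tilde Verl Verl"

definition theta :: "'i \<Rightarrow> complex" where
  "theta i = (THE c. twist C \<one>\<^bsub>G\<^esub> (V i) = c \<bullet> Idm C (V i))"

definition p_plus :: complex where
  "p_plus = (\<Sum>i\<in>Ideg \<one>\<^bsub>G\<^esub>. theta i * (dimc C (V i))\<^sup>2)"

definition p_minus :: complex where
  "p_minus = (\<Sum>i\<in>Ideg \<one>\<^bsub>G\<^esub>. inverse (theta i) * (dimc C (V i))\<^sup>2)"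

text \<open>The normalisation \<open>D\<close> is a parameter, to be instantiated by a square root of \<open>p_plus * p_minus\<close>.\<close>

definition s_op :: "complex \<Rightarrow> ('g \<Rightarrow> 'g \<Rightarrow> 'i \<Rightarrow> 'm) \<Rightarrow> ('g \<Rightarrow> 'g \<Rightarrow> 'i \<Rightarrow> 'm)" where
  "s_op D x = vscl (inverse D) (s_tilde x)"

definition generic_basis :: "('g \<Rightarrow> 'i \<Rightarrow> 'm) \<Rightarrow> bool" where
  "generic_basis lam \<longleftrightarrow>
     (\<forall>g\<in>carrier G. \<forall>i\<in>I. isomorphic C (actO C g (V i)) (V i) \<longrightarrow>
        lam g i \<in> Hom C (V i) (actO C g (V i)) \<and> lam g i \<noteq> 0) \<and>
     (\<forall>i\<in>I. lam \<one>\<^bsub>G\<^esub> i = Idm C (V i))"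

end

end

theory Submission
  imports Defs "HOL-Computational_Algebra.Fundamental_Theorem_Algebra"
begin

text \<open>
  By naturality of the braiding and cyclicity of the partial trace, a loop around a strand \<open>V\<^sub>k\<close> coloured
  by a direct sum is the sum of the loops coloured by the summands, with the diagonal components on
  them.  Hence the \<open>k\<close>-th component of \<open>s (\<lambda>\<^sub>i \<otimes> x)\<close> is a sum of loops coloured by \<open>V\<^sub>i \<boxtimes> V\<^sub>j\<close>.  By the hexagon
  axioms and the compatibility of the pivotal structure with the tensor product such a loop may be
  replaced by an inner loop coloured by \<open>V\<^sub>i\<close> and an outer one coloured by \<open>V\<^sub>j\<close>; by Schur's lemma the
  inner loop is a scalar \<open>\<sigma>\<^sub>i\<^sub>k\<close>, so that \<open>s\<close> turns multiplication by \<open>\<lambda>\<^sub>i\<close> into multiplication of the \<open>k\<close>-th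
  component by \<open>\<sigma>\<^sub>i\<^sub>k\<close>.  Finally \<open>(s \<lambda>\<^sub>i, \<lambda>\<^sub>k) = D\<^sup>-\<^sup>1 d\<^sub>k \<sigma>\<^sub>i\<^sub>k\<close>, because the bilinear form picks out the coefficient
  at \<open>\<lambda>\<^sub>k\<close>, and modularity gives \<open>d\<^sub>k \<noteq> 0\<close> and \<open>\<sigma>\<^sub>0\<^sub>k = 1\<close>.
\<close>

section \<open>Typed arrows\<close>

text \<open>Nothing is strict, so associators, unit constraints and duality constraints pervade
  every loop. They are tamed by carrying a spare object to the right of each evaluation and
  coevaluation: duality then becomes a pair of adjunctions between endofunctors, and identities for
  coevaluations are the mates of identities for evaluations. The action constraints mostly disappear
  for reasons of degree. The source component \<open>(1, g)\<close> consists of endomorphisms and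
  the target component \<open>(g\<^sup>-\<^sup>1, 1)\<close> involves only strands of degree one, so
  one of the two crossings is an ordinary braiding. As \<open>V i\<close> has degree one too, the
  inner loop is an endomorphism of \<open>V k\<close>, which is what Schur's lemma requires. The
  bilinear form involves the dual of \<open>V k\<close>, known only up to isomorphism as some
  \<open>V k'\<close>. Extracting a coefficient rests on the multiplicity of the unit in
  \<open>V j \<boxtimes> V k'\<close>, computed by Frobenius reciprocity. The operator with the
  prescribed eigenvalues is given only on basis vectors, so \<open>s x\<close> has to be supported
  on the invariant labels before the two sides can be compared.\<close>

text \<open>
  Composition of arrows returns a zero morphism on a mismatch of types.  This makes it associative
  without side conditions, so that the simplifier can rebracket composites.
\<close>

datatype ('o, 'm) arr = Arr (dm: 'o) (mr: 'm) (cd: 'o)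

context linear_category
begin

definition valid :: "('o, 'm) arr \<Rightarrow> bool" where
  "valid t \<longleftrightarrow> mr t \<in> Hom C (dm t) (cd t)"

definition acmp :: "('o, 'm) arr \<Rightarrow> ('o, 'm) arr \<Rightarrow> ('o, 'm) arr" (infixr "\<odot>" 55) where
  "t \<odot> u = Arr (dm u) (if valid t \<and> valid u \<and> cd u = dm t then mr t \<cdot> mr u else 0) (cd t)"

definition ide :: "'o \<Rightarrow> ('o, 'm) arr" where
  "ide X = Arr X (Idm C X) X"

lemma zero_in [simp]: "0 \<in> Hom C X Y"
proof -
  interpret vector_space "scl C" by (rule scl_vector_space)
  show ?thesis using Hom_subspace[of X Y] by (rule subspace_0)
qed

lemma dm_acmp [simp]: "dm (t \<odot> u) = dm u" and cd_acmp [simp]: "cd (t \<odot> u) = cd t"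
  by (simp_all add: acmp_def)

lemma valid_acmp [simp]: "valid (t \<odot> u)"
  by (auto simp: acmp_def valid_def intro: cmp_in)

lemma valid_Arr: "f \<in> Hom C X Y \<Longrightarrow> valid (Arr X f Y)"
  by (simp add: valid_def)

lemma dm_ide [simp]: "dm (ide X) = X" and cd_ide [simp]: "cd (ide X) = X"
  and mr_ide [simp]: "mr (ide X) = Idm C X" and valid_ide [simp]: "valid (ide X)"
  by (simp_all add: ide_def valid_def Idm_in)

lemma add_in: "\<lbrakk>f \<in> Hom C X Y; g \<in> Hom C X Y\<rbrakk> \<Longrightarrow> f + g \<in> Hom C X Y"
  and scl_in: "f \<in> Hom C X Y \<Longrightarrow> c \<bullet> f \<in> Hom C X Y"
  and diff_in: "\<lbrakk>f \<in> Hom C X Y; g \<in> Hom C X Y\<rbrakk> \<Longrightarrow> f - g \<in> Hom C X Y"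
proof -
  interpret vector_space "scl C" by (rule scl_vector_space)
  show "\<lbrakk>f \<in> Hom C X Y; g \<in> Hom C X Y\<rbrakk> \<Longrightarrow> f + g \<in> Hom C X Y"
    "f \<in> Hom C X Y \<Longrightarrow> c \<bullet> f \<in> Hom C X Y"
    "\<lbrakk>f \<in> Hom C X Y; g \<in> Hom C X Y\<rbrakk> \<Longrightarrow> f - g \<in> Hom C X Y"
    using Hom_subspace[of X Y] subspace_add subspace_scale subspace_diff by blast+
qed

lemma sum_in: "(\<And>a. a \<in> A \<Longrightarrow> f a \<in> Hom C X Y) \<Longrightarrow> (\<Sum>a\<in>A. f a) \<in> Hom C X Y"
  by (induction A rule: infinite_finite_induct) (auto intro: add_in)

lemma scl_0_right [simp]: "c \<bullet> 0 = 0" and scl_0_left [simp]: "0 \<bullet> f = 0"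
  and scl_1 [simp]: "1 \<bullet> f = f" and scl_scl: "c \<bullet> d \<bullet> f = (c * d) \<bullet> f"
  and scl_add_right: "c \<bullet> (f + g) = (c \<bullet> f) + (c \<bullet> g)"
  and scl_add_left: "(c + d) \<bullet> f = (c \<bullet> f) + (d \<bullet> f)"
  and scl_eq_0 [simp]: "c \<bullet> f = 0 \<longleftrightarrow> c = 0 \<or> f = 0"
  and scl_minus_left: "(- c) \<bullet> f = - (c \<bullet> f)"
  and scl_sum_right: "c \<bullet> (\<Sum>a\<in>A. F a) = (\<Sum>a\<in>A. c \<bullet> F a)"
proof -
  interpret vector_space "scl C" by (rule scl_vector_space)
  show "c \<bullet> 0 = 0" "0 \<bullet> f = 0" "1 \<bullet> f = f" "c \<bullet> d \<bullet> f = (c * d) \<bullet> f"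
    "c \<bullet> (f + g) = (c \<bullet> f) + (c \<bullet> g)" "(c + d) \<bullet> f = (c \<bullet> f) + (d \<bullet> f)"
    "c \<bullet> f = 0 \<longleftrightarrow> c = 0 \<or> f = 0" "(- c) \<bullet> f = - (c \<bullet> f)"
    "c \<bullet> (\<Sum>a\<in>A. F a) = (\<Sum>a\<in>A. c \<bullet> F a)"
    by (simp_all add: scale_right_distrib scale_left_distrib scale_sum_right)
qed

lemma cmp_0_right [simp]: "g \<in> Hom C Y Z \<Longrightarrow> g \<cdot> 0 = 0"
  using cmp_add_right[of g Y Z 0 _ 0] by simp

lemma cmp_0_left [simp]: "f \<in> Hom C X Y \<Longrightarrow> 0 \<cdot> f = 0"
  using cmp_add_left[of 0 Y _ 0 f] by simp

lemma arr_eqI: "\<lbrakk>dm t = dm u; cd t = cd u; mr t = mr u\<rbrakk> \<Longrightarrow> t = u"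
  by (rule arr.expand) simp

text \<open>On a mismatch both bracketings carry the morphism 0: a failing inner composite is
  already 0, and composing 0 with a valid arrow gives 0.\<close>

lemma acmp_assoc: "(t \<odot> u) \<odot> v = t \<odot> (u \<odot> v)"
proof (cases "valid t \<and> valid u \<and> valid v \<and> cd u = dm t \<and> cd v = dm u")
  case True
  then have t: "mr t \<in> Hom C (cd u) (cd t)" and u: "mr u \<in> Hom C (cd v) (cd u)"
    and v: "mr v \<in> Hom C (dm v) (cd v)" by (auto simp: valid_def)
  from True show ?thesis
    using cmp_assoc[OF t u v] cmp_in[OF t u] cmp_in[OF u v] t u v by (simp add: acmp_def valid_def)
next
  case False
  have z: "valid s \<Longrightarrow> 0 \<cdot> mr s = 0" "valid s \<Longrightarrow> mr s \<cdot> 0 = 0" for s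
    unfolding valid_def by (blast intro: cmp_0_left cmp_0_right)+
  have "mr ((t \<odot> u) \<odot> v) = 0"
    using False z by (auto simp: acmp_def[of "t \<odot> u"]) (auto simp: acmp_def)
  moreover have "mr (t \<odot> (u \<odot> v)) = 0"
    using False z by (auto simp: acmp_def[of t "u \<odot> v"]) (auto simp: acmp_def)
  ultimately show ?thesis by (intro arr_eqI) simp_all
qed

lemma mr_acmp: "\<lbrakk>valid t; valid u; cd u = dm t\<rbrakk> \<Longrightarrow> mr (t \<odot> u) = mr t \<cdot> mr u"
  by (simp add: acmp_def)

lemma ide_left [simp]: assumes "valid t" "cd t = X" shows "ide X \<odot> t = t"
proof (rule arr_eqI)
  show "mr (ide X \<odot> t) = mr t"
    using mr_acmp[OF valid_ide[of X] assms(1)] Idm_left[of "mr t" "dm t" X] assms by (simp add: valid_def)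
qed (use assms in simp_all)

lemma ide_right [simp]: assumes "valid t" "dm t = X" shows "t \<odot> ide X = t"
proof (rule arr_eqI)
  show "mr (t \<odot> ide X) = mr t"
    using mr_acmp[OF assms(1) valid_ide[of X]] Idm_right[of "mr t" X "cd t"] assms by (simp add: valid_def)
qed (use assms in simp_all)

text \<open>Composites are kept bracketed to the right, so a redex \<open>p \<odot> q\<close>
  usually occurs as \<open>p \<odot> (q \<odot> x)\<close>. This turns an equation between short
  composites into a rewrite rule for that shape.\<close>

lemma acmp_reassoc: "p \<odot> q = r \<Longrightarrow> p \<odot> (q \<odot> x) = r \<odot> x"
  using acmp_assoc[of p q x] by simp

lemma cancel_right:
  assumes "t \<odot> p = u \<odot> p" "p \<odot> q = ide (cd p)" "valid t" "valid u" "dm t = cd p" "dm u = cd p"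
  shows "t = u"
proof -
  have "t = (t \<odot> p) \<odot> q" unfolding acmp_assoc assms(2) using assms(3,5) by simp
  also have "\<dots> = u" unfolding assms(1) unfolding acmp_assoc assms(2) using assms(4,6) by simp
  finally show ?thesis .
qed

lemma cancel_left:
  assumes "p \<odot> t = p \<odot> u" "q \<odot> p = ide (dm p)" "valid t" "valid u" "cd t = dm p" "cd u = dm p"
  shows "t = u"
proof -
  have "t = q \<odot> (p \<odot> t)" unfolding acmp_reassoc[OF assms(2)] using assms(3,5) by simp
  also have "\<dots> = u" unfolding assms(1) unfolding acmp_reassoc[OF assms(2)] using assms(4,6) by simp
  finally show ?thesis .
qed

lemma inverse_unique:
  assumes "f \<in> Hom C X Y" "h \<in> Hom C Y X" "h \<cdot> f = Idm C X"
    and "k \<in> Hom C Y X" "f \<cdot> k = Idm C Y"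
  shows "k = h"
proof -
  have "k = Idm C X \<cdot> k" using Idm_left[OF assms(4)] by simp
  also have "\<dots> = (h \<cdot> f) \<cdot> k" using assms(3) by simp
  also have "\<dots> = h \<cdot> (f \<cdot> k)" by (rule cmp_assoc[OF assms(2,1,4)])
  also have "\<dots> = h" using assms(5) Idm_right[OF assms(2)] by simp
  finally show ?thesis .
qed

lemma inv_mor:
  assumes "is_iso C X Y f"
  shows inv_mor_in: "inv_mor C X Y f \<in> Hom C Y X"
    and inv_mor_left: "inv_mor C X Y f \<cdot> f = Idm C X"
    and inv_mor_right: "f \<cdot> inv_mor C X Y f = Idm C Y"
proof -
  from assms obtain h where h: "h \<in> Hom C Y X" "h \<cdot> f = Idm C X" "f \<cdot> h = Idm C Y"
    and f: "f \<in> Hom C X Y" unfolding is_iso_def by blast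
  have "inv_mor C X Y f \<in> Hom C Y X \<and> inv_mor C X Y f \<cdot> f = Idm C X \<and> f \<cdot> inv_mor C X Y f = Idm C Y"
    unfolding inv_mor_def
    by (rule theI[where a = h]) (use h in blast, use inverse_unique[OF f h(1,2)] in blast)
  then show "inv_mor C X Y f \<in> Hom C Y X" "inv_mor C X Y f \<cdot> f = Idm C X"
    "f \<cdot> inv_mor C X Y f = Idm C Y" by blast+
qed

lemma is_iso_in: "is_iso C X Y f \<Longrightarrow> f \<in> Hom C X Y"
  by (simp add: is_iso_def)

lemma inv_mor_unique:
  assumes "f \<in> Hom C X Y" "h \<in> Hom C Y X" "h \<cdot> f = Idm C X" "f \<cdot> h = Idm C Y"
  shows "inv_mor C X Y f = h"
proof -
  have "is_iso C X Y f" using assms unfolding is_iso_def by blast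
  from inv_mor[OF this] show ?thesis by (intro inverse_unique[OF assms(1-3)])
qed

section \<open>Inverses of arrows\<close>

definition invA :: "('o, 'm) arr \<Rightarrow> ('o, 'm) arr" where
  "invA t = Arr (cd t) (inv_mor C (dm t) (cd t) (mr t)) (dm t)"

definition isoA :: "('o, 'm) arr \<Rightarrow> bool" where
  "isoA t \<longleftrightarrow> is_iso C (dm t) (cd t) (mr t)"

lemma isoA_valid [simp]: "isoA t \<Longrightarrow> valid t"
  by (simp add: isoA_def valid_def is_iso_def)

lemma dm_invA [simp]: "dm (invA t) = cd t" and cd_invA [simp]: "cd (invA t) = dm t"
  by (simp_all add: invA_def)

lemma valid_invA [simp]: "isoA t \<Longrightarrow> valid (invA t)"
  by (simp add: isoA_def valid_def invA_def inv_mor_in)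

lemma mr_invA: "mr (invA t) = inv_mor C (dm t) (cd t) (mr t)"
  by (simp add: invA_def)

lemma invA_left [simp]: assumes "isoA t" shows "invA t \<odot> t = ide (dm t)"
proof (rule arr_eqI)
  show "mr (invA t \<odot> t) = mr (ide (dm t))"
    using mr_acmp[OF valid_invA[OF assms] isoA_valid[OF assms]] assms
    by (simp only: mr_invA dm_invA isoA_def inv_mor_left mr_ide)
qed simp_all

lemma invA_right [simp]: assumes "isoA t" shows "t \<odot> invA t = ide (cd t)"
proof (rule arr_eqI)
  show "mr (t \<odot> invA t) = mr (ide (cd t))"
    using mr_acmp[OF isoA_valid[OF assms] valid_invA[OF assms]] assms
    by (simp only: mr_invA cd_invA isoA_def inv_mor_right mr_ide)
qed simp_all

lemma invA_left' [simp]: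
  assumes "isoA t" "valid x" "cd x = dm t" shows "invA t \<odot> (t \<odot> x) = x"
  unfolding acmp_reassoc[OF invA_left[OF assms(1)]] using assms(2,3) by (rule ide_left)

lemma invA_right' [simp]:
  assumes "isoA t" "valid x" "cd x = cd t" shows "t \<odot> (invA t \<odot> x) = x"
  unfolding acmp_reassoc[OF invA_right[OF assms(1)]] using assms(2,3) by (rule ide_left)

lemma isoAI:
  assumes "valid t" "valid u" "dm u = cd t" "cd u = dm t" "u \<odot> t = ide (dm t)" "t \<odot> u = ide (cd t)"
  shows "isoA t"
proof -
  have "mr u \<cdot> mr t = Idm C (dm t)" "mr t \<cdot> mr u = Idm C (cd t)"
    using mr_acmp[of t u] mr_acmp[of u t] assms by simp_all
  moreover have "mr t \<in> Hom C (dm t) (cd t)" "mr u \<in> Hom C (cd t) (dm t)"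
    using assms(1-4) by (auto simp: valid_def)
  ultimately show ?thesis unfolding isoA_def is_iso_def by blast
qed

lemma invA_unique:
  assumes "valid t" "valid u" "dm u = cd t" "cd u = dm t" "u \<odot> t = ide (dm t)" "t \<odot> u = ide (cd t)"
  shows "invA t = u"
proof -
  have iso: "isoA t" using assms by (rule isoAI)
  have "invA t = invA t \<odot> (t \<odot> u)" unfolding assms(6) using iso by simp
  also have "\<dots> = u" using iso assms by (intro invA_left')
  finally show ?thesis .
qed

lemma isoA_invA [simp]: "isoA t \<Longrightarrow> isoA (invA t)"
  by (rule isoAI[where u = t]) simp_all

lemma isoA_acmp [simp]: "\<lbrakk>isoA t; isoA u; dm t = cd u\<rbrakk> \<Longrightarrow> isoA (t \<odot> u)"
  by (rule isoAI[where u = "invA u \<odot> invA t"]) (simp_all add: acmp_assoc)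

lemma invA_acmp: "\<lbrakk>isoA t; isoA u; dm t = cd u\<rbrakk> \<Longrightarrow> invA (t \<odot> u) = invA u \<odot> invA t"
  by (rule invA_unique) (simp_all add: acmp_assoc)

lemma isoA_ide [simp]: "isoA (ide X)"
  by (rule isoAI[where u = "ide X"]) simp_all

end

section \<open>Whiskering and duality\<close>

context pivotal_fusion_category
begin

definition lw :: "'o \<Rightarrow> ('o, 'm) arr \<Rightarrow> ('o, 'm) arr" where
  "lw X t = Arr (X \<boxtimes> dm t) (Idm C X \<boxtimes>\<^sub>m mr t) (X \<boxtimes> cd t)"

definition rw :: "('o, 'm) arr \<Rightarrow> 'o \<Rightarrow> ('o, 'm) arr" where
  "rw t Y = Arr (dm t \<boxtimes> Y) (mr t \<boxtimes>\<^sub>m Idm C Y) (cd t \<boxtimes> Y)"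

definition assocA :: "'o \<Rightarrow> 'o \<Rightarrow> 'o \<Rightarrow> ('o, 'm) arr" where
  "assocA X Y Z = Arr ((X \<boxtimes> Y) \<boxtimes> Z) (assoc C X Y Z) (X \<boxtimes> (Y \<boxtimes> Z))"

definition lunA :: "'o \<Rightarrow> ('o, 'm) arr" where
  "lunA X = Arr (unit C \<boxtimes> X) (lun C X) X"

definition runA :: "'o \<Rightarrow> ('o, 'm) arr" where
  "runA X = Arr (X \<boxtimes> unit C) (run C X) X"

abbreviation "iassocA X Y Z \<equiv> invA (assocA X Y Z)"
abbreviation "ilunA X \<equiv> invA (lunA X)"
abbreviation "irunA X \<equiv> invA (runA X)"

lemma dm_cd [simp]:
  "dm (lw X t) = X \<boxtimes> dm t" "cd (lw X t) = X \<boxtimes> cd t"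
  "dm (rw t Y) = dm t \<boxtimes> Y" "cd (rw t Y) = cd t \<boxtimes> Y"
  "dm (assocA X Y Z) = (X \<boxtimes> Y) \<boxtimes> Z" "cd (assocA X Y Z) = X \<boxtimes> (Y \<boxtimes> Z)"
  "dm (lunA X) = unit C \<boxtimes> X" "cd (lunA X) = X" "dm (runA X) = X \<boxtimes> unit C" "cd (runA X) = X"
  by (simp_all add: lw_def rw_def assocA_def lunA_def runA_def)

lemma valid_lw [simp]: "valid t \<Longrightarrow> valid (lw X t)"
  and valid_rw [simp]: "valid t \<Longrightarrow> valid (rw t X)"
  by (simp_all add: valid_def lw_def rw_def tn_in Idm_in)

lemma isoA_assocA [simp]: "isoA (assocA X Y Z)" and isoA_lunA [simp]: "isoA (lunA X)" and isoA_runA [simp]: "isoA (runA X)"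
  by (simp_all add: isoA_def assocA_def lunA_def runA_def assoc_iso lun_iso run_iso)

lemma mr_iassocA: "mr (iassocA X Y Z) = assoc_inv C X Y Z" and mr_ilunA: "mr (ilunA X) = lun_inv C X"
  and mr_irunA: "mr (irunA X) = run_inv C X"
  by (simp_all add: mr_invA assoc_inv_def lun_inv_def run_inv_def) (simp_all add: assocA_def lunA_def runA_def)

lemma lw_ide [simp]: "lw X (ide Y) = ide (X \<boxtimes> Y)" and rw_ide [simp]: "rw (ide X) Y = ide (X \<boxtimes> Y)"
  by (rule arr_eqI; simp add: lw_def rw_def tn_Idm)+

lemma lw_acmp:
  assumes "valid t" "valid u" "cd u = dm t"
  shows "lw X (t \<odot> u) = lw X t \<odot> lw X u"
proof (rule arr_eqI)
  have "(Idm C X \<cdot> Idm C X) \<boxtimes>\<^sub>m (mr t \<cdot> mr u) = (Idm C X \<boxtimes>\<^sub>m mr t) \<cdot> (Idm C X \<boxtimes>\<^sub>m mr u)"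
    using assms by (intro tn_cmp[where X = X and Y = X and Z = X and Y' = "cd u"]) (auto simp: valid_def Idm_in)
  then show "mr (lw X (t \<odot> u)) = mr (lw X t \<odot> lw X u)"
    using assms by (simp add: mr_acmp) (simp add: lw_def mr_acmp Idm_left[OF Idm_in])
qed simp_all

lemma rw_acmp:
  assumes "valid t" "valid u" "cd u = dm t"
  shows "rw (t \<odot> u) X = rw t X \<odot> rw u X"
proof (rule arr_eqI)
  have "(mr t \<cdot> mr u) \<boxtimes>\<^sub>m (Idm C X \<cdot> Idm C X) = (mr t \<boxtimes>\<^sub>m Idm C X) \<cdot> (mr u \<boxtimes>\<^sub>m Idm C X)"
    using assms by (intro tn_cmp[where X' = X and Y' = X and Z' = X and Y = "cd u"]) (auto simp: valid_def Idm_in)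
  then show "mr (rw (t \<odot> u) X) = mr (rw t X \<odot> rw u X)"
    using assms by (simp add: mr_acmp) (simp add: rw_def mr_acmp Idm_left[OF Idm_in])
qed simp_all

lemma isoA_lw [simp]: "isoA t \<Longrightarrow> isoA (lw X t)"
  by (rule isoAI[where u = "lw X (invA t)"]) (simp_all add: lw_acmp[symmetric])

lemma isoA_rw [simp]: "isoA t \<Longrightarrow> isoA (rw t X)"
  by (rule isoAI[where u = "rw (invA t) X"]) (simp_all add: rw_acmp[symmetric])

lemma invA_lw: "isoA t \<Longrightarrow> invA (lw X t) = lw X (invA t)"
  by (rule invA_unique) (simp_all add: lw_acmp[symmetric])

lemma invA_rw: "isoA t \<Longrightarrow> invA (rw t X) = rw (invA t) X"
  by (rule invA_unique) (simp_all add: rw_acmp[symmetric])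

lemma mr_tn:
  assumes "valid t" "valid u"
  shows "mr (rw t (cd u) \<odot> lw (dm t) u) = mr t \<boxtimes>\<^sub>m mr u"
    and "mr (lw (cd t) u \<odot> rw t (dm u)) = mr t \<boxtimes>\<^sub>m mr u"
proof -
  have t: "mr t \<in> Hom C (dm t) (cd t)" and u: "mr u \<in> Hom C (dm u) (cd u)"
    using assms by (auto simp: valid_def)
  show "mr (rw t (cd u) \<odot> lw (dm t) u) = mr t \<boxtimes>\<^sub>m mr u"
    using assms tn_cmp[OF Idm_in[of "dm t"] t u Idm_in[of "cd u"]] Idm_left[OF u] Idm_right[OF t]
    by (simp add: mr_acmp) (simp add: rw_def lw_def)
  show "mr (lw (cd t) u \<odot> rw t (dm u)) = mr t \<boxtimes>\<^sub>m mr u"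
    using assms tn_cmp[OF t Idm_in[of "cd t"] Idm_in[of "dm u"] u] Idm_left[OF t] Idm_right[OF u]
    by (simp add: mr_acmp) (simp add: rw_def lw_def)
qed

text \<open>Both composites are \<open>t\<close> tensored with \<open>u\<close>, by
  \<open>mr_tn\<close>. Arrows are tensored only through whiskering, so this law and the
  functoriality of the two whiskerings stand in for bifunctoriality.\<close>

lemma interchange:
  assumes "valid t" "valid u" "cd u = Y'" "dm t = X" "cd t = X'" "dm u = Y"
  shows "rw t Y' \<odot> lw X u = lw X' u \<odot> rw t Y"
  by (rule arr_eqI) (use mr_tn[OF assms(1,2)] assms in auto)

lemma assocA_nat1:
  assumes "valid t" "cd t = X"
  shows "assocA X Y Z \<odot> rw (rw t Y) Z = rw t (Y \<boxtimes> Z) \<odot> assocA (dm t) Y Z"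
proof (rule arr_eqI)
  have t: "mr t \<in> Hom C (dm t) X" using assms by (auto simp: valid_def)
  show "mr (assocA X Y Z \<odot> rw (rw t Y) Z) = mr (rw t (Y \<boxtimes> Z) \<odot> assocA (dm t) Y Z)"
    using assms assoc_nat[OF t Idm_in[of Y] Idm_in[of Z]]
    by (simp add: mr_acmp) (simp add: assocA_def rw_def tn_Idm)
qed (use assms in simp_all)

lemma assocA_nat2:
  assumes "valid t" "cd t = Y"
  shows "assocA X Y Z \<odot> rw (lw X t) Z = lw X (rw t Z) \<odot> assocA X (dm t) Z"
proof (rule arr_eqI)
  have t: "mr t \<in> Hom C (dm t) Y" using assms by (auto simp: valid_def)
  show "mr (assocA X Y Z \<odot> rw (lw X t) Z) = mr (lw X (rw t Z) \<odot> assocA X (dm t) Z)"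
    using assms assoc_nat[OF Idm_in[of X] t Idm_in[of Z]]
    by (simp add: mr_acmp) (simp add: assocA_def rw_def lw_def)
qed (use assms in simp_all)

lemma assocA_nat3:
  assumes "valid t" "cd t = Z"
  shows "assocA X Y Z \<odot> lw (X \<boxtimes> Y) t = lw X (lw Y t) \<odot> assocA X Y (dm t)"
proof (rule arr_eqI)
  have t: "mr t \<in> Hom C (dm t) Z" using assms by (auto simp: valid_def)
  show "mr (assocA X Y Z \<odot> lw (X \<boxtimes> Y) t) = mr (lw X (lw Y t) \<odot> assocA X Y (dm t))"
    using assms assoc_nat[OF Idm_in[of X] Idm_in[of Y] t]
    by (simp add: mr_acmp) (simp add: assocA_def lw_def tn_Idm)
qed (use assms in simp_all)

text \<open>A commuting square with two invertible sides can be read backwards. The naturality laws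
  of the inverse associators, of the inverse unit constraint and of the inverse crossings come from
  here.\<close>

lemma flip:
  assumes "q \<odot> s = t \<odot> q'" "isoA q" "isoA q'" "valid s" "valid t" "cd s = dm q" "dm t = cd q'"
  shows "invA q \<odot> t = s \<odot> invA q'"
proof -
  have "invA q \<odot> t = invA q \<odot> ((t \<odot> q') \<odot> invA q')" using assms by (simp add: acmp_assoc)
  also have "\<dots> = s \<odot> invA q'" using assms by (simp add: assms(1)[symmetric] acmp_assoc)
  finally show ?thesis .
qed

lemma iassocA_nat2: "\<lbrakk>valid t; cd t = Y\<rbrakk> \<Longrightarrow> iassocA X Y Z \<odot> lw X (rw t Z) = rw (lw X t) Z \<odot> iassocA X (dm t) Z"
  by (rule flip[OF assocA_nat2]) simp_all

lemma iassocA_nat3: "\<lbrakk>valid t; cd t = Z\<rbrakk> \<Longrightarrow> iassocA X Y Z \<odot> lw X (lw Y t) = lw (X \<boxtimes> Y) t \<odot> iassocA X Y (dm t)"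
  by (rule flip[OF assocA_nat3]) simp_all

lemma lunA_nat:
  assumes "valid t" "cd t = X"
  shows "lunA X \<odot> lw (unit C) t = t \<odot> lunA (dm t)"
proof (rule arr_eqI)
  have t: "mr t \<in> Hom C (dm t) X" using assms by (auto simp: valid_def)
  show "mr (lunA X \<odot> lw (unit C) t) = mr (t \<odot> lunA (dm t))"
    using assms lun_nat[OF t] by (simp add: mr_acmp) (simp add: lunA_def lw_def)
qed (use assms in simp_all)

lemma runA_nat:
  assumes "valid t" "cd t = X"
  shows "runA X \<odot> rw t (unit C) = t \<odot> runA (dm t)"
proof (rule arr_eqI)
  have t: "mr t \<in> Hom C (dm t) X" using assms by (auto simp: valid_def)
  show "mr (runA X \<odot> rw t (unit C)) = mr (t \<odot> runA (dm t))"
    using assms run_nat[OF t] by (simp add: mr_acmp) (simp add: runA_def rw_def)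
qed (use assms in simp_all)

lemma ilunA_nat: "\<lbrakk>valid t; cd t = X\<rbrakk> \<Longrightarrow> ilunA X \<odot> t = lw (unit C) t \<odot> ilunA (dm t)"
  by (rule flip[OF lunA_nat]) simp_all

lemma pentagon_arr:
  "assocA W X (Y \<boxtimes> Z) \<odot> assocA (W \<boxtimes> X) Y Z = lw W (assocA X Y Z) \<odot> assocA W (X \<boxtimes> Y) Z \<odot> rw (assocA W X Y) Z"
  using pentagon[of W X Y Z]
  by (intro arr_eqI) (simp_all add: mr_acmp, simp_all add: assocA_def lw_def rw_def)

lemma triangle_arr: "lw X (lunA Y) \<odot> assocA X (unit C) Y = rw (runA X) Y"
  using triangle[of X Y]
  by (intro arr_eqI) (simp_all add: mr_acmp, simp_all add: assocA_def lw_def rw_def lunA_def runA_def)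

lemma triangle_inv: "assocA X (unit C) Y \<odot> rw (irunA X) Y = lw X (ilunA Y)"
proof (rule cancel_left[where p = "lw X (lunA Y)" and q = "lw X (ilunA Y)"])
  show "lw X (lunA Y) \<odot> assocA X (unit C) Y \<odot> rw (irunA X) Y = lw X (lunA Y) \<odot> lw X (ilunA Y)"
    by (simp add: acmp_reassoc[OF triangle_arr] lw_acmp[symmetric] rw_acmp[symmetric])
qed (simp_all add: lw_acmp[symmetric])

text \<open>Tensoring with the unit is faithful, since the left unit constraint identifies it
  naturally with the identity functor.\<close>

lemma lw_unit_cancel:
  assumes "lw (unit C) t = lw (unit C) u" "valid t" "valid u" "dm t = dm u" "cd t = cd u"
  shows "t = u"
proof -
  have "t \<odot> lunA (dm t) = u \<odot> lunA (dm t)"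
    using lunA_nat[OF assms(2), of "cd t"] lunA_nat[OF assms(3), of "cd t"] assms by simp
  then show ?thesis using assms by (auto intro: cancel_right[where q = "ilunA (dm t)"])
qed

text \<open>Kelly's argument: the two sides agree after tensoring with the unit, by pentagon and triangle.\<close>

lemma lunA_tn: "lunA (X \<boxtimes> Y) \<odot> assocA (unit C) X Y = rw (lunA X) Y"
proof (rule lw_unit_cancel)
  let ?u = "unit C"
  let ?p = "assocA ?u (?u \<boxtimes> X) Y \<odot> rw (assocA ?u ?u X) Y"
  have "lw ?u (lunA (X \<boxtimes> Y) \<odot> assocA ?u X Y) \<odot> ?p =
    lw ?u (lunA (X \<boxtimes> Y)) \<odot> assocA ?u ?u (X \<boxtimes> Y) \<odot> assocA (?u \<boxtimes> ?u) X Y"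
    by (simp add: lw_acmp acmp_assoc pentagon_arr)
  also have "\<dots> = rw (runA ?u) (X \<boxtimes> Y) \<odot> assocA (?u \<boxtimes> ?u) X Y"
    by (simp add: acmp_reassoc[OF triangle_arr])
  also have "\<dots> = assocA ?u X Y \<odot> rw (rw (runA ?u) X) Y"
    by (simp add: assocA_nat1)
  also have "\<dots> = assocA ?u X Y \<odot> rw (lw ?u (lunA X)) Y \<odot> rw (assocA ?u ?u X) Y"
    by (simp add: triangle_arr[symmetric] rw_acmp)
  also have "\<dots> = lw ?u (rw (lunA X) Y) \<odot> ?p"
    by (simp add: acmp_reassoc[OF assocA_nat2] acmp_assoc)
  finally show "lw ?u (lunA (X \<boxtimes> Y) \<odot> assocA ?u X Y) = lw ?u (rw (lunA X) Y)"
    by (rule cancel_right[where q = "invA ?p"]) simp_all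
qed simp_all

lemma ilunA_tn: "iassocA (unit C) X Y \<odot> ilunA (X \<boxtimes> Y) = rw (ilunA X) Y"
  using invA_acmp[of "lunA (X \<boxtimes> Y)" "assocA (unit C) X Y"] by (simp add: lunA_tn invA_rw)

text \<open>
  A pairing \<open>e : A \<boxtimes> X \<rightarrow> \<one>\<close> and a copairing \<open>c : \<one> \<rightarrow> X \<boxtimes> A\<close> are used in the form of natural transformations
  \<open>A \<boxtimes> (X \<boxtimes> B) \<rightarrow> B\<close> and \<open>B \<rightarrow> X \<boxtimes> (A \<boxtimes> B)\<close> in the parameter \<open>B\<close>.  In this form the calculus of duals is that
  of adjoint endofunctors \<open>X \<boxtimes> -\<close>, which is strict, and coherence enters only through
  \<open>eps_tn\<close> and \<open>kap_tn\<close>.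
\<close>

definition eps :: "'o \<Rightarrow> 'o \<Rightarrow> ('o, 'm) arr \<Rightarrow> 'o \<Rightarrow> ('o, 'm) arr" where
  "eps A X e B = lunA B \<odot> rw e B \<odot> iassocA A X B"

definition kap :: "'o \<Rightarrow> 'o \<Rightarrow> ('o, 'm) arr \<Rightarrow> 'o \<Rightarrow> ('o, 'm) arr" where
  "kap X A c B = assocA X A B \<odot> rw c B \<odot> ilunA B"

lemma eps_simps [simp]: "dm (eps A X e B) = A \<boxtimes> (X \<boxtimes> B)" "cd (eps A X e B) = B" "valid (eps A X e B)"
  by (simp_all add: eps_def)

lemma kap_simps [simp]: "dm (kap X A c B) = B" "cd (kap X A c B) = X \<boxtimes> (A \<boxtimes> B)" "valid (kap X A c B)"
  by (simp_all add: kap_def)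

definition pairing :: "('o, 'm) arr \<Rightarrow> 'o \<Rightarrow> 'o \<Rightarrow> bool" where
  "pairing e A X \<longleftrightarrow> valid e \<and> dm e = A \<boxtimes> X \<and> cd e = unit C"

definition copairing :: "('o, 'm) arr \<Rightarrow> 'o \<Rightarrow> 'o \<Rightarrow> bool" where
  "copairing c X A \<longleftrightarrow> valid c \<and> cd c = X \<boxtimes> A \<and> dm c = unit C"

lemma eps_nat:
  assumes "pairing e A X" "valid t" "cd t = B"
  shows "eps A X e B \<odot> lw A (lw X t) = t \<odot> eps A X e (dm t)"
proof -
  have e: "valid e" "dm e = A \<boxtimes> X" "cd e = unit C" using assms by (auto simp: pairing_def)
  have "eps A X e B \<odot> lw A (lw X t) = lunA B \<odot> rw e B \<odot> lw (A \<boxtimes> X) t \<odot> iassocA A X (dm t)"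
    using assms by (simp add: eps_def acmp_assoc iassocA_nat3)
  also have "\<dots> = lunA B \<odot> lw (unit C) t \<odot> rw e (dm t) \<odot> iassocA A X (dm t)"
    using acmp_reassoc[OF interchange[OF e(1) assms(2,3) e(2,3) refl]] by (simp add: acmp_assoc)
  also have "\<dots> = t \<odot> eps A X e (dm t)"
    using assms by (simp add: eps_def acmp_reassoc[OF lunA_nat] acmp_assoc)
  finally show ?thesis .
qed

lemma kap_nat:
  assumes "copairing c X A" "valid t" "cd t = B"
  shows "kap X A c B \<odot> t = lw X (lw A t) \<odot> kap X A c (dm t)"
proof -
  have c: "valid c" "cd c = X \<boxtimes> A" "dm c = unit C" using assms by (auto simp: copairing_def)
  have "kap X A c B \<odot> t = assocA X A B \<odot> rw c B \<odot> lw (unit C) t \<odot> ilunA (dm t)"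
    using assms by (simp add: kap_def acmp_assoc ilunA_nat)
  also have "\<dots> = assocA X A B \<odot> lw (X \<boxtimes> A) t \<odot> rw c (dm t) \<odot> ilunA (dm t)"
    using acmp_reassoc[OF interchange[OF c(1) assms(2,3) c(3,2) refl]] by (simp add: acmp_assoc)
  also have "\<dots> = lw X (lw A t) \<odot> kap X A c (dm t)"
    using assms by (simp add: kap_def acmp_reassoc[OF assocA_nat3] acmp_assoc)
  finally show ?thesis .
qed

text \<open>The pentagon for \<open>A\<close>, \<open>X\<close>, \<open>Y\<close>, \<open>B\<close>
  and Kelly's identity \<open>lunA_tn\<close> are spent here and, dually, in \<open>kap_tn\<close>:
  a strand whiskered on the right is absorbed into the parameter.\<close>

lemma eps_tn:
  assumes "pairing e A X"
  shows "rw (eps A X e Y) B = eps A X e (Y \<boxtimes> B) \<odot> lw A (assocA X Y B) \<odot> assocA A (X \<boxtimes> Y) B"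
proof -
  have e: "valid e" "dm e = A \<boxtimes> X" "cd e = unit C" using assms by (auto simp: pairing_def)
  have p: "lw A (assocA X Y B) \<odot> assocA A (X \<boxtimes> Y) B = assocA A X (Y \<boxtimes> B) \<odot> assocA (A \<boxtimes> X) Y B \<odot> rw (iassocA A X Y) B"
    using acmp_reassoc[OF pentagon_arr[of A X Y B], of "rw (iassocA A X Y) B"]
    by (simp add: acmp_assoc rw_acmp[symmetric])
  have "eps A X e (Y \<boxtimes> B) \<odot> lw A (assocA X Y B) \<odot> assocA A (X \<boxtimes> Y) B =
     lunA (Y \<boxtimes> B) \<odot> rw e (Y \<boxtimes> B) \<odot> assocA (A \<boxtimes> X) Y B \<odot> rw (iassocA A X Y) B"
    by (simp add: eps_def acmp_assoc p)
  also have "\<dots> = lunA (Y \<boxtimes> B) \<odot> assocA (unit C) Y B \<odot> rw (rw e Y) B \<odot> rw (iassocA A X Y) B"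
    using acmp_reassoc[OF assocA_nat1[OF e(1,3), of Y B]] e by (simp add: acmp_assoc)
  also have "\<dots> = rw (eps A X e Y) B"
    using e by (simp add: acmp_reassoc[OF lunA_tn] eps_def rw_acmp acmp_assoc)
  finally show ?thesis by simp
qed

lemma kap_tn:
  assumes "copairing c X A"
  shows "kap X A c (Y \<boxtimes> B) = lw X (assocA A Y B) \<odot> assocA X (A \<boxtimes> Y) B \<odot> rw (kap X A c Y) B"
proof -
  have c: "valid c" "cd c = X \<boxtimes> A" "dm c = unit C" using assms by (auto simp: copairing_def)
  have "lw X (assocA A Y B) \<odot> assocA X (A \<boxtimes> Y) B \<odot> rw (kap X A c Y) B =
    (lw X (assocA A Y B) \<odot> assocA X (A \<boxtimes> Y) B \<odot> rw (assocA X A Y) B) \<odot> rw (rw c Y) B \<odot> rw (ilunA Y) B"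
    using c by (simp add: kap_def rw_acmp acmp_assoc)
  also have "\<dots> = assocA X A (Y \<boxtimes> B) \<odot> assocA (X \<boxtimes> A) Y B \<odot> rw (rw c Y) B \<odot> rw (ilunA Y) B"
    unfolding pentagon_arr[symmetric] by (simp add: acmp_assoc)
  also have "\<dots> = assocA X A (Y \<boxtimes> B) \<odot> rw c (Y \<boxtimes> B) \<odot> assocA (unit C) Y B \<odot> rw (ilunA Y) B"
    using acmp_reassoc[OF assocA_nat1[OF c(1,2), of Y B]] c by (simp add: acmp_assoc)
  also have "\<dots> = kap X A c (Y \<boxtimes> B)"
    by (simp add: kap_def ilunA_tn[symmetric])
  finally show ?thesis by simp
qed

text \<open>On the left is the morphism from \<open>X\<close> to \<open>Z\<close> obtained by
  contracting \<open>c\<close> with \<open>e\<close> along \<open>A\<close>. Moving the strand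
  \<open>B\<close> into the parameter by \<open>kap_tn\<close> and the triangle axiom absorbs the
  right unit constraint.\<close>

lemma tn_mate_left:
  assumes "copairing c Z A" "pairing e A X"
  shows "rw (runA Z \<odot> lw Z e \<odot> kap Z A c X) B = lw Z (eps A X e B) \<odot> kap Z A c (X \<boxtimes> B)"
proof -
  have e: "valid e" "dm e = A \<boxtimes> X" "cd e = unit C" using assms by (auto simp: pairing_def)
  have "rw (runA Z \<odot> lw Z e \<odot> kap Z A c X) B =
     lw Z (lunA B) \<odot> assocA Z (unit C) B \<odot> rw (lw Z e) B \<odot> rw (kap Z A c X) B"
    using e by (simp add: rw_acmp triangle_arr[symmetric] acmp_assoc)
  also have "\<dots> = lw Z (lunA B) \<odot> lw Z (rw e B) \<odot> assocA Z (A \<boxtimes> X) B \<odot> rw (kap Z A c X) B"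
    using acmp_reassoc[OF assocA_nat2[OF e(1,3), of Z B]] e by (simp add: acmp_assoc)
  also have "\<dots> = lw Z (eps A X e B) \<odot> kap Z A c (X \<boxtimes> B)"
    using e by (simp add: eps_def lw_acmp acmp_assoc kap_tn[OF assms(1)] invA_lw[symmetric])
  finally show ?thesis .
qed

text \<open>The mirrored contraction, along \<open>X\<close>, giving a morphism from
  \<open>A\<close> to \<open>Z\<close>. \<open>eps_tn\<close> and \<open>triangle_inv\<close> play
  the roles of \<open>kap_tn\<close> and the triangle axiom.\<close>

lemma tn_mate_right:
  assumes "copairing c X Z" "pairing e A X"
  shows "rw (eps A X e Z \<odot> lw A c \<odot> irunA A) B = eps A X e (Z \<boxtimes> B) \<odot> lw A (kap X Z c B)"
proof -
  have c: "valid c" "cd c = X \<boxtimes> Z" "dm c = unit C" using assms by (auto simp: copairing_def)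
  have "rw (eps A X e Z \<odot> lw A c \<odot> irunA A) B =
    eps A X e (Z \<boxtimes> B) \<odot> lw A (assocA X Z B) \<odot> assocA A (X \<boxtimes> Z) B \<odot> rw (lw A c) B \<odot> rw (irunA A) B"
    using c by (simp add: rw_acmp eps_tn[OF assms(2)] acmp_assoc)
  also have "\<dots> = eps A X e (Z \<boxtimes> B) \<odot> lw A (assocA X Z B) \<odot> lw A (rw c B) \<odot> assocA A (unit C) B \<odot> rw (irunA A) B"
    using acmp_reassoc[OF assocA_nat2[OF c(1,2), of A B]] c by (simp add: acmp_assoc)
  also have "\<dots> = eps A X e (Z \<boxtimes> B) \<odot> lw A (kap X Z c B)"
    using c by (simp add: triangle_inv kap_def lw_acmp)
  finally show ?thesis .
qed

section \<open>Duals, transposes and the pivotal structure with a parameter\<close>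

definition evA :: "'o \<Rightarrow> ('o, 'm) arr" where
  "evA X = Arr (dual C X \<boxtimes> X) (ev C X) (unit C)"

definition coevA :: "'o \<Rightarrow> ('o, 'm) arr" where
  "coevA X = Arr (unit C) (coev C X) (X \<boxtimes> dual C X)"

definition pivA :: "'o \<Rightarrow> ('o, 'm) arr" where
  "pivA X = Arr X (piv C X) (dual C (dual C X))"

definition coevA' :: "'o \<Rightarrow> ('o, 'm) arr" where
  "coevA' X = lw (dual C X) (invA (pivA X)) \<odot> coevA (dual C X)"

abbreviation "E X B \<equiv> eps (dual C X) X (evA X) B"
abbreviation "K X B \<equiv> kap X (dual C X) (coevA X) B"
abbreviation "K' X B \<equiv> kap (dual C X) X (coevA' X) B"

text \<open>The counit matching the unit \<open>K'\<close>. Thus \<open>X \<boxtimes> -\<close>,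
  which by \<open>E\<close> and \<open>K\<close> is right adjoint to tensoring with the dual of
  \<open>X\<close>, is also left adjoint to it through the pivotal structure.\<close>

definition E' :: "'o \<Rightarrow> 'o \<Rightarrow> ('o, 'm) arr" where
  "E' X B = E (dual C X) B \<odot> rw (pivA X) (dual C X \<boxtimes> B)"

lemma isoA_pivA [simp]: "isoA (pivA X)"
  by (simp add: isoA_def pivA_def piv_iso)

lemma duality_simps [simp]:
  "dm (evA X) = dual C X \<boxtimes> X" "cd (evA X) = unit C" "valid (evA X)"
  "cd (coevA X) = X \<boxtimes> dual C X" "dm (coevA X) = unit C" "valid (coevA X)"
  "dm (pivA X) = X" "cd (pivA X) = dual C (dual C X)"
  by (simp_all add: evA_def coevA_def pivA_def valid_def ev_in coev_in)

lemma mr_pivA: "mr (pivA X) = piv C X"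
  by (simp add: pivA_def)

lemma coevA'_simps [simp]:
  "cd (coevA' X) = dual C X \<boxtimes> X" "dm (coevA' X) = unit C" "valid (coevA' X)"
  by (simp_all add: coevA'_def)

lemma E'_simps [simp]: "dm (E' X B) = X \<boxtimes> (dual C X \<boxtimes> B)" "cd (E' X B) = B" "valid (E' X B)"
  by (simp_all add: E'_def)

lemma pairing_evA [simp]: "pairing (evA X) (dual C X) X"
  and copairing_coevA [simp]: "copairing (coevA X) X (dual C X)"
  and copairing_coevA' [simp]: "copairing (coevA' X) (dual C X) X"
  by (simp_all add: pairing_def copairing_def)

lemma eps_cmp_right:
  assumes "valid e" "dm e = A \<boxtimes> Y" "valid t" "cd t = Y"
  shows "eps A (dm t) (e \<odot> lw A t) B = eps A Y e B \<odot> lw A (rw t B)"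
  using assms by (simp add: eps_def rw_acmp acmp_assoc iassocA_nat2)

lemma kap_cmp_right:
  assumes "valid c" "cd c = X \<boxtimes> dm t" "valid t"
  shows "kap X (cd t) (lw X t \<odot> c) B = lw X (rw t B) \<odot> kap X (dm t) c B"
  using assms by (simp add: kap_def rw_acmp acmp_assoc acmp_reassoc[OF assocA_nat2])

lemma E_nat: "\<lbrakk>valid t; cd t = B\<rbrakk> \<Longrightarrow> E X B \<odot> lw (dual C X) (lw X t) = t \<odot> E X (dm t)"
  by (rule eps_nat) simp_all

lemma K'_nat: "\<lbrakk>valid t; cd t = B\<rbrakk> \<Longrightarrow> K' X B \<odot> t = lw (dual C X) (lw X t) \<odot> K' X (dm t)"
  by (rule kap_nat) simp_all

lemma E'_nat: "\<lbrakk>valid t; cd t = B\<rbrakk> \<Longrightarrow> E' X B \<odot> lw X (lw (dual C X) t) = t \<odot> E' X (dm t)"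
  by (simp add: E'_def acmp_assoc interchange[where X' = "dual C (dual C X)"] acmp_reassoc[OF E_nat])

text \<open>The axiom \<open>zigzag\<close> is a statement about \<open>X\<close> alone;
  \<open>tn_mate_left\<close> whiskers it by an arbitrary \<open>B\<close>.\<close>

lemma zig: "lw X (E X B) \<odot> K X (X \<boxtimes> B) = ide (X \<boxtimes> B)"
proof -
  have "runA X \<odot> lw X (evA X) \<odot> K X X = ide X"
    using zigzag[of X]
    by (intro arr_eqI)
      (simp_all add: kap_def mr_acmp mr_ilunA, simp_all add: assocA_def runA_def lw_def rw_def evA_def coevA_def)
  then show ?thesis using tn_mate_left[of "coevA X" X "dual C X" "evA X" X B] by simp
qed

lemma zag_arr: "E X (dual C X) \<odot> lw (dual C X) (coevA X) \<odot> irunA (dual C X) = ide (dual C X)"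
  using zigzag_dual[of X]
  by (intro arr_eqI)
    (simp_all add: eps_def acmp_assoc mr_acmp mr_iassocA mr_irunA, simp_all add: lunA_def lw_def rw_def evA_def coevA_def)

lemma zag: "E X (dual C X \<boxtimes> B) \<odot> lw (dual C X) (K X B) = ide (dual C X \<boxtimes> B)"
  using tn_mate_right[of "coevA X" X "dual C X" "evA X" "dual C X" B] by (simp add: zag_arr)

lemma K'_eq: "K' X B = lw (dual C X) (rw (invA (pivA X)) B) \<odot> K (dual C X) B"
  using kap_cmp_right[of "coevA (dual C X)" "dual C X" "invA (pivA X)" B] by (simp add: coevA'_def)

text \<open>Once \<open>pivA\<close> has cancelled against its inverse, what remains is
  \<open>zag\<close> for the dual of \<open>X\<close>. In the same way \<open>zag'\<close> reduces
  to \<open>zig\<close> for the dual.\<close>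

lemma zig': "E' X (X \<boxtimes> B) \<odot> lw X (K' X B) = ide (X \<boxtimes> B)"
proof -
  let ?D = "dual C X" and ?DD = "dual C (dual C X)" and ?p = "pivA X"
  have "E' X (X \<boxtimes> B) \<odot> lw X (K' X B) = E ?D (X \<boxtimes> B) \<odot> lw ?DD (K' X B) \<odot> rw ?p B"
    by (simp add: E'_def acmp_assoc interchange[where X' = ?DD])
  also have "\<dots> = (E ?D (X \<boxtimes> B) \<odot> lw ?DD (lw ?D (rw (invA ?p) B))) \<odot> lw ?DD (K ?D B) \<odot> rw ?p B"
    by (simp add: K'_eq lw_acmp acmp_assoc)
  also have "\<dots> = rw (invA ?p) B \<odot> E ?D (?DD \<boxtimes> B) \<odot> lw ?DD (K ?D B) \<odot> rw ?p B"
    by (subst E_nat) (simp_all add: acmp_assoc)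
  also have "\<dots> = ide (X \<boxtimes> B)"
    by (simp add: acmp_reassoc[OF zag] rw_acmp[symmetric])
  finally show ?thesis .
qed

lemma zag': "lw (dual C X) (E' X B) \<odot> K' X (dual C X \<boxtimes> B) = ide (dual C X \<boxtimes> B)"
  by (simp add: K'_eq E'_def lw_acmp acmp_assoc invA_lw[symmetric] invA_rw[symmetric] zig)

definition to_dualA :: "'o \<Rightarrow> 'o \<Rightarrow> ('o, 'm) arr \<Rightarrow> ('o, 'm) arr" where
  "to_dualA A X e = eps A X e (dual C X) \<odot> lw A (coevA X) \<odot> irunA A"

lemma to_dualA_simps [simp]: "dm (to_dualA A X e) = A" "cd (to_dualA A X e) = dual C X" "valid (to_dualA A X e)"
  by (simp_all add: to_dualA_def)

lemma mr_to_dualA: "pairing e A X \<Longrightarrow> mr (to_dualA A X e) = to_dual C A X (mr e)"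
  unfolding to_dualA_def to_dual_def pairing_def
  by (simp add: eps_def acmp_assoc mr_acmp mr_iassocA mr_irunA) (simp add: lunA_def lw_def rw_def coevA_def)

text \<open>By naturality of \<open>eps\<close> the evaluation of \<open>X\<close> moves past the
  pairing onto the coevaluation inside \<open>to_dualA\<close>, where \<open>zig\<close> removes
  both. Hence a morphism into a dual built from a pairing returns that pairing on
  evaluation.\<close>

lemma E_to_dualA:
  assumes "pairing e A X"
  shows "E X B \<odot> rw (to_dualA A X e) (X \<boxtimes> B) = eps A X e B"
proof -
  have "E X B \<odot> rw (to_dualA A X e) (X \<boxtimes> B) =
     (E X B \<odot> eps A X e (dual C X \<boxtimes> (X \<boxtimes> B))) \<odot> lw A (K X (X \<boxtimes> B))"
    using tn_mate_right[OF copairing_coevA assms, of "X \<boxtimes> B"] by (simp add: to_dualA_def acmp_assoc)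
  also have "\<dots> = eps A X e B \<odot> lw A (lw X (E X B)) \<odot> lw A (K X (X \<boxtimes> B))"
    by (simp add: acmp_assoc acmp_reassoc[OF eps_nat[OF assms]])
  also have "\<dots> = eps A X e B"
    using assms by (simp add: lw_acmp[symmetric] zig)
  finally show ?thesis .
qed

definition transpA :: "('o, 'm) arr \<Rightarrow> ('o, 'm) arr" where
  "transpA t = to_dualA (dual C (cd t)) (dm t) (evA (cd t) \<odot> lw (dual C (cd t)) t)"

lemma transpA_simps [simp]: "dm (transpA t) = dual C (cd t)" "cd (transpA t) = dual C (dm t)" "valid (transpA t)"
  by (simp_all add: transpA_def)

lemma mr_transpA: "valid t \<Longrightarrow> mr (transpA t) = transp C (dm t) (cd t) (mr t)"
  unfolding transpA_def transp_def
  by (subst mr_to_dualA) (simp_all add: pairing_def mr_acmp, simp add: evA_def lw_def)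

lemma E_transpA:
  assumes "valid t"
  shows "E (dm t) B \<odot> rw (transpA t) (dm t \<boxtimes> B) = E (cd t) B \<odot> lw (dual C (cd t)) (rw t B)"
  unfolding transpA_def using assms by (subst E_to_dualA) (simp_all add: pairing_def eps_cmp_right)

lemma pivA_nat:
  assumes "valid t"
  shows "pivA (cd t) \<odot> t = transpA (transpA t) \<odot> pivA (dm t)"
  using piv_nat[of "mr t" "dm t" "cd t"] assms
  by (intro arr_eqI) (simp_all add: mr_acmp mr_transpA, simp add: pivA_def valid_def)

definition arr_functor :: "(('o, 'm) arr \<Rightarrow> ('o, 'm) arr) \<Rightarrow> ('o \<Rightarrow> 'o) \<Rightarrow> bool" where
  "arr_functor F F0 \<longleftrightarrow> (\<forall>t. valid t \<longrightarrow> valid (F t)) \<and> (\<forall>t. dm (F t) = F0 (dm t) \<and> cd (F t) = F0 (cd t)) \<and>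
     (\<forall>t u. valid t \<longrightarrow> valid u \<longrightarrow> cd u = dm t \<longrightarrow> F (t \<odot> u) = F t \<odot> F u) \<and>
     (\<forall>X. F (ide X) = ide (F0 X))"

lemma arr_functor_lw: "arr_functor (lw X) ((\<boxtimes>) X)"
  by (simp add: arr_functor_def lw_acmp)

lemma arr_functor_lw_lw: "arr_functor (\<lambda>t. lw X (lw Y t)) (\<lambda>B. X \<boxtimes> (Y \<boxtimes> B))"
  by (simp add: arr_functor_def lw_acmp)

text \<open>
  Here \<open>Q1\<close> is left adjoint to \<open>P1\<close> and \<open>Q2\<close> to \<open>P2\<close>; the assumption \<open>comp\<close> says that \<open>u\<close> and \<open>w\<close> are mates.
  The cyclicity of the partial trace and its multiplicativity are both instances.
\<close>

lemma mate:
  assumes P1: "arr_functor P1 P1o" and Q1: "arr_functor Q1 Q1o" and P2: "arr_functor P2 P2o" and Q2: "arr_functor Q2 Q2o"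
    and e1: "\<And>B. valid (e1 B) \<and> dm (e1 B) = Q1o (P1o B) \<and> cd (e1 B) = B"
    and k1: "\<And>B. valid (k1 B) \<and> dm (k1 B) = B \<and> cd (k1 B) = P1o (Q1o B)"
    and e2: "\<And>B. valid (e2 B) \<and> dm (e2 B) = Q2o (P2o B) \<and> cd (e2 B) = B"
    and k2: "\<And>B. valid (k2 B) \<and> dm (k2 B) = B \<and> cd (k2 B) = P2o (Q2o B)"
    and u: "\<And>B. valid (u B) \<and> dm (u B) = Q1o B \<and> cd (u B) = Q2o B"
    and w: "\<And>B. valid (w B) \<and> dm (w B) = P2o B \<and> cd (w B) = P1o B"
    and k1_nat: "\<And>t. valid t \<Longrightarrow> k1 (cd t) \<odot> t = P1 (Q1 t) \<odot> k1 (dm t)"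
    and u_nat: "\<And>t. valid t \<Longrightarrow> u (cd t) \<odot> Q1 t = Q2 t \<odot> u (dm t)"
    and zag1: "\<And>B. P1 (e1 B) \<odot> k1 (P1o B) = ide (P1o B)"
    and zig2: "\<And>B. e2 (Q2o B) \<odot> Q2 (k2 B) = ide (Q2o B)"
    and comp: "\<And>B. e1 B \<odot> Q1 (w B) = e2 B \<odot> u (P2o B)"
  shows "P1 (u B) \<odot> k1 B = w (Q2o B) \<odot> k2 B"
proof -
  note F = P1[unfolded arr_functor_def] Q1[unfolded arr_functor_def] P2[unfolded arr_functor_def] Q2[unfolded arr_functor_def]
  let ?D = "Q2o B"
  \<comment> \<open>Inserting the triangle identity \<open>zag1\<close> lets \<open>w\<close> meet
    the counit \<open>e1\<close>; there \<open>comp\<close> trades it for \<open>u\<close>, and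
    \<open>zig2\<close> removes the rest of the second adjunction.\<close>
  have "w ?D \<odot> k2 B = (P1 (e1 ?D) \<odot> k1 (P1o ?D)) \<odot> w ?D \<odot> k2 B"
    using w k2 by (simp add: zag1)
  also have "\<dots> = P1 (e1 ?D) \<odot> P1 (Q1 (w ?D \<odot> k2 B)) \<odot> k1 B"
    using k1_nat[of "w ?D \<odot> k2 B"] w k2 by (simp add: acmp_assoc)
  also have "\<dots> = P1 ((e1 ?D \<odot> Q1 (w ?D)) \<odot> Q1 (k2 B)) \<odot> k1 B"
    using F e1 k1 e2 k2 u w by (simp add: acmp_assoc)
  also have "(e1 ?D \<odot> Q1 (w ?D)) \<odot> Q1 (k2 B) = e2 ?D \<odot> Q2 (k2 B) \<odot> u B"
    using u_nat[of "k2 B"] k2 by (simp add: comp acmp_assoc)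
  also have "\<dots> = u B"
    using u by (simp add: acmp_reassoc[OF zig2])
  finally show ?thesis by simp
qed

text \<open>The mate of the corresponding rule for \<open>E'\<close>. In that rule the transpose of
  the transpose appears, since \<open>E'\<close> evaluates on the double dual; naturality of the
  pivotal structure turns it back into \<open>t\<close>.\<close>

lemma K'_transpA:
  assumes "valid t"
  shows "lw (dual C (dm t)) (rw t B) \<odot> K' (dm t) B = rw (transpA t) (cd t \<boxtimes> B) \<odot> K' (cd t) B"
proof (rule mate[where u = "rw t" and w = "rw (transpA t)" and ?e1.0 = "E' (dm t)" and ?k1.0 = "\<lambda>B. K' (dm t) B"
      and ?e2.0 = "E' (cd t)" and ?k2.0 = "\<lambda>B. K' (cd t) B", OF arr_functor_lw arr_functor_lw arr_functor_lw arr_functor_lw])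
  fix B
  let ?X = "dm t" and ?Y = "cd t"
  let ?dX = "dual C ?X" and ?dY = "dual C ?Y"
  have "E' ?X B \<odot> lw ?X (rw (transpA t) B) =
     (E ?dX B \<odot> lw (dual C ?dX) (rw (transpA t) B)) \<odot> rw (pivA ?X) (?dY \<boxtimes> B)"
    by (simp add: E'_def acmp_assoc interchange[where X' = "dual C ?dX"])
  also have "\<dots> = E ?dY B \<odot> rw (transpA (transpA t)) (?dY \<boxtimes> B) \<odot> rw (pivA ?X) (?dY \<boxtimes> B)"
    by (simp add: acmp_assoc acmp_reassoc[OF E_transpA[of "transpA t" B, simplified]])
  also have "\<dots> = E' ?Y B \<odot> rw t (?dY \<boxtimes> B)"
    using assms by (simp add: rw_acmp[symmetric] pivA_nat[symmetric] E'_def acmp_assoc)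
  finally show "E' ?X B \<odot> lw ?X (rw (transpA t) B) = E' ?Y B \<odot> rw t (?dY \<boxtimes> B)" .
qed (use assms in \<open>simp_all add: K'_nat zag' zig' interchange\<close>)

definition dual_tnA :: "'o \<Rightarrow> 'o \<Rightarrow> ('o, 'm) arr" where
  "dual_tnA X Y = to_dualA (dual C Y \<boxtimes> dual C X) (X \<boxtimes> Y)
     (evA Y \<odot> lw (dual C Y) (E X Y) \<odot> assocA (dual C Y) (dual C X) (X \<boxtimes> Y))"

lemma dual_tnA_simps [simp]: "dm (dual_tnA X Y) = dual C Y \<boxtimes> dual C X" "cd (dual_tnA X Y) = dual C (X \<boxtimes> Y)" "valid (dual_tnA X Y)"
  by (simp_all add: dual_tnA_def)

lemma mr_dual_tnA: "mr (dual_tnA X Y) = dual_tn C X Y"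
  unfolding dual_tnA_def dual_tn_def
  by (subst mr_to_dualA, simp add: pairing_def)
    (simp add: mr_acmp, simp add: lw_def eps_def acmp_assoc mr_acmp mr_iassocA,
     simp add: evA_def assocA_def lunA_def rw_def)

text \<open>\<open>E_to_dualA\<close> replaces the evaluation of \<open>X \<boxtimes> Y\<close> by
  the pairing that defines \<open>dual_tnA\<close>, which is already the nested evaluation. The rest
  is coherence of associators.\<close>

lemma E_dual_tnA:
  "E (X \<boxtimes> Y) B \<odot> lw (dual C (X \<boxtimes> Y)) (iassocA X Y B) \<odot> rw (dual_tnA X Y) (X \<boxtimes> (Y \<boxtimes> B)) \<odot>
     iassocA (dual C Y) (dual C X) (X \<boxtimes> (Y \<boxtimes> B)) = E Y B \<odot> lw (dual C Y) (E X (Y \<boxtimes> B))"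
proof -
  let ?V = "X \<boxtimes> Y" and ?dX = "dual C X" and ?dY = "dual C Y"
  let ?e = "evA Y \<odot> lw ?dY (E X Y) \<odot> assocA ?dY ?dX ?V"
  have pe: "pairing ?e (?dY \<boxtimes> ?dX) ?V" by (simp add: pairing_def)
  \<comment> \<open>The inverted pentagon, with one associator moved to the other side.\<close>
  have a: "rw (assocA ?dY ?dX ?V) B \<odot> iassocA (?dY \<boxtimes> ?dX) ?V B \<odot> iassocA ?dY ?dX (?V \<boxtimes> B) =
    iassocA ?dY (?dX \<boxtimes> ?V) B \<odot> lw ?dY (iassocA ?dX ?V B)"
    using arg_cong[OF pentagon_arr[of ?dY ?dX ?V B], of invA]
    by (simp add: invA_acmp invA_lw invA_rw acmp_assoc)
      (metis (no_types, lifting) invA_right' isoA_assocA isoA_rw rw_acmp dm_cd dm_acmp cd_acmp valid_acmp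
        invA_rw dm_invA cd_invA)
  have "E ?V B \<odot> lw (dual C ?V) (iassocA X Y B) \<odot> rw (dual_tnA X Y) (X \<boxtimes> (Y \<boxtimes> B)) \<odot> iassocA ?dY ?dX (X \<boxtimes> (Y \<boxtimes> B)) =
    (E ?V B \<odot> rw (dual_tnA X Y) (?V \<boxtimes> B)) \<odot> iassocA ?dY ?dX (?V \<boxtimes> B) \<odot> lw ?dY (lw ?dX (iassocA X Y B))"
    by (simp add: acmp_assoc iassocA_nat3 acmp_reassoc[OF interchange[symmetric, where X = "?dY \<boxtimes> ?dX"]])
  also have "\<dots> = eps (?dY \<boxtimes> ?dX) ?V ?e B \<odot> iassocA ?dY ?dX (?V \<boxtimes> B) \<odot> lw ?dY (lw ?dX (iassocA X Y B))"
    using pe by (simp add: dual_tnA_def E_to_dualA)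
  also have "\<dots> = lunA B \<odot> rw (evA Y) B \<odot> rw (lw ?dY (E X Y)) B \<odot>
     (rw (assocA ?dY ?dX ?V) B \<odot> iassocA (?dY \<boxtimes> ?dX) ?V B \<odot> iassocA ?dY ?dX (?V \<boxtimes> B)) \<odot> lw ?dY (lw ?dX (iassocA X Y B))"
    by (simp add: eps_def rw_acmp acmp_assoc)
  also have "\<dots> = lunA B \<odot> rw (evA Y) B \<odot> (rw (lw ?dY (E X Y)) B \<odot> iassocA ?dY (?dX \<boxtimes> ?V) B) \<odot>
     lw ?dY (iassocA ?dX ?V B) \<odot> lw ?dY (lw ?dX (iassocA X Y B))"
    unfolding a by (simp add: acmp_assoc)
  also have "rw (lw ?dY (E X Y)) B \<odot> iassocA ?dY (?dX \<boxtimes> ?V) B = iassocA ?dY Y B \<odot> lw ?dY (rw (E X Y) B)"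
    using iassocA_nat2[of "E X Y" Y ?dY B] by simp
  finally show ?thesis
    by (simp add: eps_tn acmp_assoc lw_acmp invA_lw[symmetric])
      (simp add: eps_def acmp_assoc)
qed

lemma piv_tn_arr:
  "transpA (dual_tnA X Y) \<odot> pivA (X \<boxtimes> Y) =
    dual_tnA (dual C Y) (dual C X) \<odot> rw (pivA X) (dual C (dual C Y)) \<odot> lw X (pivA Y)"
proof (rule arr_eqI)
  have "mr (rw (pivA X) (cd (pivA Y)) \<odot> lw (dm (pivA X)) (pivA Y)) = piv C X \<boxtimes>\<^sub>m piv C Y"
    by (subst mr_tn) (simp_all add: mr_pivA)
  then show "mr (transpA (dual_tnA X Y) \<odot> pivA (X \<boxtimes> Y)) =
    mr (dual_tnA (dual C Y) (dual C X) \<odot> rw (pivA X) (dual C (dual C Y)) \<odot> lw X (pivA Y))"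
    using piv_tn[of Y X] by (simp add: mr_acmp[of "transpA (dual_tnA X Y)"] mr_transpA mr_dual_tnA)
      (simp add: mr_acmp[of "dual_tnA (dual C Y) (dual C X)"] mr_dual_tnA mr_pivA)
qed simp_all

text \<open>Transposing \<open>dual_tnA\<close> across the evaluation puts it next to the pivotal
  isomorphism of \<open>X \<boxtimes> Y\<close>. Monoidality of the pivotal structure,
  \<open>piv_tn_arr\<close>, replaces both by the pivotal isomorphisms of \<open>X\<close> and
  \<open>Y\<close> and a \<open>dual_tnA\<close> of duals, so that \<open>E_dual_tnA\<close> applies
  to the pair of duals.\<close>

lemma E'_dual_tnA:
  "E' (X \<boxtimes> Y) B \<odot> lw (X \<boxtimes> Y) (rw (dual_tnA X Y) B \<odot> iassocA (dual C Y) (dual C X) B) =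
   E' X B \<odot> lw X (E' Y (dual C X \<boxtimes> B)) \<odot> assocA X Y (dual C Y \<boxtimes> (dual C X \<boxtimes> B))"
proof -
  let ?V = "X \<boxtimes> Y" and ?dX = "dual C X" and ?dY = "dual C Y"
  let ?A = "?dY \<boxtimes> ?dX" and ?F = "?dY \<boxtimes> (?dX \<boxtimes> B)"
  let ?ddX = "dual C ?dX" and ?ddY = "dual C ?dY"
  have "E' ?V B \<odot> lw ?V (rw (dual_tnA X Y) B \<odot> iassocA ?dY ?dX B) =
     (E (dual C ?V) B \<odot> lw (dual C (dual C ?V)) (rw (dual_tnA X Y) B)) \<odot> rw (pivA ?V) (?A \<boxtimes> B) \<odot> lw ?V (iassocA ?dY ?dX B)"
    by (simp add: E'_def lw_acmp acmp_assoc acmp_reassoc[OF interchange[where X' = "dual C (dual C ?V)" and t = "pivA ?V"]])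
  also have "\<dots> = E ?A B \<odot> rw (transpA (dual_tnA X Y) \<odot> pivA ?V) (?A \<boxtimes> B) \<odot> lw ?V (iassocA ?dY ?dX B)"
    by (simp add: rw_acmp acmp_assoc acmp_reassoc[OF E_transpA[of "dual_tnA X Y" B, simplified]])
  also have "\<dots> = E ?A B \<odot> lw (dual C ?A) (iassocA ?dY ?dX B) \<odot> rw (transpA (dual_tnA X Y) \<odot> pivA ?V) ?F"
    by (simp add: interchange[where X' = "dual C ?A"])
  also have "\<dots> = (E ?A B \<odot> lw (dual C ?A) (iassocA ?dY ?dX B) \<odot> rw (dual_tnA ?dY ?dX) ?F \<odot> iassocA ?ddX ?ddY ?F) \<odot>
     assocA ?ddX ?ddY ?F \<odot> rw (rw (pivA X) ?ddY) ?F \<odot> rw (lw X (pivA Y)) ?F"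
    by (simp add: piv_tn_arr rw_acmp acmp_assoc)
  also have "\<dots> = E ?dX B \<odot> lw ?ddX (E ?dY (?dX \<boxtimes> B)) \<odot>
     assocA ?ddX ?ddY ?F \<odot> rw (rw (pivA X) ?ddY) ?F \<odot> rw (lw X (pivA Y)) ?F"
    unfolding E_dual_tnA by (simp add: acmp_assoc)
  also have "\<dots> = E ?dX B \<odot> lw ?ddX (E ?dY (?dX \<boxtimes> B)) \<odot>
     rw (pivA X) (?ddY \<boxtimes> ?F) \<odot> lw X (rw (pivA Y) ?F) \<odot> assocA X Y ?F"
    by (simp add: acmp_reassoc[OF assocA_nat1] assocA_nat2 acmp_assoc)
  also have "\<dots> = E ?dX B \<odot> rw (pivA X) (?dX \<boxtimes> B) \<odot> lw X (E ?dY (?dX \<boxtimes> B)) \<odot> lw X (rw (pivA Y) ?F) \<odot> assocA X Y ?F"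
    by (simp add: acmp_reassoc[OF interchange[symmetric, where X = X and t = "pivA X"]] acmp_assoc)
  also have "\<dots> = E' X B \<odot> lw X (E' Y (?dX \<boxtimes> B)) \<odot> assocA X Y ?F"
    by (simp add: E'_def lw_acmp acmp_assoc)
  finally show ?thesis .
qed

text \<open>The mate of \<open>E'_dual_tnA\<close>: the two left adjoints are
  \<open>(X \<boxtimes> Y) \<boxtimes> -\<close> and \<open>X \<boxtimes> (Y \<boxtimes> -)\<close>,
  compared by the associator, and the second adjunction is the composite of those for
  \<open>X\<close> and \<open>Y\<close>.\<close>

lemma K'_tn:
  "lw (dual C (X \<boxtimes> Y)) (assocA X Y B) \<odot> K' (X \<boxtimes> Y) B =
   (rw (dual_tnA X Y) (X \<boxtimes> (Y \<boxtimes> B)) \<odot> iassocA (dual C Y) (dual C X) (X \<boxtimes> (Y \<boxtimes> B))) \<odot>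
   lw (dual C Y) (K' X (Y \<boxtimes> B)) \<odot> K' Y B"
proof (rule mate[where u = "assocA X Y" and w = "\<lambda>B. rw (dual_tnA X Y) B \<odot> iassocA (dual C Y) (dual C X) B"
      and ?e1.0 = "E' (X \<boxtimes> Y)" and ?k1.0 = "\<lambda>B. K' (X \<boxtimes> Y) B"
      and ?e2.0 = "\<lambda>B. E' X B \<odot> lw X (E' Y (dual C X \<boxtimes> B))"
      and ?k2.0 = "\<lambda>B. lw (dual C Y) (K' X (Y \<boxtimes> B)) \<odot> K' Y B",
      OF arr_functor_lw arr_functor_lw arr_functor_lw_lw arr_functor_lw_lw])
  fix B
  let ?dX = "dual C X" and ?dY = "dual C Y" and ?D = "X \<boxtimes> (Y \<boxtimes> B)"
  have "(E' X ?D \<odot> lw X (E' Y (?dX \<boxtimes> ?D))) \<odot> lw X (lw Y (lw ?dY (K' X (Y \<boxtimes> B)) \<odot> K' Y B)) =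
    E' X ?D \<odot> lw X ((E' Y (?dX \<boxtimes> ?D) \<odot> lw Y (lw ?dY (K' X (Y \<boxtimes> B)))) \<odot> lw Y (K' Y B))"
    by (simp add: lw_acmp acmp_assoc)
  also have "\<dots> = E' X ?D \<odot> lw X (K' X (Y \<boxtimes> B) \<odot> E' Y (Y \<boxtimes> B) \<odot> lw Y (K' Y B))"
    by (subst E'_nat) (simp_all add: acmp_assoc)
  also have "\<dots> = ide ?D" by (simp add: zig')
  finally show "(E' X ?D \<odot> lw X (E' Y (?dX \<boxtimes> ?D))) \<odot> lw X (lw Y (lw ?dY (K' X (Y \<boxtimes> B)) \<odot> K' Y B)) = ide ?D" .
next
  fix t :: "('o, 'm) arr"
  assume "valid t"
  then show "assocA X Y (cd t) \<odot> lw (X \<boxtimes> Y) t = lw X (lw Y t) \<odot> assocA X Y (dm t)"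
    by (rule assocA_nat3) simp
next
  fix B
  show "E' (X \<boxtimes> Y) B \<odot> lw (X \<boxtimes> Y) (rw (dual_tnA X Y) B \<odot> iassocA (dual C Y) (dual C X) B) =
    (E' X B \<odot> lw X (E' Y (dual C X \<boxtimes> B))) \<odot> assocA X Y (dual C Y \<boxtimes> (dual C X \<boxtimes> B))"
    using E'_dual_tnA by (simp add: acmp_assoc)
qed (simp_all add: K'_nat zag')

section \<open>Partial traces\<close>

definition ptraceA :: "'o \<Rightarrow> 'o \<Rightarrow> 'o \<Rightarrow> ('o, 'm) arr \<Rightarrow> ('o, 'm) arr" where
  "ptraceA V X Y t = E V Y \<odot> lw (dual C V) t \<odot> K' V X"

lemma ptraceA_simps [simp]: "dm (ptraceA V X Y t) = X" "cd (ptraceA V X Y t) = Y" "valid (ptraceA V X Y t)"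
  by (simp_all add: ptraceA_def)

lemma mr_coevA': "mr (coevA' X) = coev' C X"
  by (simp add: coevA'_def coev'_def mr_acmp) (simp add: lw_def mr_invA pivA_def coevA_def)

lemma mr_ptraceA: "\<lbrakk>valid t; dm t = V \<boxtimes> X; cd t = V \<boxtimes> Y\<rbrakk> \<Longrightarrow> mr (ptraceA V X Y t) = ptrace C V X Y (mr t)"
  unfolding ptrace_def mr_coevA'[symmetric]
  by (simp add: ptraceA_def eps_def kap_def acmp_assoc mr_acmp mr_iassocA mr_ilunA)
    (simp add: lunA_def lw_def rw_def assocA_def evA_def)

text \<open>At the coevaluation \<open>t\<close> is replaced by its transpose on the returning
  strand, which commutes with \<open>f\<close> by interchange; at the evaluation it turns back into
  \<open>t\<close>, now on the other side of \<open>f\<close>.\<close>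

lemma ptraceA_cyclic:
  assumes "valid t" "dm t = V" "cd t = W" "valid f" "dm f = W \<boxtimes> X" "cd f = V \<boxtimes> Y"
  shows "ptraceA V X Y (f \<odot> rw t X) = ptraceA W X Y (rw t Y \<odot> f)"
proof -
  have "ptraceA V X Y (f \<odot> rw t X) = E V Y \<odot> lw (dual C V) f \<odot> rw (transpA t) (W \<boxtimes> X) \<odot> K' W X"
    using K'_transpA[of t X] assms by (simp add: ptraceA_def lw_acmp acmp_assoc)
  also have "\<dots> = (E V Y \<odot> rw (transpA t) (V \<boxtimes> Y)) \<odot> lw (dual C W) f \<odot> K' W X"
    using assms by (simp add: acmp_reassoc[OF interchange[symmetric, where X = "dual C W"]] acmp_assoc)
  also have "\<dots> = ptraceA W X Y (rw t Y \<odot> f)"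
    using E_transpA[of t Y] assms by (simp add: ptraceA_def lw_acmp acmp_assoc)
  finally show ?thesis .
qed

text \<open>\<open>K'_tn\<close> splits the coevaluation at the price of a factor
  \<open>dual_tnA\<close>. This factor slides along the dual strand past \<open>f\<close> and is
  absorbed at the top by \<open>E_dual_tnA\<close>, leaving nested traces with \<open>X\<close>
  innermost.\<close>

lemma ptraceA_tn:
  assumes "valid f" "dm f = X \<boxtimes> (Y \<boxtimes> W)" "cd f = X \<boxtimes> (Y \<boxtimes> W')"
  shows "ptraceA (X \<boxtimes> Y) W W' (iassocA X Y W' \<odot> f \<odot> assocA X Y W) = ptraceA Y W W' (ptraceA X (Y \<boxtimes> W) (Y \<boxtimes> W') f)"
proof -
  let ?V = "X \<boxtimes> Y" and ?dX = "dual C X" and ?dY = "dual C Y"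
  have "ptraceA ?V W W' (iassocA X Y W' \<odot> f \<odot> assocA X Y W) =
    E ?V W' \<odot> lw (dual C ?V) (iassocA X Y W') \<odot> lw (dual C ?V) f \<odot> lw (dual C ?V) (assocA X Y W) \<odot> K' ?V W"
    using assms by (simp add: ptraceA_def lw_acmp acmp_assoc)
  also have "\<dots> = E ?V W' \<odot> lw (dual C ?V) (iassocA X Y W') \<odot> (lw (dual C ?V) f \<odot>
      rw (dual_tnA X Y) (X \<boxtimes> (Y \<boxtimes> W)) \<odot> iassocA ?dY ?dX (X \<boxtimes> (Y \<boxtimes> W))) \<odot> lw ?dY (K' X (Y \<boxtimes> W)) \<odot> K' Y W"
    by (simp add: K'_tn acmp_assoc)
  also have "lw (dual C ?V) f \<odot> rw (dual_tnA X Y) (X \<boxtimes> (Y \<boxtimes> W)) \<odot> iassocA ?dY ?dX (X \<boxtimes> (Y \<boxtimes> W)) =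
     rw (dual_tnA X Y) (X \<boxtimes> (Y \<boxtimes> W')) \<odot> iassocA ?dY ?dX (X \<boxtimes> (Y \<boxtimes> W')) \<odot> lw ?dY (lw ?dX f)"
    using assms
    by (simp add: iassocA_nat3 acmp_reassoc[OF interchange[symmetric, where X = "?dY \<boxtimes> ?dX" and t = "dual_tnA X Y"]] acmp_assoc)
  finally have "ptraceA ?V W W' (iassocA X Y W' \<odot> f \<odot> assocA X Y W) =
     (E ?V W' \<odot> lw (dual C ?V) (iassocA X Y W') \<odot> rw (dual_tnA X Y) (X \<boxtimes> (Y \<boxtimes> W')) \<odot>
       iassocA ?dY ?dX (X \<boxtimes> (Y \<boxtimes> W'))) \<odot> lw ?dY (lw ?dX f) \<odot> lw ?dY (K' X (Y \<boxtimes> W)) \<odot> K' Y W"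
    by (simp add: acmp_assoc)
  then show ?thesis
    unfolding E_dual_tnA using assms by (simp add: ptraceA_def lw_acmp acmp_assoc)
qed

lemma ptraceA_cmp:
  assumes "valid f" "dm f = V \<boxtimes> X" "cd f = V \<boxtimes> Y" "valid b" "cd b = X" "valid c" "dm c = Y"
  shows "ptraceA V (dm b) (cd c) (lw V c \<odot> f \<odot> lw V b) = c \<odot> ptraceA V X Y f \<odot> b"
  using assms by (simp add: ptraceA_def lw_acmp acmp_assoc K'_nat acmp_reassoc[OF E_nat])

text \<open>A bystander strand \<open>Z\<close> to the right of the loop joins the parameter of both
  the evaluation and the coevaluation, by \<open>eps_tn\<close> and \<open>kap_tn\<close>.\<close>

lemma ptraceA_rw:
  assumes "valid f" "dm f = V \<boxtimes> X" "cd f = V \<boxtimes> Y"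
  shows "ptraceA V (X \<boxtimes> Z) (Y \<boxtimes> Z) (assocA V Y Z \<odot> rw f Z \<odot> iassocA V X Z) = rw (ptraceA V X Y f) Z"
proof -
  let ?dV = "dual C V"
  have "rw (ptraceA V X Y f) Z = E V (Y \<boxtimes> Z) \<odot> lw ?dV (assocA V Y Z) \<odot> (assocA ?dV (V \<boxtimes> Y) Z \<odot> rw (lw ?dV f) Z) \<odot> rw (K' V X) Z"
    using assms by (simp add: ptraceA_def rw_acmp eps_tn acmp_assoc)
  also have "\<dots> = E V (Y \<boxtimes> Z) \<odot> lw ?dV (assocA V Y Z) \<odot> lw ?dV (rw f Z) \<odot> assocA ?dV (V \<boxtimes> X) Z \<odot> rw (K' V X) Z"
    using assms by (simp add: assocA_nat2 acmp_assoc)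
  also have "\<dots> = E V (Y \<boxtimes> Z) \<odot> lw ?dV (assocA V Y Z) \<odot> lw ?dV (rw f Z) \<odot> lw ?dV (iassocA V X Z) \<odot> K' V (X \<boxtimes> Z)"
    by (simp add: kap_tn[OF copairing_coevA'] invA_lw[symmetric])
  finally show ?thesis
    using assms by (simp add: ptraceA_def lw_acmp acmp_assoc)
qed

end

section \<open>Encircling loops\<close>

context linear_category
begin

definition sclA :: "complex \<Rightarrow> ('o, 'm) arr \<Rightarrow> ('o, 'm) arr" where
  "sclA c t = Arr (dm t) (c \<bullet> mr t) (cd t)"

lemma sclA_simps [simp]: "dm (sclA c t) = dm t" "cd (sclA c t) = cd t" "mr (sclA c t) = c \<bullet> mr t"
  by (simp_all add: sclA_def)

lemma valid_sclA [simp]: "valid t \<Longrightarrow> valid (sclA c t)"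
  by (simp add: valid_def scl_in)

lemma acmp_sclA:
  assumes "valid t" "valid u" "cd u = dm t"
  shows "sclA c t \<odot> u = sclA c (t \<odot> u)" "t \<odot> sclA c u = sclA c (t \<odot> u)"
proof -
  have t: "mr t \<in> Hom C (dm t) (cd t)" and u: "mr u \<in> Hom C (dm u) (dm t)"
    using assms by (auto simp: valid_def)
  show "sclA c t \<odot> u = sclA c (t \<odot> u)" "t \<odot> sclA c u = sclA c (t \<odot> u)"
    using assms cmp_scl_left[OF t u] cmp_scl_right[OF t u] by (auto intro!: arr_eqI simp: mr_acmp)
qed

end

context pivotal_fusion_category
begin

lemma tn_sclA:
  assumes "valid t"
  shows "lw X (sclA c t) = sclA c (lw X t)" "rw (sclA c t) X = sclA c (rw t X)"
proof -
  have t: "mr t \<in> Hom C (dm t) (cd t)" using assms by (auto simp: valid_def)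
  show "lw X (sclA c t) = sclA c (lw X t)" "rw (sclA c t) X = sclA c (rw t X)"
    using tn_scl_left[OF t Idm_in] tn_scl_right[OF Idm_in t]
    by (auto intro!: arr_eqI) (auto simp: lw_def rw_def)
qed

lemma ptraceA_sclA:
  assumes "valid t" "dm t = V \<boxtimes> X" "cd t = V \<boxtimes> Y"
  shows "ptraceA V X Y (sclA c t) = sclA c (ptraceA V X Y t)"
  using assms by (simp add: ptraceA_def tn_sclA acmp_sclA)

lemma lw_add:
  assumes "f \<in> Hom C X Y" "g \<in> Hom C X Y"
  shows "mr (lw Z (Arr X (f + g) Y)) = mr (lw Z (Arr X f Y)) + mr (lw Z (Arr X g Y))"
  using assms by (simp add: lw_def tn_add_right[OF Idm_in])

lemma ptrace_add:
  assumes "f \<in> Hom C (V \<boxtimes> X) (V \<boxtimes> Y)" "g \<in> Hom C (V \<boxtimes> X) (V \<boxtimes> Y)"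
  shows "ptrace C V X Y (f + g) = ptrace C V X Y f + ptrace C V X Y g"
proof -
  let ?A = "\<lambda>f. Arr (V \<boxtimes> X) f (V \<boxtimes> Y)"
  have v: "valid (?A f)" if "f \<in> Hom C (V \<boxtimes> X) (V \<boxtimes> Y)" for f using that by (rule valid_Arr)
  have p: "ptrace C V X Y f = mr (E V Y) \<cdot> mr (lw (dual C V) (?A f)) \<cdot> mr (K' V X)"
    if "f \<in> Hom C (V \<boxtimes> X) (V \<boxtimes> Y)" for f
    using mr_ptraceA[OF v[OF that], of V X Y] v[OF that] by (simp add: ptraceA_def mr_acmp)
  let ?l = "\<lambda>f. mr (lw (dual C V) (?A f))"
  have l: "?l f \<in> Hom C (dual C V \<boxtimes> (V \<boxtimes> X)) (dual C V \<boxtimes> (V \<boxtimes> Y))"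
    if "f \<in> Hom C (V \<boxtimes> X) (V \<boxtimes> Y)" for f
    using valid_lw[OF v[OF that], of "dual C V"] by (simp add: valid_def)
  have K: "mr (K' V X) \<in> Hom C X (dual C V \<boxtimes> (V \<boxtimes> X))" and E: "mr (E V Y) \<in> Hom C (dual C V \<boxtimes> (V \<boxtimes> Y)) Y"
    using kap_simps(3)[of "dual C V" V "coevA' V" X] eps_simps(3)[of "dual C V" V "evA V" Y]
    by (simp_all add: valid_def)
  show ?thesis
    using assms
    by (simp add: p add_in lw_add cmp_add_left[OF l l K] cmp_add_right[OF E cmp_in[OF l K] cmp_in[OF l K]])
qed

lemma ptrace_0: "ptrace C V X Y 0 = 0"
  using ptrace_add[of 0 V X Y 0] by simp

lemma tn_0_left: "g \<in> Hom C X' Y' \<Longrightarrow> 0 \<boxtimes>\<^sub>m g = 0"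
  using tn_add_left[of 0 _ _ 0 g] by simp

lemma tn_0_right: "g \<in> Hom C X' Y' \<Longrightarrow> g \<boxtimes>\<^sub>m 0 = 0"
  using tn_add_right[of g _ _ 0 _ _ 0] by simp

end

section \<open>The group action and the crossed braiding as arrows\<close>

context equivariant_fusion_category
begin

lemma one_closed [simp]: "\<one>\<^bsub>G\<^esub> \<in> carrier G"
  and inv_closed [simp]: "h \<in> carrier G \<Longrightarrow> inv\<^bsub>G\<^esub> h \<in> carrier G"
  and l_one [simp]: "h \<in> carrier G \<Longrightarrow> \<one>\<^bsub>G\<^esub> \<otimes>\<^bsub>G\<^esub> h = h"
  and r_one [simp]: "h \<in> carrier G \<Longrightarrow> h \<otimes>\<^bsub>G\<^esub> \<one>\<^bsub>G\<^esub> = h"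
  and r_inv [simp]: "h \<in> carrier G \<Longrightarrow> h \<otimes>\<^bsub>G\<^esub> inv\<^bsub>G\<^esub> h = \<one>\<^bsub>G\<^esub>"
  and inv_one [simp]: "inv\<^bsub>G\<^esub> \<one>\<^bsub>G\<^esub> = \<one>\<^bsub>G\<^esub>"
  and inv_inv [simp]: "h \<in> carrier G \<Longrightarrow> inv\<^bsub>G\<^esub> (inv\<^bsub>G\<^esub> h) = h"
proof -
  interpret group G by (rule group)
  show "\<one>\<^bsub>G\<^esub> \<in> carrier G" "h \<in> carrier G \<Longrightarrow> inv\<^bsub>G\<^esub> h \<in> carrier G"
    "h \<in> carrier G \<Longrightarrow> \<one>\<^bsub>G\<^esub> \<otimes>\<^bsub>G\<^esub> h = h" "h \<in> carrier G \<Longrightarrow> h \<otimes>\<^bsub>G\<^esub> \<one>\<^bsub>G\<^esub> = h"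
    "h \<in> carrier G \<Longrightarrow> h \<otimes>\<^bsub>G\<^esub> inv\<^bsub>G\<^esub> h = \<one>\<^bsub>G\<^esub>" "inv\<^bsub>G\<^esub> \<one>\<^bsub>G\<^esub> = \<one>\<^bsub>G\<^esub>"
    "h \<in> carrier G \<Longrightarrow> inv\<^bsub>G\<^esub> (inv\<^bsub>G\<^esub> h) = h" by simp_all
qed

text \<open>Applied to \<open>mu\<close> and \<open>eta\<close> at the neutral element: there the
  coherence laws \<open>alpha_mu\<close> and \<open>alpha_eta\<close> say that these isomorphisms
  are idempotent.\<close>

lemma idempotent_iso:
  assumes "isoA t" "t \<odot> t = t" "dm t = cd t"
  shows "t = ide (dm t)"
  using invA_left'[OF assms(1), of t] assms by simp

lemma mu_one: "mu C \<one>\<^bsub>G\<^esub> X Y = Idm C (X \<boxtimes> Y)"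
proof -
  let ?m = "Arr (X \<boxtimes> Y) (mu C \<one>\<^bsub>G\<^esub> X Y) (X \<boxtimes> Y)"
  have iso: "isoA ?m" using mu_iso[of "\<one>\<^bsub>G\<^esub>" X Y] by (simp add: isoA_def act_one)
  have m: "mu C \<one>\<^bsub>G\<^esub> X Y \<in> Hom C (X \<boxtimes> Y) (X \<boxtimes> Y)" using isoA_valid[OF iso] by (simp add: valid_def)
  have "mu C \<one>\<^bsub>G\<^esub> X Y \<cdot> mu C \<one>\<^bsub>G\<^esub> X Y = mu C \<one>\<^bsub>G\<^esub> X Y"
    using alpha_mu[of "\<one>\<^bsub>G\<^esub>" "\<one>\<^bsub>G\<^esub>" X Y]
    by (simp add: act_one act_one(2)[OF m] alpha_one tn_Idm Idm_right[OF m] Idm_left[OF cmp_in[OF m m]])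
  then have "?m \<odot> ?m = ?m" using isoA_valid[OF iso] by (intro arr_eqI) (simp_all add: mr_acmp)
  from idempotent_iso[OF iso this] show ?thesis by (simp add: ide_def)
qed

lemma eta_one: "eta C \<one>\<^bsub>G\<^esub> = Idm C (unit C)"
proof -
  let ?m = "Arr (unit C) (eta C \<one>\<^bsub>G\<^esub>) (unit C)"
  have iso: "isoA ?m" using eta_iso[of "\<one>\<^bsub>G\<^esub>"] by (simp add: isoA_def act_one)
  have m: "eta C \<one>\<^bsub>G\<^esub> \<in> Hom C (unit C) (unit C)" using isoA_valid[OF iso] by (simp add: valid_def)
  have "eta C \<one>\<^bsub>G\<^esub> \<cdot> eta C \<one>\<^bsub>G\<^esub> = eta C \<one>\<^bsub>G\<^esub>"
    using alpha_eta[of "\<one>\<^bsub>G\<^esub>" "\<one>\<^bsub>G\<^esub>"]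
    by (simp add: act_one(1) act_one(2)[OF m] alpha_one Idm_left[OF cmp_in[OF m m]])
  then have "?m \<odot> ?m = ?m" using isoA_valid[OF iso] by (intro arr_eqI) (simp_all add: mr_acmp)
  from idempotent_iso[OF iso this] show ?thesis by (simp add: ide_def)
qed

definition braidA :: "'g \<Rightarrow> 'o \<Rightarrow> 'o \<Rightarrow> ('o, 'm) arr" where
  "braidA h X Y = Arr (X \<boxtimes> Y) (braid C h X Y) (actO C h Y \<boxtimes> X)"

definition actA :: "'g \<Rightarrow> ('o, 'm) arr \<Rightarrow> ('o, 'm) arr" where
  "actA h t = Arr (actO C h (dm t)) (actM C h (mr t)) (actO C h (cd t))"

text \<open>The constraint at \<open>h\<close> and its inverse has target \<open>W\<close> itself
  because the neutral element acts strictly by the identity.\<close>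

definition alphaA :: "'g \<Rightarrow> 'o \<Rightarrow> ('o, 'm) arr" where
  "alphaA h W = Arr (actO C h (actO C (inv\<^bsub>G\<^esub> h) W)) (alpha C h (inv\<^bsub>G\<^esub> h) W) W"

lemma braidA_simps [simp]: "dm (braidA h X Y) = X \<boxtimes> Y" "cd (braidA h X Y) = actO C h Y \<boxtimes> X"
  "dm (actA h t) = actO C h (dm t)" "cd (actA h t) = actO C h (cd t)"
  "dm (alphaA h W) = actO C h (actO C (inv\<^bsub>G\<^esub> h) W)" "cd (alphaA h W) = W"
  by (simp_all add: braidA_def actA_def alphaA_def)

lemma isoA_braidA [simp]: "\<lbrakk>h \<in> carrier G; X \<in> deg C h\<rbrakk> \<Longrightarrow> isoA (braidA h X Y)"
  by (simp add: isoA_def braidA_def braid_iso)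

lemma isoA_alphaA [simp]: "h \<in> carrier G \<Longrightarrow> isoA (alphaA h W)"
  using alpha_iso[of h "inv\<^bsub>G\<^esub> h" W] by (simp add: isoA_def alphaA_def act_one)

lemma valid_actA [simp]: "\<lbrakk>h \<in> carrier G; valid t\<rbrakk> \<Longrightarrow> valid (actA h t)"
  by (simp add: valid_def actA_def act_in)

lemma actA_one: "valid t \<Longrightarrow> actA \<one>\<^bsub>G\<^esub> t = t"
  by (intro arr_eqI) (auto simp: act_one(1), auto simp: actA_def valid_def intro: act_one(2))

lemma braidA_nat_left:
  assumes "h \<in> carrier G" "valid t" "dm t \<in> deg C h" "cd t = X" "X \<in> deg C h"
  shows "braidA h X Y \<odot> rw t Y = lw (actO C h Y) t \<odot> braidA h (dm t) Y"
proof (rule arr_eqI)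
  have t: "mr t \<in> Hom C (dm t) X" using assms by (auto simp: valid_def)
  show "mr (braidA h X Y \<odot> rw t Y) = mr (lw (actO C h Y) t \<odot> braidA h (dm t) Y)"
    using assms braid_nat[OF assms(1,3,5) t Idm_in[of Y]] act_Idm[of h Y]
    by (simp add: mr_acmp) (simp add: braidA_def rw_def lw_def)
qed (use assms in simp_all)

lemma braidA_nat_right:
  assumes "h \<in> carrier G" "valid t" "X \<in> deg C h" "cd t = Y"
  shows "braidA h X Y \<odot> lw X t = rw (actA h t) X \<odot> braidA h X (dm t)"
proof (rule arr_eqI)
  have t: "mr t \<in> Hom C (dm t) Y" using assms by (auto simp: valid_def)
  show "mr (braidA h X Y \<odot> lw X t) = mr (rw (actA h t) X \<odot> braidA h X (dm t))"
    using assms braid_nat[OF assms(1,3,3) Idm_in t]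
    by (simp add: mr_acmp) (simp add: braidA_def rw_def lw_def actA_def)
qed (use assms in simp_all)

lemma braidA_tn_right:
  assumes "W \<in> deg C \<one>\<^bsub>G\<^esub>"
  shows "braidA \<one>\<^bsub>G\<^esub> W (X \<boxtimes> Y) =
    iassocA X Y W \<odot> lw X (braidA \<one>\<^bsub>G\<^esub> W Y) \<odot> assocA X W Y \<odot> rw (braidA \<one>\<^bsub>G\<^esub> W X) Y \<odot> iassocA W X Y"
proof (rule arr_eqI)
  let ?r = "iassocA X Y W \<odot> lw X (braidA \<one>\<^bsub>G\<^esub> W Y) \<odot> assocA X W Y \<odot> rw (braidA \<one>\<^bsub>G\<^esub> W X) Y \<odot> iassocA W X Y"
  have "mr ?r \<in> Hom C (W \<boxtimes> (X \<boxtimes> Y)) ((X \<boxtimes> Y) \<boxtimes> W)"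
    using valid_acmp[of "iassocA X Y W" "lw X (braidA \<one>\<^bsub>G\<^esub> W Y) \<odot> assocA X W Y \<odot> rw (braidA \<one>\<^bsub>G\<^esub> W X) Y \<odot> iassocA W X Y"]
    unfolding valid_def by simp
  then show "mr (braidA \<one>\<^bsub>G\<^esub> W (X \<boxtimes> Y)) = mr ?r"
    using assms braid_tn_right[of "\<one>\<^bsub>G\<^esub>" W X Y]
    by (simp add: mr_acmp act_one(1) mr_iassocA mu_one tn_Idm)
      (simp add: braidA_def rw_def lw_def assocA_def act_one(1) Idm_left)
qed (simp_all add: act_one(1))

text \<open>For \<open>X\<close> of degree one the constraint \<open>alpha\<close> in the hexagon is
  an identity by \<open>alpha_one\<close>, and the crossing of \<open>X\<close> is an ordinary
  braiding.\<close>

lemma braidA_tn_left: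
  assumes "h \<in> carrier G" "X \<in> deg C \<one>\<^bsub>G\<^esub>" "Y \<in> deg C h"
  shows "braidA h (X \<boxtimes> Y) Z =
    assocA (actO C h Z) X Y \<odot> rw (braidA \<one>\<^bsub>G\<^esub> X (actO C h Z)) Y \<odot> iassocA X (actO C h Z) Y \<odot>
    lw X (braidA h Y Z) \<odot> assocA X Y Z"
proof (rule arr_eqI)
  let ?T = "actO C h Z"
  let ?r = "assocA ?T X Y \<odot> rw (braidA \<one>\<^bsub>G\<^esub> X ?T) Y \<odot> iassocA X ?T Y \<odot> lw X (braidA h Y Z) \<odot> assocA X Y Z"
  have "mr ?r \<in> Hom C ((X \<boxtimes> Y) \<boxtimes> Z) (?T \<boxtimes> (X \<boxtimes> Y))"
    using valid_acmp[of "assocA ?T X Y" "rw (braidA \<one>\<^bsub>G\<^esub> X ?T) Y \<odot> iassocA X ?T Y \<odot> lw X (braidA h Y Z) \<odot> assocA X Y Z"]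
    unfolding valid_def by simp
  then show "mr (braidA h (X \<boxtimes> Y) Z) = mr ?r"
    using assms braid_tn_left[OF one_closed assms, of Z]
    by (simp add: mr_acmp act_one(1) mr_iassocA alpha_one tn_Idm)
      (simp add: braidA_def rw_def lw_def assocA_def act_one(1) Idm_left)
qed (simp_all add: act_one(1))

text \<open>The encircling of \<open>W\<close> by \<open>X\<close> consists of two crossings: \<open>passA\<close> moves \<open>W\<close> to the left of
  \<open>X\<close> and \<open>returnA\<close> moves it back.\<close>

definition passA :: "'o \<Rightarrow> 'o \<Rightarrow> ('o, 'm) arr" where
  "passA X W = invA (braidA \<one>\<^bsub>G\<^esub> W X)"

definition returnA :: "'g \<Rightarrow> 'o \<Rightarrow> 'o \<Rightarrow> ('o, 'm) arr" where
  "returnA h X W = invA (rw (alphaA h W) X \<odot> braidA h X (actO C (inv\<^bsub>G\<^esub> h) W))"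

definition encircleA :: "'g \<Rightarrow> 'o \<Rightarrow> 'o \<Rightarrow> ('o, 'm) arr" where
  "encircleA h X W = returnA h X W \<odot> passA X W"

lemma passA_simps [simp]: "dm (passA X W) = X \<boxtimes> W" "cd (passA X W) = W \<boxtimes> X"
  "dm (returnA h X W) = W \<boxtimes> X" "cd (returnA h X W) = X \<boxtimes> actO C (inv\<^bsub>G\<^esub> h) W"
  "dm (encircleA h X W) = X \<boxtimes> W" "cd (encircleA h X W) = X \<boxtimes> actO C (inv\<^bsub>G\<^esub> h) W" "valid (encircleA h X W)"
  by (simp_all add: passA_def returnA_def encircleA_def act_one(1))

lemma isoA_passA [simp]: "W \<in> deg C \<one>\<^bsub>G\<^esub> \<Longrightarrow> isoA (passA X W)"
  and isoA_returnA [simp]: "\<lbrakk>h \<in> carrier G; X \<in> deg C h\<rbrakk> \<Longrightarrow> isoA (returnA h X W)"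
  by (simp_all add: passA_def returnA_def)

lemma encircleA_one: 
  assumes "X \<in> deg C \<one>\<^bsub>G\<^esub>"
  shows "encircleA \<one>\<^bsub>G\<^esub> X W = invA (braidA \<one>\<^bsub>G\<^esub> X W) \<odot> passA X W"
proof -
  have "alphaA \<one>\<^bsub>G\<^esub> W = ide W" by (simp add: alphaA_def ide_def act_one(1) alpha_one)
  then show ?thesis using assms by (simp add: encircleA_def returnA_def act_one(1))
qed

text \<open>Naturality of the two braidings passes to their inverses by \<open>flip\<close>, so a
  morphism on the loop slides through both crossings.\<close>

lemma encircleA_nat:
  assumes "h \<in> carrier G" "W \<in> deg C \<one>\<^bsub>G\<^esub>" "valid u" "dm u = X" "cd u = Y" "X \<in> deg C h" "Y \<in> deg C h"
  shows "encircleA h Y W \<odot> rw u W = rw u (actO C (inv\<^bsub>G\<^esub> h) W) \<odot> encircleA h X W"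
proof -
  let ?W = "actO C (inv\<^bsub>G\<^esub> h) W"
  have b: "passA Y W \<odot> rw u W = lw W u \<odot> passA X W"
    unfolding passA_def
  proof (rule flip)
    show "braidA \<one>\<^bsub>G\<^esub> W Y \<odot> lw W u = rw u W \<odot> braidA \<one>\<^bsub>G\<^esub> W X"
      using braidA_nat_right[of "\<one>\<^bsub>G\<^esub>" u W Y] assms by (simp add: actA_one)
  qed (use assms in \<open>simp_all add: act_one(1)\<close>)
  have c: "returnA h Y W \<odot> lw W u = rw u ?W \<odot> returnA h X W"
    unfolding returnA_def
  proof (rule flip)
    show "(rw (alphaA h W) Y \<odot> braidA h Y ?W) \<odot> rw u ?W = lw W u \<odot> (rw (alphaA h W) X \<odot> braidA h X ?W)"
      using assms by (simp add: acmp_assoc braidA_nat_left acmp_reassoc[OF interchange[where X' = W and t = "alphaA h W"]])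
  qed (use assms in simp_all)
  show ?thesis by (simp add: encircleA_def acmp_assoc b) (simp add: acmp_reassoc[OF c] acmp_assoc)
qed

lemma passA_tn:
  assumes "W \<in> deg C \<one>\<^bsub>G\<^esub>"
  shows "passA (X \<boxtimes> Y) W = assocA W X Y \<odot> rw (passA X W) Y \<odot> iassocA X W Y \<odot> lw X (passA Y W) \<odot> assocA X Y W"
  using assms by (simp add: passA_def braidA_tn_right invA_acmp invA_lw invA_rw act_one(1) acmp_assoc)
    (subst invA_unique[of "iassocA X Y W" "assocA X Y W"], simp_all, subst invA_unique[of "iassocA W X Y" "assocA W X Y"], simp_all)

lemma returnA_tn:
  fixes W :: 'o
  assumes "h \<in> carrier G" "X \<in> deg C \<one>\<^bsub>G\<^esub>" "Y \<in> deg C h"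
  defines "W' \<equiv> actO C (inv\<^bsub>G\<^esub> h) W"
  shows "returnA h (X \<boxtimes> Y) W =
    iassocA X Y W' \<odot> lw X (returnA h Y W) \<odot> assocA X W Y \<odot> rw (invA (braidA \<one>\<^bsub>G\<^esub> X W)) Y \<odot> iassocA W X Y"
proof -
  let ?T = "actO C h W'" and ?a = "alphaA h W"
  have a: "dm ?a = ?T" "cd ?a = W" "valid ?a" using assms by (simp_all add: W'_def)
  have XY: "X \<boxtimes> Y \<in> deg C h" using deg_tn[OF one_closed assms(1-3)] assms(1) by simp
  \<comment> \<open>Since \<open>X\<close> has degree one, its crossing is natural without any
    action on morphisms. So \<open>alphaA h W\<close> slides through it and \<open>X\<close> crosses
    \<open>W\<close> itself instead of the twice translated object.\<close>
  have nat: "rw ?a X \<odot> braidA \<one>\<^bsub>G\<^esub> X ?T = braidA \<one>\<^bsub>G\<^esub> X W \<odot> lw X ?a"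
    using braidA_nat_right[of "\<one>\<^bsub>G\<^esub>" ?a X W] assms(2) a by (simp add: actA_one)
  have "rw ?a (X \<boxtimes> Y) \<odot> braidA h (X \<boxtimes> Y) W' =
    (rw ?a (X \<boxtimes> Y) \<odot> assocA ?T X Y) \<odot> rw (braidA \<one>\<^bsub>G\<^esub> X ?T) Y \<odot> iassocA X ?T Y \<odot> lw X (braidA h Y W') \<odot> assocA X Y W'"
    using assms by (simp add: braidA_tn_left acmp_assoc)
  also have "rw ?a (X \<boxtimes> Y) \<odot> assocA ?T X Y = assocA W X Y \<odot> rw (rw ?a X) Y"
    using assocA_nat1[of ?a W X Y] a by simp
  also have "(assocA W X Y \<odot> rw (rw ?a X) Y) \<odot> rw (braidA \<one>\<^bsub>G\<^esub> X ?T) Y \<odot> iassocA X ?T Y \<odot> lw X (braidA h Y W') \<odot> assocA X Y W' =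
    assocA W X Y \<odot> rw (rw ?a X \<odot> braidA \<one>\<^bsub>G\<^esub> X ?T) Y \<odot> iassocA X ?T Y \<odot> lw X (braidA h Y W') \<odot> assocA X Y W'"
    using a assms by (simp add: rw_acmp act_one(1) acmp_assoc)
  also have "\<dots> = assocA W X Y \<odot> rw (braidA \<one>\<^bsub>G\<^esub> X W) Y \<odot> (rw (lw X ?a) Y \<odot> iassocA X ?T Y) \<odot> lw X (braidA h Y W') \<odot> assocA X Y W'"
    unfolding nat using a assms by (simp add: rw_acmp acmp_assoc)
  also have "rw (lw X ?a) Y \<odot> iassocA X ?T Y = iassocA X W Y \<odot> lw X (rw ?a Y)"
    using iassocA_nat2[of ?a W X Y] a by simp
  also have "assocA W X Y \<odot> rw (braidA \<one>\<^bsub>G\<^esub> X W) Y \<odot> (iassocA X W Y \<odot> lw X (rw ?a Y)) \<odot> lw X (braidA h Y W') \<odot> assocA X Y W' =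
     assocA W X Y \<odot> rw (braidA \<one>\<^bsub>G\<^esub> X W) Y \<odot> iassocA X W Y \<odot> lw X (rw ?a Y \<odot> braidA h Y W') \<odot> assocA X Y W'"
    using a assms by (simp add: lw_acmp acmp_assoc)
  finally have *: "rw ?a (X \<boxtimes> Y) \<odot> braidA h (X \<boxtimes> Y) W' = \<dots>" .
  have i: "invA (iassocA X W Y) = assocA X W Y" by (rule invA_unique) simp_all
  show ?thesis
    unfolding returnA_def W'_def[symmetric] * using a assms(1-3)
    by (simp add: invA_acmp invA_lw invA_rw act_one(1) acmp_assoc i)
qed

text \<open>By the inverted hexagons \<open>W\<close> passes \<open>Y\<close>, passes
  \<open>X\<close>, returns past \<open>X\<close> and returns past \<open>Y\<close>. The two middle
  crossings form the complete encircling by \<open>X\<close>, with \<open>Y\<close> standing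
  by.\<close>

lemma encircleA_tn:
  assumes "h \<in> carrier G" "X \<in> deg C \<one>\<^bsub>G\<^esub>" "Y \<in> deg C h" "W \<in> deg C \<one>\<^bsub>G\<^esub>"
  shows "encircleA h (X \<boxtimes> Y) W =
    iassocA X Y (actO C (inv\<^bsub>G\<^esub> h) W) \<odot>
      (lw X (returnA h Y W) \<odot> (assocA X W Y \<odot> rw (encircleA \<one>\<^bsub>G\<^esub> X W) Y \<odot> iassocA X W Y) \<odot> lw X (passA Y W)) \<odot> assocA X Y W"
  using assms
  by (simp add: encircleA_def[of h "X \<boxtimes> Y"] passA_tn returnA_tn encircleA_one rw_acmp act_one(1) acmp_assoc)

text \<open>The trace over \<open>X \<boxtimes> Y\<close> is taken over \<open>X\<close> first. By
  \<open>ptraceA_cmp\<close> the crossings with \<open>Y\<close> leave this inner trace, and by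
  \<open>ptraceA_rw\<close> so does the bystander \<open>Y\<close>; a closed
  \<open>X\<close>-coloured loop around \<open>W\<close> remains inside the
  \<open>Y\<close>-coloured one.\<close>

lemma ptraceA_encircleA_tn:
  assumes "h \<in> carrier G" "X \<in> deg C \<one>\<^bsub>G\<^esub>" "Y \<in> deg C h" "W \<in> deg C \<one>\<^bsub>G\<^esub>"
    and f: "valid f" "dm f = Y" "cd f = Y"
  defines "W' \<equiv> actO C (inv\<^bsub>G\<^esub> h) W"
  shows "ptraceA (X \<boxtimes> Y) W W' (encircleA h (X \<boxtimes> Y) W \<odot> rw (lw X f) W) =
    ptraceA Y W W' (returnA h Y W \<odot> rw (ptraceA X W W (encircleA \<one>\<^bsub>G\<^esub> X W)) Y \<odot> passA Y W \<odot> rw f W)"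
proof -
  let ?G = "assocA X W Y \<odot> rw (encircleA \<one>\<^bsub>G\<^esub> X W) Y \<odot> iassocA X W Y"
  let ?F = "lw X (returnA h Y W) \<odot> ?G \<odot> lw X (passA Y W \<odot> rw f W)"
  have "encircleA h (X \<boxtimes> Y) W \<odot> rw (lw X f) W = iassocA X Y W' \<odot> ?F \<odot> assocA X Y W"
    using assms by (simp add: encircleA_tn acmp_assoc assocA_nat2 lw_acmp)
  then have "ptraceA (X \<boxtimes> Y) W W' (encircleA h (X \<boxtimes> Y) W \<odot> rw (lw X f) W) =
    ptraceA Y W W' (ptraceA X (Y \<boxtimes> W) (Y \<boxtimes> W') ?F)"
    using f by (simp add: ptraceA_tn W'_def)
  also have "ptraceA X (Y \<boxtimes> W) (Y \<boxtimes> W') ?F = returnA h Y W \<odot> ptraceA X (W \<boxtimes> Y) (W \<boxtimes> Y) ?G \<odot> passA Y W \<odot> rw f W"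
    using ptraceA_cmp[of ?G X "W \<boxtimes> Y" "W \<boxtimes> Y" "passA Y W \<odot> rw f W" "returnA h Y W"] assms
    by (simp add: act_one(1))
  also have "ptraceA X (W \<boxtimes> Y) (W \<boxtimes> Y) ?G = rw (ptraceA X W W (encircleA \<one>\<^bsub>G\<^esub> X W)) Y"
    by (rule ptraceA_rw) (simp_all add: act_one(1))
  finally show ?thesis .
qed

section \<open>Linearity, cyclicity and multiplicativity of loops\<close>

lemma mr_returnA:
  assumes "h \<in> carrier G" "X \<in> deg C h"
  shows "mr (returnA h X W) = inv_mor C (X \<boxtimes> actO C (inv\<^bsub>G\<^esub> h) W) (W \<boxtimes> X)
     ((alpha C h (inv\<^bsub>G\<^esub> h) W \<boxtimes>\<^sub>m Idm C X) \<cdot> braid C h X (actO C (inv\<^bsub>G\<^esub> h) W))"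
proof -
  let ?W = "actO C (inv\<^bsub>G\<^esub> h) W"
  have "mr (rw (alphaA h W) X \<odot> braidA h X ?W) = (alpha C h (inv\<^bsub>G\<^esub> h) W \<boxtimes>\<^sub>m Idm C X) \<cdot> braid C h X ?W"
    using assms by (subst mr_acmp) (simp_all, simp add: rw_def alphaA_def braidA_def)
  then show ?thesis by (simp add: returnA_def mr_invA)
qed

lemma loop_eq:
  assumes "h \<in> carrier G" "X \<in> deg C h" "W \<in> deg C \<one>\<^bsub>G\<^esub>" "f \<in> Hom C X X"
  shows "loop G C \<one>\<^bsub>G\<^esub> h X f W = mr (ptraceA X W (actO C (inv\<^bsub>G\<^esub> h) W) (encircleA h X W \<odot> rw (Arr X f X) W))"
proof -
  let ?W = "actO C (inv\<^bsub>G\<^esub> h) W"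
  have v: "valid (Arr X f X)" using assms by (simp add: valid_def)
  have b: "mr (passA X W) = inv_mor C (W \<boxtimes> X) (X \<boxtimes> W) (braid C \<one>\<^bsub>G\<^esub> W X)"
    by (simp add: passA_def mr_invA act_one(1)) (simp add: braidA_def)
  have c: "mr (returnA h X W) = inv_mor C (X \<boxtimes> ?W) (W \<boxtimes> X)
     ((alpha C h (inv\<^bsub>G\<^esub> h) W \<boxtimes>\<^sub>m Idm C X) \<cdot> braid C h X ?W)"
    using assms by (intro mr_returnA)
  have r: "mr (rw (Arr X f X) W) = f \<boxtimes>\<^sub>m Idm C W" by (simp add: rw_def)
  have "mr (encircleA h X W \<odot> rw (Arr X f X) W) = mr (returnA h X W) \<cdot> mr (passA X W) \<cdot> mr (rw (Arr X f X) W)"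
    using assms v by (simp add: encircleA_def acmp_assoc mr_acmp)
  then show ?thesis
    unfolding loop_def Let_def act_one(1) b[symmetric] c[symmetric] r[symmetric]
    using v by (subst mr_ptraceA) simp_all
qed

lemma loop_in:
  assumes "h \<in> carrier G" "X \<in> deg C h" "W \<in> deg C \<one>\<^bsub>G\<^esub>" "f \<in> Hom C X X"
  shows "loop G C \<one>\<^bsub>G\<^esub> h X f W \<in> Hom C W (actO C (inv\<^bsub>G\<^esub> h) W)"
  unfolding loop_eq[OF assms] using ptraceA_simps(3)[of X W "actO C (inv\<^bsub>G\<^esub> h) W" "encircleA h X W \<odot> rw (Arr X f X) W"]
  unfolding valid_def by simp

lemma loop_add:
  assumes "h \<in> carrier G" "X \<in> deg C h" "W \<in> deg C \<one>\<^bsub>G\<^esub>" "f \<in> Hom C X X" "g \<in> Hom C X X"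
  shows "loop G C \<one>\<^bsub>G\<^esub> h X (f + g) W = loop G C \<one>\<^bsub>G\<^esub> h X f W + loop G C \<one>\<^bsub>G\<^esub> h X g W"
proof -
  let ?W = "actO C (inv\<^bsub>G\<^esub> h) W"
  let ?T = "\<lambda>f. encircleA h X W \<odot> rw (Arr X f X) W"
  have T: "mr (?T f) \<in> Hom C (X \<boxtimes> W) (X \<boxtimes> ?W)" "loop G C \<one>\<^bsub>G\<^esub> h X f W = ptrace C X W ?W (mr (?T f))"
    "mr (?T f) = mr (encircleA h X W) \<cdot> (f \<boxtimes>\<^sub>m Idm C W)" "f \<boxtimes>\<^sub>m Idm C W \<in> Hom C (X \<boxtimes> W) (X \<boxtimes> W)"
    if f: "f \<in> Hom C X X" for f
  proof -
    have v: "valid (Arr X f X)" using f by (simp add: valid_def)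
    show "mr (?T f) \<in> Hom C (X \<boxtimes> W) (X \<boxtimes> ?W)" 
      using valid_acmp[of "encircleA h X W" "rw (Arr X f X) W"] unfolding valid_def by simp
    show "loop G C \<one>\<^bsub>G\<^esub> h X f W = ptrace C X W ?W (mr (?T f))"
      using loop_eq[OF assms(1-3) f] v by (simp add: mr_ptraceA)
    show "mr (?T f) = mr (encircleA h X W) \<cdot> (f \<boxtimes>\<^sub>m Idm C W)" using v by (simp add: mr_acmp) (simp add: rw_def)
    show "f \<boxtimes>\<^sub>m Idm C W \<in> Hom C (X \<boxtimes> W) (X \<boxtimes> W)" using f by (simp add: tn_in Idm_in)
  qed
  have M: "mr (encircleA h X W) \<in> Hom C (X \<boxtimes> W) (X \<boxtimes> ?W)" using passA_simps(7)[of h X W] unfolding valid_def by simp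
  have "mr (?T (f + g)) = mr (?T f) + mr (?T g)"
    using T(3)[OF assms(4)] T(3)[OF assms(5)] T(3)[OF add_in[OF assms(4,5)]]
      tn_add_left[OF assms(4,5) Idm_in[of W]] cmp_add_right[OF M T(4)[OF assms(4)] T(4)[OF assms(5)]] by simp
  then show ?thesis
    using ptrace_add[OF T(1)[OF assms(4)] T(1)[OF assms(5)]] T(2)[OF assms(4)] T(2)[OF assms(5)]
      T(2)[OF add_in[OF assms(4,5)]] by simp
qed

text \<open>The degree of the strand is arbitrary, because \<open>s_tilde\<close> ranges over all
  commuting pairs and its terms away from the source component must be seen to vanish.\<close>

lemma loop_0:
  assumes "b \<in> carrier G" "h \<in> carrier G" "X \<in> deg C h" "W \<in> deg C b"
  shows "loop G C b h X 0 W = 0"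
proof -
  let ?W = "actO C (inv\<^bsub>G\<^esub> h) W"
  have 1: "inv_mor C (X \<boxtimes> ?W) (W \<boxtimes> X)
     ((alpha C h (inv\<^bsub>G\<^esub> h) W \<boxtimes>\<^sub>m Idm C X) \<cdot> braid C h X ?W) \<in> Hom C (W \<boxtimes> X) (X \<boxtimes> ?W)"
    using isoA_valid[OF isoA_returnA[OF assms(2,3), of W]] mr_returnA[OF assms(2,3), of W] by (simp add: valid_def)
  have 2: "inv_mor C (W \<boxtimes> X) (actO C b X \<boxtimes> W) (braid C b W X) \<in> Hom C (actO C b X \<boxtimes> W) (W \<boxtimes> X)"
    using assms by (intro inv_mor_in braid_iso)
  show ?thesis
    unfolding loop_def Let_def using tn_0_left[OF Idm_in[of W]] cmp_0_right[OF 1] cmp_0_right[OF 2]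
    by (simp add: ptrace_0)
qed

text \<open>Cyclicity of the partial trace moves \<open>u\<close> from the start of the loop to its
  end; \<open>encircleA_nat\<close> carries it back through the crossings to the position of the
  loop's label.\<close>

lemma loop_cyclic:
  assumes "h \<in> carrier G" "X \<in> deg C h" "Y \<in> deg C h" "W \<in> deg C \<one>\<^bsub>G\<^esub>"
    and u: "u \<in> Hom C X Y" and v: "v \<in> Hom C Y X"
  shows "loop G C \<one>\<^bsub>G\<^esub> h X (v \<cdot> u) W = loop G C \<one>\<^bsub>G\<^esub> h Y (u \<cdot> v) W"
proof -
  let ?u = "Arr X u Y" and ?v = "Arr Y v X" and ?W = "actO C (inv\<^bsub>G\<^esub> h) W"
  have V: "valid ?u" "valid ?v" using u v by (simp_all add: valid_def)
  have a: "Arr X (v \<cdot> u) X = ?v \<odot> ?u" "Arr Y (u \<cdot> v) Y = ?u \<odot> ?v"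
    using V by (auto intro!: arr_eqI simp: mr_acmp)
  have "ptraceA X W ?W (encircleA h X W \<odot> rw (?v \<odot> ?u) W) = ptraceA X W ?W ((encircleA h X W \<odot> rw ?v W) \<odot> rw ?u W)"
    using V by (simp add: rw_acmp acmp_assoc)
  also have "\<dots> = ptraceA Y W ?W (rw ?u ?W \<odot> encircleA h X W \<odot> rw ?v W)"
    using V by (intro ptraceA_cyclic) simp_all
  also have "\<dots> = ptraceA Y W ?W (encircleA h Y W \<odot> rw (?u \<odot> ?v) W)"
    using V assms(1-4) by (simp add: rw_acmp acmp_reassoc[OF encircleA_nat[symmetric, where Y = Y]] acmp_assoc)
  finally show ?thesis
    using assms(1-4) cmp_in[OF v u] cmp_in[OF u v] by (simp add: loop_eq a)
qed

text \<open>In \<open>ptraceA_encircleA_tn\<close> the inner loop is now the scalar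
  \<open>\<sigma>\<close> times an identity, so it comes out of the whiskering and of the outer
  trace.\<close>

lemma loop_tn:
  assumes "h \<in> carrier G" "X \<in> deg C \<one>\<^bsub>G\<^esub>" "Y \<in> deg C h" "W \<in> deg C \<one>\<^bsub>G\<^esub>" and f: "f \<in> Hom C Y Y"
    and sigma: "loop G C \<one>\<^bsub>G\<^esub> \<one>\<^bsub>G\<^esub> X (Idm C X) W = \<sigma> \<bullet> Idm C W"
  shows "loop G C \<one>\<^bsub>G\<^esub> h (X \<boxtimes> Y) (Idm C X \<boxtimes>\<^sub>m f) W = \<sigma> \<bullet> loop G C \<one>\<^bsub>G\<^esub> h Y f W"
proof -
  let ?f = "Arr Y f Y" and ?W = "actO C (inv\<^bsub>G\<^esub> h) W"
  have v: "valid ?f" using f by (simp add: valid_def)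
  have XY: "X \<boxtimes> Y \<in> deg C h" using deg_tn[OF one_closed assms(1-3)] assms(1) by simp
  have "ptraceA X W W (encircleA \<one>\<^bsub>G\<^esub> X W) = sclA \<sigma> (ide W)"
    using sigma loop_eq[of "\<one>\<^bsub>G\<^esub>" X W "Idm C X"] assms(2,4)
    by (intro arr_eqI) (simp_all add: Idm_in act_one(1) flip: ide_def)
  then have *: "returnA h Y W \<odot> rw (ptraceA X W W (encircleA \<one>\<^bsub>G\<^esub> X W)) Y \<odot> passA Y W \<odot> rw ?f W = sclA \<sigma> (encircleA h Y W \<odot> rw ?f W)"
    using assms(1,3,4) v by (simp add: tn_sclA acmp_sclA encircleA_def acmp_assoc)
  have l: "Arr (X \<boxtimes> Y) (Idm C X \<boxtimes>\<^sub>m f) (X \<boxtimes> Y) = lw X ?f" by (simp add: lw_def)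
  have "loop G C \<one>\<^bsub>G\<^esub> h (X \<boxtimes> Y) (Idm C X \<boxtimes>\<^sub>m f) W = mr (ptraceA (X \<boxtimes> Y) W ?W (encircleA h (X \<boxtimes> Y) W \<odot> rw (lw X ?f) W))"
    using loop_eq[OF assms(1) XY assms(4) tn_in[OF Idm_in f]] by (simp add: l)
  also have "\<dots> = mr (ptraceA Y W ?W (sclA \<sigma> (encircleA h Y W \<odot> rw ?f W)))"
    using ptraceA_encircleA_tn[OF assms(1-4) v] by (simp add: *)
  also have "\<dots> = \<sigma> \<bullet> loop G C \<one>\<^bsub>G\<^esub> h Y f W"
    using loop_eq[OF assms(1,3,4) f] v by (simp add: ptraceA_sclA)
  finally show ?thesis .
qed

end

section \<open>Schur's lemma\<close>

context linear_category
begin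

lemma cmp_diff_right:
  assumes "g \<in> Hom C Y Z" "f \<in> Hom C X Y" "f' \<in> Hom C X Y"
  shows "g \<cdot> (f - f') = (g \<cdot> f) - (g \<cdot> f')"
  using cmp_add_right[OF assms(1) diff_in[OF assms(2,3)] assms(3)] by simp

lemma cmp_sum_left:
  assumes "\<And>a. a \<in> A \<Longrightarrow> g a \<in> Hom C Y Z" "f \<in> Hom C X Y"
  shows "(\<Sum>a\<in>A. g a) \<cdot> f = (\<Sum>a\<in>A. g a \<cdot> f)"
  using assms(1)
proof (induction A rule: infinite_finite_induct)
  case (insert x F)
  then have "(g x + (\<Sum>a\<in>F. g a)) \<cdot> f = (g x \<cdot> f) + ((\<Sum>a\<in>F. g a) \<cdot> f)"
    by (intro cmp_add_left[where Z = Z, OF _ _ assms(2)] sum_in) simp_all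
  then show ?case using insert by simp
qed (use assms(2) in simp_all)

lemma isomorphic_sym: "isomorphic C X Y \<Longrightarrow> isomorphic C Y X"
  unfolding isomorphic_def is_iso_def by blast

lemma isomorphic_trans:
  assumes "isomorphic C X Y" "isomorphic C Y Z"
  shows "isomorphic C X Z"
proof -
  obtain f g where f: "is_iso C X Y f" and g: "is_iso C Y Z g" using assms by (auto simp: isomorphic_def)
  have "isoA (Arr X f Y)" "isoA (Arr Y g Z)" using f g by (simp_all add: isoA_def)
  then have "isoA (Arr Y g Z \<odot> Arr X f Y)" by simp
  then show ?thesis by (auto simp: isoA_def isomorphic_def)
qed

lemma isomorphic_refl: "isomorphic C X X"
  using isoA_ide[of X] by (auto simp: isoA_def isomorphic_def)

lemma isomorphicI:
  assumes "f \<in> Hom C X Y" "h \<in> Hom C Y X" "h \<cdot> f = Idm C X" "f \<cdot> h = Idm C Y"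
  shows "isomorphic C X Y"
  using assms unfolding isomorphic_def is_iso_def by blast

end

context semisimple_abelian_category
begin

text \<open>The kernel of \<open>h\<close> is a subobject of the simple object \<open>S\<close>. If
  it is zero, then \<open>h\<close> is mono and hence invertible, as \<open>T\<close> is simple and
  \<open>S\<close> is nonzero; if it is all of \<open>S\<close>, then \<open>h\<close> is 0.\<close>

lemma iso_of_nonzero:
  assumes S: "simple C S" and T: "simple C T" and h: "h \<in> Hom C S T" "h \<noteq> 0"
  shows "is_iso C S T h"
proof -
  obtain K k where k: "is_kernel C K S T k h" using kernels[OF h(1)] by blast
  then have kin: "k \<in> Hom C K S" and hk: "h \<cdot> k = 0"
    and univ: "\<And>W u. u \<in> Hom C W S \<Longrightarrow> h \<cdot> u = 0 \<Longrightarrow> \<exists>!v. v \<in> Hom C W K \<and> k \<cdot> v = u"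
    unfolding is_kernel_def by blast+
  have "is_mono C K S k"
    unfolding is_mono_def
  proof (intro conjI allI ballI impI kin)
    fix W u v assume u: "u \<in> Hom C W K" and v: "v \<in> Hom C W K" and eq: "k \<cdot> u = k \<cdot> v"
    have "h \<cdot> (k \<cdot> u) = (h \<cdot> k) \<cdot> u" using cmp_assoc[OF h(1) kin u] by simp
    also have "\<dots> = 0" using hk cmp_0_left[OF u] by simp
    finally show "u = v" using univ[OF cmp_in[OF kin u]] u v eq by metis
  qed
  then consider "Idm C K = 0" | "is_iso C K S k" using S unfolding simple_def by blast
  then show ?thesis
  proof cases
    case 1
    have "is_mono C S T h"
      unfolding is_mono_def
    proof (intro conjI allI ballI impI h(1))
      fix W u v assume u: "u \<in> Hom C W S" and v: "v \<in> Hom C W S" and eq: "h \<cdot> u = h \<cdot> v"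
      have "h \<cdot> (u - v) = 0" using cmp_diff_right[OF h(1) u v] eq by simp
      then obtain w where w: "w \<in> Hom C W K" "k \<cdot> w = u - v" using univ[OF diff_in[OF u v]] by blast
      have "w = 0" using Idm_left[OF w(1)] 1 cmp_0_left[OF w(1)] by simp
      then show "u = v" using w cmp_0_right[OF kin] by simp
    qed
    then show ?thesis using S T unfolding simple_def by blast
  next
    case 2
    have "h = h \<cdot> (k \<cdot> inv_mor C K S k)" using inv_mor_right[OF 2] Idm_right[OF h(1)] by simp
    also have "\<dots> = (h \<cdot> k) \<cdot> inv_mor C K S k" using cmp_assoc[OF h(1) kin inv_mor_in[OF 2]] by simp
    also have "\<dots> = 0" using hk cmp_0_left[OF inv_mor_in[OF 2]] by simp
    finally show ?thesis using h(2) by simp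
  qed
qed

text \<open>Horner evaluation of a polynomial at an endomorphism; an eigenvalue of \<open>f\<close>
  will be found as a root of an annihilating polynomial.\<close>

definition peval :: "'a \<Rightarrow> 'b \<Rightarrow> complex poly \<Rightarrow> 'b" where
  "peval S f p = fold_coeffs (\<lambda>a r. (a \<bullet> Idm C S) + (f \<cdot> r)) p 0"

lemma peval_0 [simp]: "peval S f 0 = 0"
  by (simp add: peval_def)

lemma peval_pCons:
  assumes "f \<in> Hom C S S"
  shows "peval S f (pCons a p) = (a \<bullet> Idm C S) + (f \<cdot> peval S f p)"
  using assms by (cases "a = 0 \<and> p = 0") (auto simp: peval_def)

lemma peval_in:
  assumes "f \<in> Hom C S S"
  shows "peval S f p \<in> Hom C S S"
  using assms by (induction p) (simp_all add: peval_pCons add_in scl_in Idm_in cmp_in)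

lemma peval_add:
  assumes "f \<in> Hom C S S"
  shows "peval S f (p + q) = peval S f p + peval S f q"
proof (induction p q rule: poly_induct2)
  case (pCons a p b q)
  then show ?case
    using assms cmp_add_right[OF assms peval_in[OF assms, of p] peval_in[OF assms, of q]]
    by (simp add: peval_pCons scl_add_left)
qed simp

lemma peval_smult:
  assumes "f \<in> Hom C S S"
  shows "peval S f (smult c p) = c \<bullet> peval S f p"
proof (induction p)
  case (pCons a p)
  then show ?case
    using assms cmp_scl_right[OF assms peval_in[OF assms, of p]]
    by (simp add: peval_pCons scl_add_right scl_scl)
qed simp

lemma peval_linear_factor:
  assumes f: "f \<in> Hom C S S"
  shows "peval S f ([:- c, 1:] * q) = (f - (c \<bullet> Idm C S)) \<cdot> peval S f q"
proof -
  note q = peval_in[OF f, of q]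
  have "[:- c, 1:] * q = pCons 0 q + smult (- c) q" by simp
  then have "peval S f ([:- c, 1:] * q) = (f \<cdot> peval S f q) - (c \<bullet> peval S f q)"
    unfolding \<open>_ = pCons 0 q + smult (- c) q\<close>
    using f by (simp only: peval_add peval_smult peval_pCons) (simp add: scl_minus_left)
  moreover have "f \<cdot> peval S f q = ((f - (c \<bullet> Idm C S)) \<cdot> peval S f q) + (c \<bullet> peval S f q)"
  proof -
    have "f \<cdot> peval S f q = ((f - (c \<bullet> Idm C S)) + (c \<bullet> Idm C S)) \<cdot> peval S f q" by simp
    also have "\<dots> = ((f - (c \<bullet> Idm C S)) \<cdot> peval S f q) + ((c \<bullet> Idm C S) \<cdot> peval S f q)"
      by (rule cmp_add_left[OF diff_in[OF f scl_in[OF Idm_in]] scl_in[OF Idm_in] q])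
    also have "(c \<bullet> Idm C S) \<cdot> peval S f q = c \<bullet> peval S f q"
      using cmp_scl_left[OF Idm_in q] Idm_left[OF q] by simp
    finally show ?thesis .
  qed
  ultimately show ?thesis by (metis add_diff_cancel_right')
qed

definition powm :: "'a \<Rightarrow> 'b \<Rightarrow> nat \<Rightarrow> 'b" where
  "powm S f n = peval S f (monom 1 n)"

lemma peval_monom: "f \<in> Hom C S S \<Longrightarrow> peval S f (monom c n) = c \<bullet> powm S f n"
  using peval_smult[of f S c "monom 1 n"] by (simp add: powm_def smult_monom)

lemma peval_sum:
  assumes "f \<in> Hom C S S"
  shows "peval S f (\<Sum>a\<in>A. P a) = (\<Sum>a\<in>A. peval S f (P a))"
  by (induction A rule: infinite_finite_induct) (simp_all add: peval_add[OF assms])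

lemma peval_annihilator:
  assumes f: "f \<in> Hom C S S"
  shows "\<exists>p. p \<noteq> 0 \<and> peval S f p = 0"
proof -
  interpret vector_space "scl C" by (rule scl_vector_space)
  obtain B where B: "finite B" "span B = Hom C S S" using Hom_finite_dim[of S S] by blast
  let ?N = "card B" and ?v = "powm S f"
  \<comment> \<open>Linear dependence of a set sees only distinct vectors. If two powers of
    \<open>f\<close> coincide, their difference gives an annihilating polynomial directly.\<close>
  show ?thesis
  proof (cases "inj_on ?v {..?N}")
    case True
    have "?v ` {..?N} \<subseteq> span B" using B peval_in[OF f] by (auto simp: powm_def)
    moreover have "card (?v ` {..?N}) = Suc ?N" using card_image[OF True] by simp
    ultimately have "dependent (?v ` {..?N})" using independent_span_bound[OF B(1)] by force
    then obtain u where u: "\<exists>v\<in>?v ` {..?N}. u v \<noteq> 0" "(\<Sum>v\<in>?v ` {..?N}. u v \<bullet> v) = 0"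
      unfolding dependent_finite[OF finite_imageI[OF finite_atMost]] by blast
    let ?p = "\<Sum>n\<le>?N. monom (u (?v n)) n"
    have "peval S f ?p = (\<Sum>n\<le>?N. u (?v n) \<bullet> ?v n)"
      by (simp add: peval_sum[OF f] peval_monom[OF f])
    also have "\<dots> = 0" using u(2) by (simp add: sum.reindex[OF True])
    finally have "peval S f ?p = 0" .
    moreover obtain n where n: "n \<le> ?N" "u (?v n) \<noteq> 0" using u(1) by auto
    have "coeff ?p n = u (?v n)" using n(1) by (simp add: coeff_sum)
    then have "?p \<noteq> 0" using n(2) by (metis coeff_0)
    ultimately show ?thesis by blast
  next
    case False
    then obtain m n where mn: "m \<noteq> n" "?v m = ?v n" by (auto simp: inj_on_def)
    let ?p = "monom 1 m + monom (- 1) n :: complex poly"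
    have "coeff ?p m = 1" using mn(1) by simp
    then have "?p \<noteq> 0" by (metis coeff_0 zero_neq_one)
    moreover have "peval S f ?p = 0"
      using mn(2) by (simp add: peval_add[OF f] peval_monom[OF f] scl_minus_left)
    ultimately show ?thesis by blast
  qed
qed

text \<open>Induction on the degree of an annihilating polynomial. At a root \<open>z\<close> the
  endomorphism \<open>f - z\<close> is either 0, and \<open>f\<close> is scalar, or invertible, and
  then the cofactor of smaller degree annihilates \<open>f\<close> as well.\<close>

lemma schur:
  assumes S: "simple C S" and f: "f \<in> Hom C S S"
  shows "\<exists>c. f = c \<bullet> Idm C S"
proof -
  have "\<exists>c. f = c \<bullet> Idm C S" if "p \<noteq> 0" "peval S f p = 0" for p
    using that
  proof (induction "degree p" arbitrary: p rule: less_induct)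
    case less
    show ?case
    proof (cases "degree p = 0")
      case True
      then obtain a where "p = [:a:]" by (metis degree_eq_zeroE)
      then have "a \<bullet> Idm C S = 0" "a \<noteq> 0" using less.prems f by (simp_all add: peval_pCons)
      then show ?thesis using S by (simp add: simple_def)
    next
      case False
      then have "\<not> constant (poly p)" by (simp add: constant_degree)
      then obtain z where "poly p z = 0" using fundamental_theorem_of_algebra by blast
      then obtain q where q: "p = [:- z, 1:] * q" using poly_eq_0_iff_dvd by blast
      let ?h = "f - (z \<bullet> Idm C S)"
      have h: "?h \<in> Hom C S S" using f by (intro diff_in scl_in Idm_in)
      have hq: "?h \<cdot> peval S f q = 0" using less.prems(2) peval_linear_factor[OF f] q by metis
      show ?thesis
      proof (cases "?h = 0")
        case True
        then show ?thesis by auto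
      next
        case False
        then have iso: "is_iso C S S ?h" using iso_of_nonzero[OF S S h] by blast
        note i = inv_mor_in[OF iso] inv_mor_left[OF iso] and qin = peval_in[OF f, of q]
        have "peval S f q = (inv_mor C S S ?h \<cdot> ?h) \<cdot> peval S f q" using i(2) Idm_left[OF qin] by simp
        also have "\<dots> = 0" using cmp_assoc[OF i(1) h qin] hq cmp_0_right[OF i(1)] by simp
        finally have "peval S f q = 0" .
        moreover have q0: "q \<noteq> 0" using q less.prems(1) by auto
        moreover have "degree q < degree p" unfolding q using q0 by (subst degree_mult_eq) auto
        ultimately show ?thesis using less.hyps by blast
      qed
    qed
  qed
  then show ?thesis using peval_annihilator[OF f] by blast
qed

text \<open>Composition with an isomorphism from \<open>T\<close> to \<open>S\<close> reduces the
  claim to endomorphisms of \<open>S\<close>, which are scalars.\<close>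

lemma hom_proportional:
  assumes S: "simple C S" and iso: "isomorphic C T S"
    and l: "l \<in> Hom C S T" "l \<noteq> 0" and f: "f \<in> Hom C S T"
  shows "\<exists>c. f = c \<bullet> l"
proof -
  obtain j where j: "is_iso C T S j" using iso by (auto simp: isomorphic_def)
  let ?i = "inv_mor C T S j"
  note i = inv_mor_in[OF j] inv_mor_left[OF j] and jin = is_iso_in[OF j]
  have cancel: "g = ?i \<cdot> (j \<cdot> g)" if "g \<in> Hom C S T" for g
    using cmp_assoc[OF i(1) jin that] i(2) Idm_left[OF that] by simp
  obtain a b where a: "j \<cdot> l = a \<bullet> Idm C S" and b: "j \<cdot> f = b \<bullet> Idm C S"
    using schur[OF S cmp_in[OF jin l(1)]] schur[OF S cmp_in[OF jin f]] by blast
  have a0: "a \<noteq> 0" using cancel[OF l(1)] a l(2) cmp_0_right[OF i(1)] by auto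
  have "f = ?i \<cdot> ((b / a) \<bullet> (j \<cdot> l))" using cancel[OF f] a b a0 by (simp add: scl_scl)
  also have "\<dots> = (b / a) \<bullet> l"
    using cmp_scl_right[OF i(1) cmp_in[OF jin l(1)]] cancel[OF l(1)] by simp
  finally show ?thesis by blast
qed

end

section \<open>Frobenius reciprocity and duals of simple objects\<close>

context pivotal_fusion_category
begin

text \<open>Frobenius reciprocity: \<open>Hom \<one> (Z \<boxtimes> X\<^sup>*)\<close> embeds into \<open>Hom X Z\<close>.\<close>

definition frobenius :: "'o \<Rightarrow> 'o \<Rightarrow> ('o, 'm) arr \<Rightarrow> ('o, 'm) arr" where
  "frobenius Z X u = runA Z \<odot> lw Z (evA X) \<odot> kap Z (dual C X) u X"

lemma frobenius_simps [simp]: "dm (frobenius Z X u) = X" "cd (frobenius Z X u) = Z" "valid (frobenius Z X u)"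
  by (simp_all add: frobenius_def)

text \<open>By \<open>zag\<close> the transformation \<open>kap\<close> of a copairing is recovered
  from its contraction. The copairing itself is then read off from \<open>kap\<close> at the unit
  object by stripping invertible constraints.\<close>

lemma frobenius_inj:
  assumes eq: "frobenius Z X u = frobenius Z X v"
    and u: "copairing u Z (dual C X)" and v: "copairing v Z (dual C X)"
  shows "u = v"
proof -
  let ?D = "dual C X"
  have k: "kap Z ?D u B = rw (frobenius Z X u) (?D \<boxtimes> B) \<odot> K X B" if u: "copairing u Z ?D" for u B
  proof -
    have "kap Z ?D u B = lw Z (E X (?D \<boxtimes> B) \<odot> lw ?D (K X B)) \<odot> kap Z ?D u B"
      by (simp add: zag)
    also have "\<dots> = lw Z (E X (?D \<boxtimes> B)) \<odot> (lw Z (lw ?D (K X B)) \<odot> kap Z ?D u B)"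
      by (simp add: lw_acmp acmp_assoc)
    also have "lw Z (lw ?D (K X B)) \<odot> kap Z ?D u B = kap Z ?D u (X \<boxtimes> (?D \<boxtimes> B)) \<odot> K X B"
      by (subst kap_nat[OF u]) simp_all
    finally show ?thesis
      unfolding frobenius_def tn_mate_left[OF u pairing_evA] by (simp add: acmp_assoc)
  qed
  have "kap Z ?D u B = kap Z ?D v B" for B
    unfolding k[OF u] k[OF v] eq ..
  then have kap_eq: "kap Z ?D u (unit C) = kap Z ?D v (unit C)" .
  have r: "rw u (unit C) = iassocA Z ?D (unit C) \<odot> kap Z ?D u (unit C) \<odot> lunA (unit C)"
    if "copairing u Z ?D" for u
    using that by (simp add: kap_def acmp_assoc copairing_def)
  have rw_eq: "rw u (unit C) = rw v (unit C)"
    unfolding r[OF u] r[OF v] kap_eq ..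
  have n: "u \<odot> runA (unit C) = runA (Z \<boxtimes> ?D) \<odot> rw u (unit C)" if "copairing u Z ?D" for u
    using runA_nat[of u "Z \<boxtimes> ?D"] that by (simp add: copairing_def)
  have "u \<odot> runA (unit C) = v \<odot> runA (unit C)"
    unfolding n[OF u] n[OF v] rw_eq ..
  then show ?thesis
    by (rule cancel_right[where q = "irunA (unit C)"]) (use u v in \<open>simp_all add: copairing_def\<close>)
qed

lemma frobenius_sclA:
  assumes "copairing u Z (dual C X)"
  shows "frobenius Z X (sclA c u) = sclA c (frobenius Z X u)"
  using assms by (simp add: frobenius_def kap_def copairing_def tn_sclA acmp_sclA)

lemma zig_arr: "frobenius X X (coevA X) = ide X"
  using zigzag[of X]
  by (intro arr_eqI)
    (simp_all add: frobenius_def kap_def mr_acmp mr_ilunA,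
     simp_all add: assocA_def runA_def lw_def rw_def evA_def coevA_def)

lemma transpA_ide: "transpA (ide X) = ide (dual C X)"
  by (simp add: transpA_def to_dualA_def zag_arr)

lemma transpA_sclA: "valid t \<Longrightarrow> transpA (sclA c t) = sclA c (transpA t)"
  by (simp add: transpA_def to_dualA_def eps_def tn_sclA acmp_sclA)

text \<open>By naturality of the pivotal structure, \<open>f\<close> is determined by its transpose, an endomorphism of
  \<open>X\<^sup>*\<^sup>* \<cong> X\<close>.\<close>

lemma dual_End:
  assumes X: "simple C X" and f: "f \<in> Hom C (dual C X) (dual C X)"
  shows "\<exists>c. f = c \<bullet> Idm C (dual C X)"
proof -
  let ?D = "dual C X" and ?p = "pivA X"
  let ?f = "Arr ?D f ?D"
  have v: "valid ?f" using f by (simp add: valid_def)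
  let ?g = "invA ?p \<odot> transpA ?f \<odot> ?p"
  have "mr ?g \<in> Hom C X X" using valid_acmp[of "invA ?p" "transpA ?f \<odot> ?p"] unfolding valid_def by simp
  then obtain c where c: "mr ?g = c \<bullet> Idm C X" using schur[OF X] by blast
  then have g: "?g = sclA c (ide X)" by (intro arr_eqI) simp_all
  have "transpA ?f = ?p \<odot> ?g \<odot> invA ?p" by (simp add: acmp_assoc)
  also have "\<dots> = sclA c (ide (dual C ?D))" unfolding g by (simp add: acmp_sclA)
  finally have tr: "transpA ?f = sclA c (ide (dual C ?D))" .
  have "pivA ?D \<odot> ?f = transpA (transpA ?f) \<odot> pivA ?D" using pivA_nat[OF v] by (simp only: arr.sel)
  also have "\<dots> = pivA ?D \<odot> sclA c (ide ?D)" unfolding tr by (simp add: transpA_sclA transpA_ide acmp_sclA)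
  finally have "?f = sclA c (ide ?D)"
    by (rule cancel_left[where q = "invA (pivA ?D)"]) (use v in simp_all)
  then have "mr ?f = mr (sclA c (ide ?D))" by simp
  then show ?thesis by auto
qed

text \<open>Under Frobenius reciprocity the coevaluation corresponds to the identity of
  \<open>X\<close>.\<close>

lemma coev_nonzero:
  assumes "Idm C X \<noteq> 0"
  shows "coev C X \<noteq> 0"
proof
  assume "coev C X = 0"
  then have "coevA X = sclA 0 (coevA X)" by (intro arr_eqI) (simp_all add: coevA_def)
  then have "ide X = sclA 0 (ide X)" using frobenius_sclA[of "coevA X" X X 0] by (simp add: zig_arr)
  then have "mr (ide X) = mr (sclA 0 (ide X))" by simp
  then show False using assms by simp
qed

lemma dual_nonzero:
  assumes "Idm C X \<noteq> 0"
  shows "Idm C (dual C X) \<noteq> 0"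
proof
  assume "Idm C (dual C X) = 0"
  then have "Idm C (X \<boxtimes> dual C X) = 0" using tn_Idm[of X "dual C X"] tn_0_right[OF Idm_in[of X]] by simp
  then have "coev C X = 0" using Idm_left[OF coev_in[of X]] cmp_0_left[OF coev_in[of X]] by simp
  then show False using coev_nonzero[OF assms] by simp
qed

end

section \<open>Classes in the extended Verlinde algebra\<close>

context linear_category
begin

lemma direct_sumD:
  assumes "is_direct_sum C X A F i p"
  shows "finite A" "\<And>a. a \<in> A \<Longrightarrow> i a \<in> Hom C (F a) X" "\<And>a. a \<in> A \<Longrightarrow> p a \<in> Hom C X (F a)"
    "\<And>a. a \<in> A \<Longrightarrow> p a \<cdot> i a = Idm C (F a)"
    "\<And>a b. \<lbrakk>a \<in> A; b \<in> A; a \<noteq> b\<rbrakk> \<Longrightarrow> p a \<cdot> i b = 0"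
    "(\<Sum>a\<in>A. i a \<cdot> p a) = Idm C X"
  using assms by (auto simp: is_direct_sum_def)

lemma direct_sum_transport:
  assumes ds: "is_direct_sum C X A F i p" and j: "\<And>a. a \<in> A \<Longrightarrow> is_iso C (F a) (F' a) (j a)"
  shows "is_direct_sum C X A F' (\<lambda>a. i a \<cdot> inv_mor C (F a) (F' a) (j a)) (\<lambda>a. j a \<cdot> p a)"
proof -
  note d = direct_sumD[OF ds]
  let ?k = "\<lambda>a. inv_mor C (F a) (F' a) (j a)"
  note jj = is_iso_in[OF j] inv_mor_in[OF j] inv_mor_left[OF j] inv_mor_right[OF j]
  have 1: "(j a \<cdot> p a) \<cdot> (i b \<cdot> ?k b) = (if a = b then Idm C (F' a) else 0)" if "a \<in> A" "b \<in> A" for a b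
  proof -
    have "(j a \<cdot> p a) \<cdot> (i b \<cdot> ?k b) = j a \<cdot> ((p a \<cdot> i b) \<cdot> ?k b)"
      using cmp_assoc[OF jj(1)[OF that(1)] d(3)[OF that(1)] cmp_in[OF d(2)[OF that(2)] jj(2)[OF that(2)]]]
        cmp_assoc[OF d(3)[OF that(1)] d(2)[OF that(2)] jj(2)[OF that(2)]] by simp
    then show ?thesis
      using that d(4,5) jj(4) Idm_left[OF jj(2)[OF that(2)]] cmp_0_left[OF jj(2)[OF that(2)]]
        cmp_0_right[OF jj(1)[OF that(1)]] by auto
  qed
  have 2: "(i a \<cdot> ?k a) \<cdot> (j a \<cdot> p a) = i a \<cdot> p a" if a: "a \<in> A" for a
    using cmp_assoc[OF d(2)[OF a] jj(2)[OF a] cmp_in[OF jj(1)[OF a] d(3)[OF a]]]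
      cmp_assoc[OF jj(2)[OF a] jj(1)[OF a] d(3)[OF a]] jj(3)[OF a] Idm_left[OF d(3)[OF a]] by simp
  show ?thesis
    unfolding is_direct_sum_def using d(1,6) 1 2 cmp_in[OF d(2) jj(2)] cmp_in[OF jj(1) d(3)] by simp
qed

end

section \<open>Degrees of summands, of simple objects and of the unit\<close>

context equivariant_fusion_category
begin

text \<open>A homogeneous component of \<open>S\<close> of degree other than \<open>h\<close> has no
  nonzero morphism to \<open>X\<close>, so its inclusion into the retract \<open>S\<close> of
  \<open>X\<close> is 0. Thus \<open>S\<close> is isomorphic to its component of degree
  \<open>h\<close>, and \<open>deg\<close> is closed under isomorphism.\<close>

lemma summand_deg:
  assumes h: "h \<in> carrier G" and X: "X \<in> deg C h"
    and i: "i \<in> Hom C S X" and p: "p \<in> Hom C X S" and pi: "p \<cdot> i = Idm C S"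
  shows "S \<in> deg C h"
proof -
  obtain F j q where F: "\<And>a. a \<in> carrier G \<Longrightarrow> F a \<in> deg C a" and ds: "is_direct_sum C S (carrier G) F j q"
    using deg_decomp[of S] by blast
  note d = direct_sumD[OF ds]
  have z: "j a = 0" if "a \<in> carrier G" "a \<noteq> h" for a
  proof -
    have "i \<cdot> j a \<in> Hom C (F a) X" using i d(2)[OF that(1)] by (rule cmp_in)
    then have "i \<cdot> j a = 0" using deg_orthogonal[OF that(1) h that(2) F[OF that(1)] X] by simp
    then have "(p \<cdot> i) \<cdot> j a = 0" using cmp_assoc[OF p i d(2)[OF that(1)]] cmp_0_right[OF p] by simp
    then show ?thesis using pi Idm_left[OF d(2)[OF that(1)]] by simp
  qed
  have "(\<Sum>a\<in>carrier G. j a \<cdot> q a) = (\<Sum>a\<in>{h}. j a \<cdot> q a)"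
    using z d(3) h finite_group by (intro sum.mono_neutral_right) (auto intro: cmp_0_left)
  then have "j h \<cdot> q h = Idm C S" using d(6) by simp
  then have "isomorphic C (F h) S" using d(2-4) h by (intro isomorphicI[of "j h" _ _ "q h"]) auto
  then show ?thesis using deg_replete[OF h F[OF h]] by blast
qed

text \<open>Some homogeneous projector on \<open>S\<close> is nonzero. By Schur's lemma it is an
  invertible scalar, which makes \<open>S\<close> a retract of a homogeneous object.\<close>

lemma simple_deg:
  assumes S: "simple C S"
  shows "\<exists>h\<in>carrier G. S \<in> deg C h"
proof -
  obtain F i p where F: "\<And>a. a \<in> carrier G \<Longrightarrow> F a \<in> deg C a" and ds: "is_direct_sum C S (carrier G) F i p"
    using deg_decomp[of S] by blast
  note d = direct_sumD[OF ds]
  have "(\<Sum>a\<in>carrier G. i a \<cdot> p a) \<noteq> 0" using d(6) S by (simp add: simple_def)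
  then obtain a where a: "a \<in> carrier G" "i a \<cdot> p a \<noteq> 0" by (meson sum.neutral)
  note i_a = d(2)[OF a(1)] and p_a = d(3)[OF a(1)]
  obtain c where c: "i a \<cdot> p a = c \<bullet> Idm C S" using schur[OF S cmp_in[OF i_a p_a]] by blast
  then have c0: "c \<noteq> 0" using a(2) by auto
  have "((1 / c) \<bullet> i a) \<cdot> p a = Idm C S" using cmp_scl_left[OF i_a p_a] c c0 by (simp add: scl_scl)
  then show ?thesis using summand_deg[OF a(1) F[OF a(1)] p_a scl_in[OF i_a]] a(1) by blast
qed

text \<open>The unit is isomorphic to its tensor square, so its degree is an idempotent of the
  group.\<close>

lemma unit_deg: "unit C \<in> deg C \<one>\<^bsub>G\<^esub>"
proof -
  interpret group G by (rule group)
  obtain h where h: "h \<in> carrier G" "unit C \<in> deg C h" using simple_deg[OF unit_simple] by blast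
  have "isomorphic C (unit C \<boxtimes> unit C) (unit C)" using lun_iso[of "unit C"] by (auto simp: isomorphic_def)
  moreover have "unit C \<boxtimes> unit C \<in> deg C (h \<otimes>\<^bsub>G\<^esub> h)" using deg_tn h by blast
  ultimately have hh: "unit C \<in> deg C (h \<otimes>\<^bsub>G\<^esub> h)" using deg_replete h by blast
  have "h \<otimes>\<^bsub>G\<^esub> h = h"
  proof (rule ccontr)
    assume "h \<otimes>\<^bsub>G\<^esub> h \<noteq> h"
    then have "Hom C (unit C) (unit C) = {0}" using deg_orthogonal[OF _ h(1) _ hh h(2)] h(1) by simp
    then show False using Idm_in[of "unit C"] unit_simple by (simp add: simple_def)
  qed
  then have "h = \<one>\<^bsub>G\<^esub>" using h(1) l_cancel_one by blast
  then show ?thesis using h by simp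
qed

lemma loop_sum:
  assumes "h \<in> carrier G" "X \<in> deg C h" "W \<in> deg C \<one>\<^bsub>G\<^esub>" "\<And>a. a \<in> A \<Longrightarrow> f a \<in> Hom C X X"
  shows "loop G C \<one>\<^bsub>G\<^esub> h X (\<Sum>a\<in>A. f a) W = (\<Sum>a\<in>A. loop G C \<one>\<^bsub>G\<^esub> h X (f a) W)"
  using assms(4)
proof (induction A rule: infinite_finite_induct)
  case (insert a A)
  then show ?case using loop_add[OF assms(1-3), of "f a" "\<Sum>a\<in>A. f a"] by (simp add: sum_in)
qed (use loop_0[OF one_closed assms(1-3)] in simp_all)

section \<open>Adjoints of zero morphisms and of identities\<close>

lemma transp_0: "transp C X Y 0 = 0"
proof -
  have z: "Arr X 0 Y = sclA 0 (Arr X 0 Y)" by (intro arr_eqI) simp_all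
  have v: "valid (Arr X 0 Y)" by (simp add: valid_def)
  have "transpA (Arr X 0 Y) = sclA 0 (transpA (Arr X 0 Y))" using transpA_sclA[OF v, of 0] z by metis
  then have "mr (transpA (Arr X 0 Y)) = mr (sclA 0 (transpA (Arr X 0 Y)))" by (rule arg_cong)
  then show ?thesis using mr_transpA[OF v] by simp
qed

lemma act_dual_in:
  assumes "g \<in> carrier G"
  shows "act_dual C g X \<in> Hom C (actO C g (dual C X)) (dual C (actO C g X))"
proof -
  let ?e = "inv_mor C (unit C) (actO C g (unit C)) (eta C g) \<cdot> actM C g (ev C X) \<cdot> mu C g (dual C X) X"
  let ?A = "Arr (actO C g (dual C X) \<boxtimes> actO C g X) ?e (unit C)"
  have "?e \<in> Hom C (actO C g (dual C X) \<boxtimes> actO C g X) (unit C)"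
    using assms inv_mor_in[OF eta_iso[OF assms]] act_in[OF assms ev_in] is_iso_in[OF mu_iso[OF assms]]
    by (intro cmp_in)
  then have "pairing ?A (actO C g (dual C X)) (actO C g X)" by (simp add: pairing_def valid_def)
  from mr_to_dualA[OF this] have "act_dual C g X = mr (to_dualA (actO C g (dual C X)) (actO C g X) ?A)"
    by (simp add: act_dual_def)
  then show ?thesis
    using to_dualA_simps(3)[of "actO C g (dual C X)" "actO C g X" ?A] unfolding valid_def by simp
qed

lemma adjoint_0:
  assumes "g \<in> carrier G"
  shows "adjoint G C g X 0 = 0"
proof -
  have i: "inv_mor C (actO C (inv\<^bsub>G\<^esub> g) (actO C g (dual C X))) (dual C X) (alpha C (inv\<^bsub>G\<^esub> g) g (dual C X))
     \<in> Hom C (dual C X) (actO C (inv\<^bsub>G\<^esub> g) (actO C g (dual C X)))"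
  proof (rule inv_mor_in)
    interpret group G by (rule group)
    show "is_iso C (actO C (inv\<^bsub>G\<^esub> g) (actO C g (dual C X))) (dual C X) (alpha C (inv\<^bsub>G\<^esub> g) g (dual C X))"
      using alpha_iso[of "inv\<^bsub>G\<^esub> g" g "dual C X"] assms by (simp add: act_one(1))
  qed
  have "actM C (inv\<^bsub>G\<^esub> g) 0 = 0"
    using act_scl[OF inv_closed[OF assms] zero_in, of 0] by simp
  then show ?thesis
    using cmp_0_left[OF act_dual_in[OF assms, of X]] cmp_0_left[OF i] by (simp add: adjoint_def transp_0)
qed

lemma inv_mor_Idm: "inv_mor C X X (Idm C X) = Idm C X"
  by (rule inv_mor_unique) (simp_all add: Idm_in Idm_left[OF Idm_in])

lemma adjoint_one: "adjoint G C \<one>\<^bsub>G\<^esub> X (Idm C X) = Idm C (dual C X)"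
proof -
  have e: "ev C X \<in> Hom C (dual C X \<boxtimes> X) (unit C)" by (rule ev_in)
  have p: "pairing (evA X) (dual C X) X" by simp
  have td: "to_dual C (dual C X) X (ev C X) = Idm C (dual C X)"
    using mr_to_dualA[OF p] zag_arr[of X] by (simp add: to_dualA_def) (simp add: evA_def)
  have t: "transp C X X (Idm C X) = Idm C (dual C X)"
    by (simp add: transp_def tn_Idm Idm_right[OF e] td)
  have "act_dual C \<one>\<^bsub>G\<^esub> X = Idm C (dual C X)"
    by (simp add: act_dual_def act_one(1) act_one(2)[OF e] mu_one eta_one inv_mor_Idm
        Idm_right[OF e] Idm_left[OF e] td)
  then show ?thesis
    by (simp add: adjoint_def act_one(1) t Idm_left[OF Idm_in] act_one(2)[OF Idm_in] alpha_one inv_mor_Idm)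
qed

end

section \<open>Representatives, decompositions and classes of morphisms\<close>

locale verlinde = equivariant_fusion_category C G
  for C :: "('g, 'o, 'm::ab_group_add, 'z) equivariant_cat_scheme" (structure)
    and G :: "('g, 'y) monoid_scheme" +
  fixes I :: "'i set" and V :: "'i \<Rightarrow> 'o" and i0 :: 'i
  assumes reps: "simple_reps C I V i0"
begin

lemma V_simple: "i \<in> I \<Longrightarrow> simple C (V i)"
  and V_i0 [simp]: "V i0 = unit C" and i0_in [simp]: "i0 \<in> I"
  using reps by (auto simp: simple_reps_def)

lemma V_nonzero: "i \<in> I \<Longrightarrow> Idm C (V i) \<noteq> 0"
  using V_simple by (auto simp: simple_def)

lemma V_rep: "simple C X \<Longrightarrow> \<exists>i\<in>I. isomorphic C X (V i)"
  using reps unfolding simple_reps_def by blast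

lemma V_unique: "\<lbrakk>i \<in> I; j \<in> I; isomorphic C (V i) (V j)\<rbrakk> \<Longrightarrow> i = j"
  using reps V_simple[of i] isomorphic_refl[of "V i"] unfolding simple_reps_def by blast

lemma finite_I: "finite I"
proof -
  obtain S where S: "finite S" "\<And>X. simple C X \<Longrightarrow> \<exists>Y\<in>S. isomorphic C X Y"
    using finitely_many_simples by blast
  then have "\<forall>i\<in>I. \<exists>Y. Y \<in> S \<and> isomorphic C (V i) Y" using V_simple by blast
  then obtain f where f: "\<And>i. i \<in> I \<Longrightarrow> f i \<in> S \<and> isomorphic C (V i) (f i)"
    using bchoice[of I "\<lambda>i Y. Y \<in> S \<and> isomorphic C (V i) Y"] by blast
  have "inj_on f I"
    using f V_unique isomorphic_trans isomorphic_sym by (intro inj_onI) metis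
  then show ?thesis using inj_on_finite[of f I S] f S(1) by blast
qed

lemma Ideg_iff: "i \<in> Ideg C I V h \<longleftrightarrow> i \<in> I \<and> V i \<in> deg C h"
  by (auto simp: Ideg_def)

lemma finite_Ideg [simp]: "finite (Ideg C I V h)"
  using finite_I by (simp add: Ideg_def)

lemma i0_Ideg [simp]: "i0 \<in> Ideg C I V \<one>\<^bsub>G\<^esub>"
  using unit_deg by (simp add: Ideg_iff)

lemma rep_decomp:
  "\<exists>(n::nat) e i p. (\<forall>a<n. e a \<in> I) \<and> is_direct_sum C X {..<n} (\<lambda>a. V (e a)) i p"
proof -
  obtain n F i p where F: "\<And>a. a < n \<Longrightarrow> simple C (F a)" and ds: "is_direct_sum C X {..<n::nat} F i p"
    using semisimple[of X] by blast
  obtain e where e: "\<And>a. a < n \<Longrightarrow> e a \<in> I \<and> isomorphic C (F a) (V (e a))"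
    using V_rep[OF F] by metis
  then obtain j where "\<And>a. a < n \<Longrightarrow> is_iso C (F a) (V (e a)) (j a)"
    unfolding isomorphic_def by metis
  then show ?thesis using direct_sum_transport[OF ds, of "\<lambda>a. V (e a)" j] e by blast
qed

text \<open>The choice made in \<open>cls\<close> depends on \<open>X\<close> only, so a single
  decomposition serves for all group elements, morphisms and labels. Every property of classes is
  proved from an unspecified decomposition of this kind.\<close>

lemma cls_decomp:
  obtains n :: nat and e i p where "\<And>a. a < n \<Longrightarrow> e a \<in> I" "is_direct_sum C X {..<n} (\<lambda>a. V (e a)) i p"
    "\<And>g f k. cls C I V g X f k = (\<Sum>a | a < n \<and> e a = k. actM C g (p a) \<cdot> f \<cdot> i a)"
proof -
  let ?P = "\<lambda>(n::nat, e, i, p). (\<forall>a<n. e a \<in> I) \<and> is_direct_sum C X {..<n} (\<lambda>a. V (e a)) i p"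
  obtain n e i p where t: "(SOME x. ?P x) = (n, e, i, p)" using prod_cases4 by blast
  have "?P (SOME x. ?P x)" using rep_decomp[of X] by (intro someI_ex[of ?P]) auto
  then have "(\<forall>a<n. e a \<in> I) \<and> is_direct_sum C X {..<n} (\<lambda>a. V (e a)) i p" unfolding t by simp
  moreover have "cls C I V g X f k = (\<Sum>a | a < n \<and> e a = k. actM C g (p a) \<cdot> f \<cdot> i a)" for g f k
    unfolding cls_def t by simp
  ultimately show ?thesis using that by blast
qed

lemma cls_0:
  assumes g: "g \<in> carrier G"
  shows "cls C I V g X 0 k = 0"
proof -
  obtain n e i p where "\<And>a. a < n \<Longrightarrow> e a \<in> I" and d: "is_direct_sum C X {..<n::nat} (\<lambda>a. V (e a)) i p"
    "\<And>g f k. cls C I V g X f k = (\<Sum>a | a < n \<and> e a = k. actM C g (p a) \<cdot> f \<cdot> i a)"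
    by (rule cls_decomp[of X]) (rule that)
  have "actM C g (p a) \<cdot> 0 \<cdot> i a = 0" if "a < n" for a
    using cmp_0_left[OF direct_sumD(2)[OF d(1), of a]] cmp_0_right[OF act_in[OF g direct_sumD(3)[OF d(1), of a]]]
      that by simp
  then show ?thesis by (simp add: d(2))
qed

lemma cls_in:
  assumes "f \<in> Hom C X X"
  shows "cls C I V \<one>\<^bsub>G\<^esub> X f k \<in> Hom C (V k) (V k)"
proof -
  obtain n e i p where "\<And>a. a < n \<Longrightarrow> e a \<in> I" and d: "is_direct_sum C X {..<n::nat} (\<lambda>a. V (e a)) i p"
    "\<And>g f k. cls C I V g X f k = (\<Sum>a | a < n \<and> e a = k. actM C g (p a) \<cdot> f \<cdot> i a)"
    by (rule cls_decomp[of X]) (rule that)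
  show ?thesis
    unfolding d(2)
  proof (rule sum_in)
    fix a assume "a \<in> {a. a < n \<and> e a = k}"
    then have "i a \<in> Hom C (V k) X" "p a \<in> Hom C X (V k)" using direct_sumD(2,3)[OF d(1), of a] by auto
    then show "actM C \<one>\<^bsub>G\<^esub> (p a) \<cdot> f \<cdot> i a \<in> Hom C (V k) (V k)"
      using assms by (simp add: act_one(2) cmp_in)
  qed
qed

text \<open>A loop coloured by a summand and carrying \<open>p \<cdot> f \<cdot> i\<close> equals,
  by cyclicity, the loop coloured by \<open>X\<close> and carrying
  \<open>i \<cdot> p \<cdot> f\<close>. The idempotents \<open>i \<cdot> p\<close> add up to the
  identity of \<open>X\<close>.\<close>

lemma loop_cls:
  assumes h: "h \<in> carrier G" and X: "X \<in> deg C h" and W: "W \<in> deg C \<one>\<^bsub>G\<^esub>" and f: "f \<in> Hom C X X"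
  shows "(\<Sum>m\<in>Ideg C I V h. loop G C \<one>\<^bsub>G\<^esub> h (V m) (cls C I V \<one>\<^bsub>G\<^esub> X f m) W) = loop G C \<one>\<^bsub>G\<^esub> h X f W"
proof -
  obtain n e i p where e: "\<And>a. a < n \<Longrightarrow> e a \<in> I" and ds: "is_direct_sum C X {..<n::nat} (\<lambda>a. V (e a)) i p"
    and cls: "\<And>g f k. cls C I V g X f k = (\<Sum>a | a < n \<and> e a = k. actM C g (p a) \<cdot> f \<cdot> i a)"
    by (rule cls_decomp[of X]) (rule that)
  note d = direct_sumD[OF ds]
  have i: "i a \<in> Hom C (V (e a)) X" and p: "p a \<in> Hom C X (V (e a))" and pi: "p a \<cdot> i a = Idm C (V (e a))"
    if "a < n" for a using d(2-4)[of a] that by auto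
  have ea: "e a \<in> Ideg C I V h" and dega: "V (e a) \<in> deg C h" if "a < n" for a
    using e[OF that] summand_deg[OF h X i[OF that] p[OF that] pi[OF that]] by (auto simp: Ideg_iff)
  let ?l = "\<lambda>Y g. loop G C \<one>\<^bsub>G\<^esub> h Y g W"
  have "(\<Sum>m\<in>Ideg C I V h. ?l (V m) (cls C I V \<one>\<^bsub>G\<^esub> X f m)) =
    (\<Sum>m\<in>Ideg C I V h. \<Sum>a | a \<in> {..<n} \<and> e a = m. ?l (V (e a)) (p a \<cdot> f \<cdot> i a))"
  proof (rule sum.cong[OF refl])
    fix m assume m: "m \<in> Ideg C I V h"
    have "cls C I V \<one>\<^bsub>G\<^esub> X f m = (\<Sum>a | a < n \<and> e a = m. p a \<cdot> f \<cdot> i a)"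
      unfolding cls by (rule sum.cong[OF refl]) (auto simp: act_one(2)[OF p])
    moreover have "?l (V m) (\<Sum>a | a < n \<and> e a = m. p a \<cdot> f \<cdot> i a) =
      (\<Sum>a | a < n \<and> e a = m. ?l (V m) (p a \<cdot> f \<cdot> i a))"
      using i p f m by (intro loop_sum h W) (auto simp: Ideg_iff intro!: cmp_in)
    ultimately show "?l (V m) (cls C I V \<one>\<^bsub>G\<^esub> X f m) =
      (\<Sum>a | a \<in> {..<n} \<and> e a = m. ?l (V (e a)) (p a \<cdot> f \<cdot> i a))" by simp
  qed
  \<comment> \<open>Summands are regrouped by their labels; each label occurs in \<open>Ideg\<close>
    at \<open>h\<close> because a summand of \<open>X\<close> inherits its degree.\<close>
  also have "\<dots> = (\<Sum>a\<in>{..<n}. ?l (V (e a)) (p a \<cdot> f \<cdot> i a))"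
    using ea by (intro sum.group) auto
  also have "\<dots> = (\<Sum>a\<in>{..<n}. ?l X (i a \<cdot> p a \<cdot> f))"
  proof (rule sum.cong[OF refl])
    fix a assume "a \<in> {..<n}"
    then have a: "a < n" by simp
    have "p a \<cdot> f \<cdot> i a = (p a \<cdot> f) \<cdot> i a" using cmp_assoc[OF p[OF a] f i[OF a]] by simp
    then show "?l (V (e a)) (p a \<cdot> f \<cdot> i a) = ?l X (i a \<cdot> p a \<cdot> f)"
      using loop_cyclic[OF h dega[OF a] X W i[OF a] cmp_in[OF p[OF a] f]] by simp
  qed
  also have "\<dots> = ?l X (\<Sum>a\<in>{..<n}. i a \<cdot> p a \<cdot> f)"
    using i p f by (intro loop_sum[symmetric] h X W) (auto intro!: cmp_in)
  also have "(\<Sum>a\<in>{..<n}. i a \<cdot> p a \<cdot> f) = (\<Sum>a\<in>{..<n}. (i a \<cdot> p a) \<cdot> f)"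
    using cmp_assoc[OF i p f] by (intro sum.cong) auto
  also have "\<dots> = (\<Sum>a\<in>{..<n}. i a \<cdot> p a) \<cdot> f"
    using i p f by (intro cmp_sum_left[symmetric]) (auto intro!: cmp_in)
  also have "\<dots> = f" using d(6) Idm_left[OF f] by simp
  finally show ?thesis .
qed

text \<open>There is exactly one simple summand: the projectors of two summands would be nonzero
  multiples of the identity, yet they annihilate each other. This will show that the dual of
  \<open>V k\<close> is isomorphic to a representative.\<close>

lemma cls_End_scalar:
  assumes X: "Idm C X \<noteq> 0" and End: "\<And>f. f \<in> Hom C X X \<Longrightarrow> \<exists>c. f = c \<bullet> Idm C X"
  obtains k i p where "k \<in> I" "i \<in> Hom C (V k) X" "p \<in> Hom C X (V k)" "p \<cdot> i = Idm C (V k)" "i \<cdot> p = Idm C X"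
    "\<And>l. cls C I V \<one>\<^bsub>G\<^esub> X (Idm C X) l = (if l = k then Idm C (V k) else 0)"
proof -
  obtain n e i p where e: "\<And>a. a < n \<Longrightarrow> e a \<in> I" and ds: "is_direct_sum C X {..<n::nat} (\<lambda>a. V (e a)) i p"
    and cls: "\<And>g f k. cls C I V g X f k = (\<Sum>a | a < n \<and> e a = k. actM C g (p a) \<cdot> f \<cdot> i a)"
    by (rule cls_decomp[of X]) (rule that)
  note d = direct_sumD[OF ds]
  have i: "i a \<in> Hom C (V (e a)) X" and p: "p a \<in> Hom C X (V (e a))" and pi: "p a \<cdot> i a = Idm C (V (e a))"
    if "a < n" for a using d(2-4)[of a] that by auto
  have ne: "i a \<cdot> p a \<noteq> 0" if a: "a < n" for a
  proof
    assume z: "i a \<cdot> p a = 0"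
    have "Idm C (V (e a)) = p a \<cdot> (i a \<cdot> (p a \<cdot> i a))"
      using pi[OF a] Idm_right[OF i[OF a]] by simp
    also have "\<dots> = p a \<cdot> ((i a \<cdot> p a) \<cdot> i a)" using cmp_assoc[OF i[OF a] p[OF a] i[OF a]] by simp
    also have "\<dots> = 0" using z cmp_0_left[OF i[OF a]] cmp_0_right[OF p[OF a]] by simp
    finally show False using V_nonzero[OF e[OF a]] by simp
  qed
  have "n \<noteq> 0" using d(6) X by (metis lessThan_0 sum.empty)
  moreover have "\<not> 1 < n"
  proof
    assume n: "1 < n"
    then have n0: "0 < n" by simp
    obtain b c where b: "i 0 \<cdot> p 0 = b \<bullet> Idm C X" and c: "i 1 \<cdot> p 1 = c \<bullet> Idm C X"
      using End[OF cmp_in[OF i[OF n0] p[OF n0]]] End[OF cmp_in[OF i[OF n] p[OF n]]] by blast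
    have bc: "b \<noteq> 0" "c \<noteq> 0" using ne[OF n0] ne[OF n] b c by auto
    have "p 0 \<cdot> (i 1 \<cdot> p 1) = (p 0 \<cdot> i 1) \<cdot> p 1" using cmp_assoc[OF p[OF n0] i[OF n] p[OF n]] by simp
    also have "\<dots> = 0" using d(5)[of 0 1] n cmp_0_left[OF p[OF n]] by simp
    finally have "c \<bullet> p 0 = 0" using c cmp_scl_right[OF p[OF n0] Idm_in] Idm_right[OF p[OF n0]] by simp
    then have "p 0 = 0" using bc by simp
    then show False using ne[OF n0] cmp_0_right[OF i[OF n0]] by simp
  qed
  ultimately have n: "n = 1" by simp
  show ?thesis
  proof (rule that[of "e 0" "i 0" "p 0"])
    show "i 0 \<cdot> p 0 = Idm C X" using d(6) n by simp
    show "cls C I V \<one>\<^bsub>G\<^esub> X (Idm C X) l = (if l = e 0 then Idm C (V (e 0)) else 0)" for l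
    proof -
      have "{a. a < n \<and> e a = l} = (if l = e 0 then {0} else {})" using n by auto
      then show ?thesis
        unfolding cls using n i[of 0] p[of 0] pi[of 0] by (simp add: act_one(2) Idm_left)
    qed
  qed (use n e i p pi in auto)
qed

text \<open>Frobenius reciprocity turns \<open>u\<close> into a morphism from \<open>V k\<close> to
  \<open>V j\<close>, which is 0 between non-isomorphic simple objects.\<close>

lemma hom_unit_distinct:
  assumes "j \<in> I" "k \<in> I" "j \<noteq> k" and u: "u \<in> Hom C (unit C) (V j \<boxtimes> dual C (V k))"
  shows "u = 0"
proof -
  let ?A = "\<lambda>u. Arr (unit C) u (V j \<boxtimes> dual C (V k))"
  have c: "copairing (?A u) (V j) (dual C (V k))" if "u \<in> Hom C (unit C) (V j \<boxtimes> dual C (V k))" for u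
    using that by (simp add: copairing_def valid_def)
  have z: "mr (frobenius (V j) (V k) t) = 0" for t
  proof (rule ccontr)
    assume n: "mr (frobenius (V j) (V k) t) \<noteq> 0"
    have "mr (frobenius (V j) (V k) t) \<in> Hom C (V k) (V j)"
      using frobenius_simps(3)[of "V j" "V k" t] unfolding valid_def by simp
    from iso_of_nonzero[OF V_simple V_simple this n] have "isomorphic C (V k) (V j)"
      using assms by (auto simp: isomorphic_def)
    then show False using V_unique assms by blast
  qed
  have "frobenius (V j) (V k) (?A u) = frobenius (V j) (V k) (?A 0)"
    by (intro arr_eqI) (simp_all only: frobenius_simps z)
  from frobenius_inj[OF this c[OF u] c[OF zero_in]] show ?thesis by simp
qed

text \<open>Frobenius reciprocity embeds these morphisms linearly into the endomorphisms of
  \<open>V k\<close>, a line by Schur's lemma.\<close>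

lemma hom_unit_proportional:
  assumes k: "k \<in> I" and u: "u \<in> Hom C (unit C) (V k \<boxtimes> dual C (V k))"
    and v: "v \<in> Hom C (unit C) (V k \<boxtimes> dual C (V k))" "v \<noteq> 0"
  shows "\<exists>c. u = c \<bullet> v"
proof -
  let ?H = "Hom C (unit C) (V k \<boxtimes> dual C (V k))" and ?X = "V k"
  let ?A = "\<lambda>u. Arr (unit C) u (?X \<boxtimes> dual C ?X)"
  have c: "copairing (?A u) ?X (dual C ?X)" if "u \<in> ?H" for u
    using that by (simp add: copairing_def valid_def)
  have "\<exists>a. frobenius ?X ?X t = sclA a (ide ?X)" for t
  proof -
    have "mr (frobenius ?X ?X t) \<in> Hom C ?X ?X" using frobenius_simps(3)[of ?X ?X t] unfolding valid_def by simp
    from schur[OF V_simple[OF k] this] obtain a where "mr (frobenius ?X ?X t) = a \<bullet> Idm C ?X" by blast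
    then have "frobenius ?X ?X t = sclA a (ide ?X)" by (intro arr_eqI) simp_all
    then show ?thesis by blast
  qed
  then obtain a b where a: "frobenius ?X ?X (?A u) = sclA a (ide ?X)" and b: "frobenius ?X ?X (?A v) = sclA b (ide ?X)"
    by blast
  have s: "sclA r (?A w) = ?A (r \<bullet> w)" for r w by (simp add: sclA_def)
  have f: "frobenius ?X ?X (?A (r \<bullet> w)) = sclA r (frobenius ?X ?X (?A w))" if "w \<in> ?H" for r w
    unfolding s[symmetric] by (rule frobenius_sclA[OF c[OF that]])
  \<comment> \<open>With \<open>a\<close> and \<open>b\<close> the scalars of \<open>u\<close> and
    \<open>v\<close>, cross multiplication gives equal images; injectivity then also shows that
    \<open>b\<close> is nonzero.\<close>
  have "frobenius ?X ?X (?A (b \<bullet> u)) = frobenius ?X ?X (?A (a \<bullet> v))"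
    unfolding f[OF u] f[OF v(1)] a b by (simp add: sclA_def scl_scl mult.commute)
  from frobenius_inj[OF this c[OF scl_in[OF u]] c[OF scl_in[OF v(1)]]] have ab: "b \<bullet> u = a \<bullet> v" by simp
  have "b \<noteq> 0"
  proof
    assume "b = 0"
    then have "frobenius ?X ?X (?A v) = frobenius ?X ?X (?A (0 \<bullet> v))"
      unfolding f[OF v(1)] b by (simp add: sclA_def)
    from frobenius_inj[OF this c[OF v(1)] c[OF scl_in[OF v(1)]]] show False using v(2) by simp
  qed
  then have "u = (a / b) \<bullet> v"
    using arg_cong[OF ab, of "\<lambda>x. (1 / b) \<bullet> x"] by (simp add: scl_scl)
  then show ?thesis by blast
qed

section \<open>Products, the involution and the bilinear form\<close>

lemma commuting_one [simp]: "commuting G \<one>\<^bsub>G\<^esub> a \<longleftrightarrow> a \<in> carrier G" "commuting G a \<one>\<^bsub>G\<^esub> \<longleftrightarrow> a \<in> carrier G"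
  by (auto simp: commuting_def)

lemma VerlD: "\<lbrakk>x \<in> Verl G C I V; commuting G g h; i \<in> Ideg C I V h\<rbrakk> \<Longrightarrow> x g h i \<in> Hom C (V i) (actO C g (V i))"
  and Verl_compD: "x \<in> Verl_comp G C I V g h \<Longrightarrow> x \<in> Verl G C I V"
    "\<lbrakk>x \<in> Verl_comp G C I V g h; (g', h') \<noteq> (g, h)\<rbrakk> \<Longrightarrow> x g' h' i = 0"
  unfolding Verl_def Verl_comp_def by (auto split: if_splits)

lemma Verl_one: "\<lbrakk>x \<in> Verl G C I V; h \<in> carrier G; i \<in> Ideg C I V h\<rbrakk> \<Longrightarrow> x \<one>\<^bsub>G\<^esub> h i \<in> Hom C (V i) (V i)"
  using VerlD[of x "\<one>\<^bsub>G\<^esub>" h i] by (simp add: act_one(1))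

lemma vtimes_term_0:
  assumes "g \<in> carrier G" "f' \<in> Hom C Y (actO C g Y)"
  shows "cls C I V g (X \<boxtimes> Y) (mu C g X Y \<cdot> (0 \<boxtimes>\<^sub>m f')) k = 0"
  using cls_0[OF assms(1)] cmp_0_right[OF is_iso_in[OF mu_iso[OF assms(1)]]] tn_0_left[OF assms(2)] by simp

lemma vtimes_comp_0:
  assumes x: "x \<in> Verl_comp G C I V \<one>\<^bsub>G\<^esub> \<one>\<^bsub>G\<^esub>" and z: "z \<in> Verl G C I V" and g: "g \<noteq> \<one>\<^bsub>G\<^esub>"
  shows "vtimes G C I V x z g c k = 0"
proof (cases "commuting G g c \<and> k \<in> Ideg C I V c")
  case True
  then have gG: "g \<in> carrier G" by (simp add: commuting_def)
  have z0: "(\<Sum>i\<in>Ideg C I V a. \<Sum>j\<in>Ideg C I V b.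
     cls C I V g (V i \<boxtimes> V j) (mu C g (V i) (V j) \<cdot> (x g a i \<boxtimes>\<^sub>m z g b j)) k) = 0"
    if "commuting G g b" for a b
  proof (intro sum.neutral ballI)
    fix i j assume j: "j \<in> Ideg C I V b"
    have "x g a i = 0" using Verl_compD(2)[OF x] g by simp
    then show "cls C I V g (V i \<boxtimes> V j) (mu C g (V i) (V j) \<cdot> (x g a i \<boxtimes>\<^sub>m z g b j)) k = 0"
      using vtimes_term_0[OF gG VerlD[OF z that j]] by simp
  qed
  have "vtimes G C I V x z g c k = (\<Sum>(a, b) | commuting G g a \<and> commuting G g b \<and> a \<otimes>\<^bsub>G\<^esub> b = c.
     \<Sum>i\<in>Ideg C I V a. \<Sum>j\<in>Ideg C I V b.
       cls C I V g (V i \<boxtimes> V j) (mu C g (V i) (V j) \<cdot> (x g a i \<boxtimes>\<^sub>m z g b j)) k)"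
    using True by (simp add: vtimes_def)
  also have "\<dots> = 0" by (rule sum.neutral) (auto simp: z0)
  finally show ?thesis .
qed (auto simp: vtimes_def)

text \<open>As \<open>x\<close> is supported at the pair of neutral elements, only the factorisation
  of \<open>c\<close> with first factor neutral contributes, and there \<open>mu_one\<close> removes
  the tensor constraint of the action.\<close>

lemma vtimes_one:
  assumes x: "x \<in> Verl_comp G C I V \<one>\<^bsub>G\<^esub> \<one>\<^bsub>G\<^esub>" and z: "z \<in> Verl G C I V"
    and c: "c \<in> carrier G" and k: "k \<in> Ideg C I V c"
  shows "vtimes G C I V x z \<one>\<^bsub>G\<^esub> c k = (\<Sum>i\<in>Ideg C I V \<one>\<^bsub>G\<^esub>. \<Sum>j\<in>Ideg C I V c.
     cls C I V \<one>\<^bsub>G\<^esub> (V i \<boxtimes> V j) (x \<one>\<^bsub>G\<^esub> \<one>\<^bsub>G\<^esub> i \<boxtimes>\<^sub>m z \<one>\<^bsub>G\<^esub> c j) k)"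
proof -
  let ?o = "\<one>\<^bsub>G\<^esub>"
  let ?P = "{(a, b). commuting G ?o a \<and> commuting G ?o b \<and> a \<otimes>\<^bsub>G\<^esub> b = c}"
  let ?F = "\<lambda>(a, b). \<Sum>i\<in>Ideg C I V a. \<Sum>j\<in>Ideg C I V b.
     cls C I V ?o (V i \<boxtimes> V j) (mu C ?o (V i) (V j) \<cdot> (x ?o a i \<boxtimes>\<^sub>m z ?o b j)) k"
  have fin: "finite ?P"
    by (rule finite_subset[OF _ finite_cartesian_product[OF finite_group finite_group]]) auto
  have "vtimes G C I V x z ?o c k = sum ?F ?P" using c k by (simp add: vtimes_def)
  also have "\<dots> = sum ?F {(?o, c)}"
  proof (rule sum.mono_neutral_right[OF fin])
    show "{(?o, c)} \<subseteq> ?P" using c by simp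
    show "\<forall>t\<in>?P - {(?o, c)}. ?F t = 0"
    proof
      fix t assume t: "t \<in> ?P - {(?o, c)}"
      then obtain a b where ab: "t = (a, b)" "a \<in> carrier G" "b \<in> carrier G" "a \<otimes>\<^bsub>G\<^esub> b = c" "t \<noteq> (?o, c)"
        by auto
      then have a: "a \<noteq> ?o" by auto
      have "cls C I V ?o (V i \<boxtimes> V j) (mu C ?o (V i) (V j) \<cdot> (x ?o a i \<boxtimes>\<^sub>m z ?o b j)) k = 0"
        if "j \<in> Ideg C I V b" for i j
      proof -
        have "x ?o a i = 0" using Verl_compD(2)[OF x] a by simp
        then show ?thesis using vtimes_term_0[OF one_closed VerlD[OF z _ that]] ab(3) by simp
      qed
      then show "?F t = 0" unfolding ab(1) by (simp add: sum.neutral)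
    qed
  qed
  also have "\<dots> = (\<Sum>i\<in>Ideg C I V ?o. \<Sum>j\<in>Ideg C I V c.
     cls C I V ?o (V i \<boxtimes> V j) (x ?o ?o i \<boxtimes>\<^sub>m z ?o c j) k)"
  proof -
    have "mu C ?o (V i) (V j) \<cdot> (x ?o ?o i \<boxtimes>\<^sub>m z ?o c j) = x ?o ?o i \<boxtimes>\<^sub>m z ?o c j"
      if "i \<in> Ideg C I V ?o" "j \<in> Ideg C I V c" for i j
      unfolding mu_one
      by (rule Idm_left[OF tn_in[OF Verl_one[OF Verl_compD(1)[OF x] one_closed that(1)] Verl_one[OF z c that(2)]]])
    then show ?thesis by simp
  qed
  finally show ?thesis .
qed

text \<open>The basis element \<open>\<lambda>\<^sub>k\<close> at the neutral group element, where a
  generic basis is normalised to the identity.\<close>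

definition idm_basis :: "'i \<Rightarrow> 'g \<Rightarrow> 'g \<Rightarrow> 'i \<Rightarrow> 'm" where
  "idm_basis k = single \<one>\<^bsub>G\<^esub> \<one>\<^bsub>G\<^esub> k (Idm C (V k))"

lemma idm_basis_apply: "idm_basis k g h i = (if g = \<one>\<^bsub>G\<^esub> \<and> h = \<one>\<^bsub>G\<^esub> \<and> i = k then Idm C (V k) else 0)"
  by (simp add: idm_basis_def single_def)

lemma idm_basis_in: "k \<in> Ideg C I V \<one>\<^bsub>G\<^esub> \<Longrightarrow> idm_basis k \<in> Verl_comp G C I V \<one>\<^bsub>G\<^esub> \<one>\<^bsub>G\<^esub>"
  by (auto simp: Verl_comp_def Verl_def idm_basis_apply act_one(1) Idm_in)

lemma vstar_idm_basis:
  assumes k: "k \<in> Ideg C I V \<one>\<^bsub>G\<^esub>"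
  shows "vstar G C I V (idm_basis k) g h l =
    (if g = \<one>\<^bsub>G\<^esub> \<and> h = \<one>\<^bsub>G\<^esub> \<and> l \<in> Ideg C I V \<one>\<^bsub>G\<^esub>
     then cls C I V \<one>\<^bsub>G\<^esub> (dual C (V k)) (Idm C (dual C (V k))) l else 0)"
proof (cases "commuting G g h \<and> l \<in> Ideg C I V h")
  case True
  then have gh: "g \<in> carrier G" "h \<in> carrier G" by (auto simp: commuting_def)
  have i1: "inv\<^bsub>G\<^esub> a = \<one>\<^bsub>G\<^esub> \<longleftrightarrow> a = \<one>\<^bsub>G\<^esub>" if "a \<in> carrier G" for a
    using inv_inv[OF that] by auto
  have t: "cls C I V g (dual C (V i)) (adjoint G C (inv\<^bsub>G\<^esub> g) (V i) (idm_basis k (inv\<^bsub>G\<^esub> g) (inv\<^bsub>G\<^esub> h) i)) l =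
    (if g = \<one>\<^bsub>G\<^esub> \<and> h = \<one>\<^bsub>G\<^esub> \<and> i = k
     then cls C I V \<one>\<^bsub>G\<^esub> (dual C (V k)) (Idm C (dual C (V k))) l else 0)" for i
    using gh by (auto simp: idm_basis_apply i1 adjoint_0 cls_0 adjoint_one)
  have v: "vstar G C I V (idm_basis k) g h l = (\<Sum>i\<in>Ideg C I V (inv\<^bsub>G\<^esub> h).
     if g = \<one>\<^bsub>G\<^esub> \<and> h = \<one>\<^bsub>G\<^esub> \<and> i = k
     then cls C I V \<one>\<^bsub>G\<^esub> (dual C (V k)) (Idm C (dual C (V k))) l else 0)"
    using True by (simp only: vstar_def t simp_thms if_True)
  show ?thesis
  proof (cases "g = \<one>\<^bsub>G\<^esub> \<and> h = \<one>\<^bsub>G\<^esub>")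
    case one: True
    then show ?thesis unfolding v using True k by simp
  next
    case False
    then consider "g \<noteq> \<one>\<^bsub>G\<^esub>" | "h \<noteq> \<one>\<^bsub>G\<^esub>" by blast
    then show ?thesis unfolding v by cases simp_all
  qed
qed (auto simp: vstar_def)

lemma vstar_idm_basis_in:
  assumes k: "k \<in> Ideg C I V \<one>\<^bsub>G\<^esub>"
  shows "vstar G C I V (idm_basis k) \<in> Verl G C I V"
  by (auto simp: Verl_def vstar_idm_basis[OF k] act_one(1) intro: cls_in Idm_in)

lemma eta_nonzero: "g \<in> carrier G \<Longrightarrow> eta C g \<noteq> 0"
proof
  assume g: "g \<in> carrier G" and "eta C g = 0"
  then have "Idm C (unit C) = 0"
    using inv_mor_left[OF eta_iso[OF g]] cmp_0_right[OF inv_mor_in[OF eta_iso[OF g]]] by simp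
  then show False using unit_simple by (simp add: simple_def)
qed

lemma THE_scl: "v \<noteq> 0 \<Longrightarrow> (THE c. a \<bullet> v = c \<bullet> v) = a"
proof (rule the_equality)
  fix c assume v: "v \<noteq> 0" and "a \<bullet> v = c \<bullet> v"
  then have "(a - c) \<bullet> v = 0" using scl_add_left[of a "- c" v] by (simp add: scl_minus_left)
  then show "c = a" using v by simp
qed simp

lemma cls_no_hom:
  assumes "k \<in> I" "Hom C (V k) X = {0}"
  shows "cls C I V \<one>\<^bsub>G\<^esub> X f k = 0"
proof -
  obtain n e i p where e: "\<And>a. a < n \<Longrightarrow> e a \<in> I" and ds: "is_direct_sum C X {..<n::nat} (\<lambda>a. V (e a)) i p"
    and cls: "\<And>g f k. cls C I V g X f k = (\<Sum>a | a < n \<and> e a = k. actM C g (p a) \<cdot> f \<cdot> i a)"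
    by (rule cls_decomp[of X]) (rule that)
  have "{a. a < n \<and> e a = k} = {}"
  proof (rule ccontr)
    assume "{a. a < n \<and> e a = k} \<noteq> {}"
    then obtain a where a: "a < n" "e a = k" by blast
    then have "i a \<in> Hom C (V k) X" using direct_sumD(2)[OF ds, of a] by simp
    then have "i a = 0" using assms by simp
    then have "Idm C (V k) = 0" using direct_sumD(3,4)[OF ds, of a] a cmp_0_right by fastforce
    then show False using V_nonzero assms by simp
  qed
  then show ?thesis by (simp only: cls sum.empty)
qed

text \<open>The morphism \<open>u0\<close> forces \<open>V k\<close> to occur among the summands of
  \<open>X\<close>, and since the morphisms from \<open>V k\<close> form a line it occurs only once.
  So the diagonal part at \<open>k\<close> of \<open>c\<close> times the identity is a single
  term.\<close>

lemma cls_hom_line: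
  assumes k: "k \<in> I" and u0: "u0 \<in> Hom C (V k) X" "u0 \<noteq> 0"
    and line: "\<And>u v. \<lbrakk>u \<in> Hom C (V k) X; v \<in> Hom C (V k) X; v \<noteq> 0\<rbrakk> \<Longrightarrow> \<exists>c. u = c \<bullet> v"
  shows "cls C I V \<one>\<^bsub>G\<^esub> X (c \<bullet> Idm C X) k = c \<bullet> Idm C (V k)"
proof -
  obtain n e i p where e: "\<And>a. a < n \<Longrightarrow> e a \<in> I" and ds: "is_direct_sum C X {..<n::nat} (\<lambda>a. V (e a)) i p"
    and cls: "\<And>g f k. cls C I V g X f k = (\<Sum>a | a < n \<and> e a = k. actM C g (p a) \<cdot> f \<cdot> i a)"
    by (rule cls_decomp[of X]) (rule that)
  note d = direct_sumD[OF ds]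
  have i: "i a \<in> Hom C (V (e a)) X" and p: "p a \<in> Hom C X (V (e a))" and pi: "p a \<cdot> i a = Idm C (V (e a))"
    if "a < n" for a using d(2-4)[of a] that by auto
  have "\<exists>a<n. p a \<cdot> u0 \<noteq> 0"
  proof (rule ccontr)
    assume "\<not> ?thesis"
    then have z: "p a \<cdot> u0 = 0" if "a < n" for a using that by blast
    have "u0 = (\<Sum>a\<in>{..<n}. i a \<cdot> p a) \<cdot> u0" using d(6) Idm_left[OF u0(1)] by simp
    also have "\<dots> = (\<Sum>a\<in>{..<n}. (i a \<cdot> p a) \<cdot> u0)"
      using i p u0(1) by (intro cmp_sum_left) (auto intro!: cmp_in)
    also have "\<dots> = 0"
      using cmp_assoc[OF i p u0(1)] z cmp_0_right[OF i] by (intro sum.neutral) simp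
    finally show False using u0(2) by simp
  qed
  then obtain a where a: "a < n" "p a \<cdot> u0 \<noteq> 0" by blast
  have "is_iso C (V k) (V (e a)) (p a \<cdot> u0)"
    by (rule iso_of_nonzero[OF V_simple[OF k] V_simple[OF e[OF a(1)]] cmp_in[OF p[OF a(1)] u0(1)] a(2)])
  then have ea: "e a = k" using V_unique[OF k e[OF a(1)]] by (auto simp: isomorphic_def)
  \<comment> \<open>Two inclusions of \<open>V k\<close> would be proportional, while the projection
    onto one summand annihilates the inclusion of the other.\<close>
  have uniq: "b = a" if b: "b < n" "e b = k" for b
  proof (rule ccontr)
    assume ba: "b \<noteq> a"
    have i_b: "i b \<in> Hom C (V k) X" and i_a: "i a \<in> Hom C (V k) X" using i[OF b(1)] i[OF a(1)] b ea by auto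
    have "i b \<noteq> 0" using pi[OF b(1)] cmp_0_right[OF p[OF b(1)]] V_nonzero[OF e[OF b(1)]] by auto
    then obtain r where r: "i a = r \<bullet> i b" using line[OF i_a i_b] by blast
    have "p a \<cdot> i a = r \<bullet> (p a \<cdot> i b)" unfolding r by (rule cmp_scl_right[OF p[OF a(1)] i_b])
    also have "\<dots> = 0" using d(5)[of a b] a b ba by simp
    finally show False using pi[OF a(1)] V_nonzero[OF e[OF a(1)]] by simp
  qed
  have "{b. b < n \<and> e b = k} = {a}" using a ea uniq by blast
  then have "cls C I V \<one>\<^bsub>G\<^esub> X (c \<bullet> Idm C X) k = p a \<cdot> (c \<bullet> Idm C X) \<cdot> i a"
    by (simp add: cls act_one(2)[OF p[OF a(1)]])
  also have "\<dots> = c \<bullet> Idm C (V k)"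
    using cmp_scl_left[OF Idm_in i[OF a(1)]] Idm_left[OF i[OF a(1)]] cmp_scl_right[OF p[OF a(1)] i[OF a(1)]]
      pi[OF a(1)] ea by simp
  finally show ?thesis .
qed

text \<open>The involution sends the basis element at \<open>k\<close> to the class of the identity
  of the dual of \<open>V k\<close>, concentrated at one label \<open>k'\<close>. The unit occurs
  once in \<open>V j \<boxtimes> V k'\<close> for \<open>j = k\<close> and not at all for
  \<open>j \<noteq> k\<close>, so exactly the coefficient at \<open>k\<close> reaches
  \<open>vcoeff0\<close>.\<close>

lemma vform_idm_basis:
  assumes y: "y \<in> Verl_comp G C I V \<one>\<^bsub>G\<^esub> \<one>\<^bsub>G\<^esub>" and k: "k \<in> Ideg C I V \<one>\<^bsub>G\<^esub>"
    and yk: "y \<one>\<^bsub>G\<^esub> \<one>\<^bsub>G\<^esub> k = c \<bullet> Idm C (V k)"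
  shows "vform G C I V i0 y (idm_basis k) = c"
proof -
  let ?o = "\<one>\<^bsub>G\<^esub>" and ?D = "dual C (V k)"
  have kI: "k \<in> I" using k by (simp add: Ideg_iff)
  obtain k' i p where k': "k' \<in> I" "i \<in> Hom C (V k') ?D" "p \<in> Hom C ?D (V k')" "p \<cdot> i = Idm C (V k')"
    "i \<cdot> p = Idm C ?D"
    and cls: "\<And>l. cls C I V ?o ?D (Idm C ?D) l = (if l = k' then Idm C (V k') else 0)"
    using cls_End_scalar[OF dual_nonzero[OF V_nonzero[OF kI]] dual_End[OF V_simple[OF kI]]] by blast
  let ?z = "vtimes G C I V y (vstar G C I V (idm_basis k))"
  \<comment> \<open>Composition with the isomorphism \<open>i\<close> transfers morphisms into
    \<open>V j \<boxtimes> V k'\<close> to morphisms into \<open>V j\<close> tensored with the dual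
    of \<open>V k\<close>, where Frobenius reciprocity applies.\<close>
  have up: "(Idm C (V j) \<boxtimes>\<^sub>m i) \<cdot> u \<in> Hom C (unit C) (V j \<boxtimes> ?D)"
    "(Idm C (V j) \<boxtimes>\<^sub>m p) \<cdot> ((Idm C (V j) \<boxtimes>\<^sub>m i) \<cdot> u) = u"
    if u: "u \<in> Hom C (unit C) (V j \<boxtimes> V k')" for j u
  proof -
    note I = tn_in[OF Idm_in[of "V j"] k'(2)] and P = tn_in[OF Idm_in[of "V j"] k'(3)]
    show "(Idm C (V j) \<boxtimes>\<^sub>m i) \<cdot> u \<in> Hom C (unit C) (V j \<boxtimes> ?D)" by (rule cmp_in[OF I u])
    have "(Idm C (V j) \<boxtimes>\<^sub>m p) \<cdot> (Idm C (V j) \<boxtimes>\<^sub>m i) = Idm C (V j \<boxtimes> V k')"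
      using tn_cmp[OF Idm_in[of "V j"] Idm_in[of "V j"] k'(2,3)] k'(4) tn_Idm Idm_left[OF Idm_in[of "V j"]] by simp
    then show "(Idm C (V j) \<boxtimes>\<^sub>m p) \<cdot> ((Idm C (V j) \<boxtimes>\<^sub>m i) \<cdot> u) = u"
      using cmp_assoc[OF P I u] Idm_left[OF u] by simp
  qed
  \<comment> \<open>The coevaluation of \<open>V k\<close>, transported along the isomorphism from
    its dual to \<open>V k'\<close>.\<close>
  let ?u0 = "(Idm C (V k) \<boxtimes>\<^sub>m p) \<cdot> coev C (V k)"
  have u0: "?u0 \<in> Hom C (unit C) (V k \<boxtimes> V k')"
    by (rule cmp_in[OF tn_in[OF Idm_in k'(3)] coev_in])
  have u0_ne: "?u0 \<noteq> 0"
  proof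
    assume z: "?u0 = 0"
    note I = tn_in[OF Idm_in[of "V k"] k'(2)] and P = tn_in[OF Idm_in[of "V k"] k'(3)]
    have "(Idm C (V k) \<boxtimes>\<^sub>m i) \<cdot> (Idm C (V k) \<boxtimes>\<^sub>m p) = Idm C (V k \<boxtimes> ?D)"
      using tn_cmp[OF Idm_in[of "V k"] Idm_in[of "V k"] k'(3,2)] k'(5) tn_Idm Idm_left[OF Idm_in[of "V k"]] by simp
    then have "coev C (V k) = (Idm C (V k) \<boxtimes>\<^sub>m i) \<cdot> ?u0"
      using cmp_assoc[OF I P coev_in] Idm_left[OF coev_in] by simp
    then show False using z cmp_0_right[OF I] coev_nonzero[OF V_nonzero[OF kI]] by simp
  qed
  \<comment> \<open>A nonzero morphism from the unit to \<open>V k \<boxtimes> V k'\<close> forces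
    the latter to have degree one, and with it \<open>V k'\<close>.\<close>
  have k'1: "k' \<in> Ideg C I V ?o"
  proof -
    obtain h where h: "h \<in> carrier G" "V k' \<in> deg C h" using simple_deg[OF V_simple[OF k'(1)]] by blast
    have "V k \<boxtimes> V k' \<in> deg C h" using deg_tn[OF one_closed h(1) _ h(2)] k h(1) by (simp add: Ideg_iff)
    then have "h = ?o"
      using deg_orthogonal[OF one_closed h(1) _ unit_deg, of "V k \<boxtimes> V k'"] u0 u0_ne by blast
    then show ?thesis using h k'(1) by (simp add: Ideg_iff)
  qed
  have yj: "y ?o ?o j \<in> Hom C (V j) (V j)" if "j \<in> Ideg C I V ?o" for j
    using Verl_one[OF Verl_compD(1)[OF y] one_closed that] .
  have "?z ?o ?o i0 = (\<Sum>j\<in>Ideg C I V ?o. \<Sum>l\<in>Ideg C I V ?o.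
     cls C I V ?o (V j \<boxtimes> V l) (y ?o ?o j \<boxtimes>\<^sub>m vstar G C I V (idm_basis k) ?o ?o l) i0)"
    by (rule vtimes_one[OF y vstar_idm_basis_in[OF k] one_closed i0_Ideg])
  also have "\<dots> = (\<Sum>j\<in>Ideg C I V ?o. \<Sum>l\<in>Ideg C I V ?o.
     if l = k' then cls C I V ?o (V j \<boxtimes> V k') (y ?o ?o j \<boxtimes>\<^sub>m Idm C (V k')) i0 else 0)"
    using tn_0_right[OF yj] cls_0[OF one_closed]
    by (intro sum.cong refl) (simp add: vstar_idm_basis[OF k] cls)
  also have "\<dots> = (\<Sum>j\<in>Ideg C I V ?o. cls C I V ?o (V j \<boxtimes> V k') (y ?o ?o j \<boxtimes>\<^sub>m Idm C (V k')) i0)"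
    using k'1 by simp
  also have "\<dots> = (\<Sum>j\<in>Ideg C I V ?o. if j = k then c \<bullet> Idm C (unit C) else 0)"
  proof (rule sum.cong[OF refl])
    fix j assume j: "j \<in> Ideg C I V ?o"
    then have jI: "j \<in> I" by (simp add: Ideg_iff)
    show "cls C I V ?o (V j \<boxtimes> V k') (y ?o ?o j \<boxtimes>\<^sub>m Idm C (V k')) i0 = (if j = k then c \<bullet> Idm C (unit C) else 0)"
    proof (cases "j = k")
      case False
      have "u = 0" if u: "u \<in> Hom C (unit C) (V j \<boxtimes> V k')" for u
      proof -
        have z: "(Idm C (V j) \<boxtimes>\<^sub>m i) \<cdot> u = 0" by (rule hom_unit_distinct[OF jI kI False up(1)[OF u]])
        show ?thesis
          using up(2)[OF u] cmp_0_right[OF tn_in[OF Idm_in[of "V j"] k'(3)]] unfolding z by simp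
      qed
      then have "Hom C (V i0) (V j \<boxtimes> V k') = {0}" by auto
      then show ?thesis using cls_no_hom[OF i0_in] False by simp
    next
      case True
      have "y ?o ?o k \<boxtimes>\<^sub>m Idm C (V k') = c \<bullet> Idm C (V k \<boxtimes> V k')"
        unfolding yk using tn_scl_left[OF Idm_in Idm_in] tn_Idm by simp
      moreover have "cls C I V ?o (V k \<boxtimes> V k') (c \<bullet> Idm C (V k \<boxtimes> V k')) i0 = c \<bullet> Idm C (V i0)"
      proof (rule cls_hom_line[OF i0_in])
        show "?u0 \<in> Hom C (V i0) (V k \<boxtimes> V k')" "?u0 \<noteq> 0" using u0 u0_ne by simp_all
        fix u v assume "u \<in> Hom C (V i0) (V k \<boxtimes> V k')" "v \<in> Hom C (V i0) (V k \<boxtimes> V k')" and v0: "v \<noteq> 0"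
        then have u: "u \<in> Hom C (unit C) (V k \<boxtimes> V k')" and v: "v \<in> Hom C (unit C) (V k \<boxtimes> V k')" by simp_all
        note P = tn_in[OF Idm_in[of "V k"] k'(3)]
        have "(Idm C (V k) \<boxtimes>\<^sub>m i) \<cdot> v \<noteq> 0" using up(2)[OF v] cmp_0_right[OF P] v0 by auto
        then obtain r where "(Idm C (V k) \<boxtimes>\<^sub>m i) \<cdot> u = r \<bullet> ((Idm C (V k) \<boxtimes>\<^sub>m i) \<cdot> v)"
          using hom_unit_proportional[OF kI up(1)[OF u] up(1)[OF v]] by blast
        then have "u = (Idm C (V k) \<boxtimes>\<^sub>m p) \<cdot> (r \<bullet> ((Idm C (V k) \<boxtimes>\<^sub>m i) \<cdot> v))" using up(2)[OF u] by simp
        also have "\<dots> = r \<bullet> v" using cmp_scl_right[OF P up(1)[OF v]] up(2)[OF v] by simp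
        finally show "\<exists>r. u = r \<bullet> v" by blast
      qed
      ultimately show ?thesis using True by simp
    qed
  qed
  also have "\<dots> = c \<bullet> Idm C (unit C)" using k by simp
  finally have z1: "?z ?o ?o i0 = c \<bullet> eta C ?o" by (simp add: eta_one)
  \<comment> \<open>\<open>vcoeff0\<close> sums over the whole group. Away from the neutral element
    the product vanishes, and since \<open>eta\<close> is nonzero the coefficient picked there is
    0.\<close>
  have zg: "?z h ?o i0 = 0 \<bullet> eta C h" if "h \<noteq> ?o" for h
    using vtimes_comp_0[OF y vstar_idm_basis_in[OF k] that] by simp
  have "vform G C I V i0 y (idm_basis k) = (\<Sum>h\<in>carrier G. THE b. ?z h ?o i0 = b \<bullet> eta C h)"
    by (simp add: vform_def vcoeff0_def)
  also have "\<dots> = (\<Sum>h\<in>carrier G. if h = ?o then c else 0)"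
  proof (rule sum.cong[OF refl])
    fix h assume h: "h \<in> carrier G"
    show "(THE b. ?z h ?o i0 = b \<bullet> eta C h) = (if h = ?o then c else 0)"
    proof (cases "h = ?o")
      case True
      then show ?thesis using THE_scl[OF eta_nonzero[OF h], of c] z1 by simp
    next
      case False
      show ?thesis unfolding zg[OF False] THE_scl[OF eta_nonzero[OF h]] using False by simp
    qed
  qed
  also have "\<dots> = c" using finite_group by simp
  finally show ?thesis .
qed

lemma vtimes_idm_basis:
  assumes i: "i \<in> Ideg C I V \<one>\<^bsub>G\<^esub>" and z: "z \<in> Verl G C I V" and c: "c \<in> carrier G" and k: "k \<in> Ideg C I V c"
  shows "vtimes G C I V (idm_basis i) z \<one>\<^bsub>G\<^esub> c k =
    (\<Sum>j\<in>Ideg C I V c. cls C I V \<one>\<^bsub>G\<^esub> (V i \<boxtimes> V j) (Idm C (V i) \<boxtimes>\<^sub>m z \<one>\<^bsub>G\<^esub> c j) k)"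
proof -
  let ?o = "\<one>\<^bsub>G\<^esub>"
  have "vtimes G C I V (idm_basis i) z ?o c k = (\<Sum>i'\<in>Ideg C I V ?o. \<Sum>j\<in>Ideg C I V c.
     cls C I V ?o (V i' \<boxtimes> V j) (idm_basis i ?o ?o i' \<boxtimes>\<^sub>m z ?o c j) k)"
    by (rule vtimes_one[OF idm_basis_in[OF i] z c k])
  also have "\<dots> = (\<Sum>i'\<in>Ideg C I V ?o. if i' = i then
     \<Sum>j\<in>Ideg C I V c. cls C I V ?o (V i \<boxtimes> V j) (Idm C (V i) \<boxtimes>\<^sub>m z ?o c j) k else 0)"
    using tn_0_left[OF Verl_one[OF z c]] cls_0[OF one_closed]
    by (intro sum.cong refl) (simp add: idm_basis_apply)
  finally show ?thesis using i by simp
qed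

lemma vtimes_idm_basis_in:
  assumes i: "i \<in> Ideg C I V \<one>\<^bsub>G\<^esub>" and g: "g \<in> carrier G" and x: "x \<in> Verl_comp G C I V \<one>\<^bsub>G\<^esub> g"
  shows "vtimes G C I V (idm_basis i) x \<in> Verl_comp G C I V \<one>\<^bsub>G\<^esub> g"
proof -
  let ?o = "\<one>\<^bsub>G\<^esub>" and ?L = "vtimes G C I V (idm_basis i) x"
  note xV = Verl_compD(1)[OF x]
  have z: "?L b c m = 0" if bc: "(b, c) \<noteq> (?o, g)" for b c m
  proof (cases "b = ?o")
    case False
    then show ?thesis using vtimes_comp_0[OF idm_basis_in[OF i] xV] by simp
  next
    case b: True
    show ?thesis
    proof (cases "c \<in> carrier G \<and> m \<in> Ideg C I V c")
      case True
      have "x ?o c j = 0" for j using Verl_compD(2)[OF x] bc b by simp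
      then show ?thesis
        using True b vtimes_idm_basis[OF i xV, of c m] tn_0_right[OF Idm_in[of "V i"]] cls_0[OF one_closed] by simp
    next
      case False
      then show ?thesis using b by (auto simp: vtimes_def)
    qed
  qed
  have 1: "?L ?o g m \<in> Hom C (V m) (V m)" if m: "m \<in> Ideg C I V g" for m
    unfolding vtimes_idm_basis[OF i xV g m] using Verl_one[OF xV g]
    by (intro sum_in cls_in tn_in Idm_in)
  have 2: "?L ?o g m = 0" if "m \<notin> Ideg C I V g" for m
    using that by (simp add: vtimes_def)
  have "if commuting G b c \<and> m \<in> Ideg C I V c then ?L b c m \<in> Hom C (V m) (actO C b (V m)) else ?L b c m = 0"
    for b c m
  proof (cases "(b, c) = (?o, g)")
    case True
    then show ?thesis using 1 2 g by (simp add: act_one(1))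
  next
    case False
    show ?thesis unfolding z[OF False] by simp
  qed
  then show ?thesis using z unfolding Verl_comp_def Verl_def by blast
qed

section \<open>The operator \<open>s\<close> and its effect on products\<close>

lemma s_tilde_eq:
  assumes g: "g \<in> carrier G" and y: "y \<in> Verl_comp G C I V \<one>\<^bsub>G\<^esub> g"
  shows "s_tilde G C I V y a b k =
    (if a = inv\<^bsub>G\<^esub> g \<and> b = \<one>\<^bsub>G\<^esub> \<and> k \<in> Iinv C I V (inv\<^bsub>G\<^esub> g) \<one>\<^bsub>G\<^esub>
     then dimc C (V k) \<bullet> (\<Sum>m\<in>Ideg C I V g. loop G C \<one>\<^bsub>G\<^esub> g (V m) (y \<one>\<^bsub>G\<^esub> g m) (V k)) else 0)"
proof (cases "a = inv\<^bsub>G\<^esub> g \<and> b = \<one>\<^bsub>G\<^esub>")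
  case True
  then show ?thesis using g by (auto simp: s_tilde_def scl_sum_right)
next
  case False
  have "s_tilde G C I V y a b k = 0"
  proof (cases "commuting G a b \<and> k \<in> Iinv C I V a b")
    case True
    then have ab: "a \<in> carrier G" "b \<in> carrier G" and k: "V k \<in> deg C b"
      by (auto simp: commuting_def Iinv_def Ideg_def)
    have "(b, inv\<^bsub>G\<^esub> a) \<noteq> (\<one>\<^bsub>G\<^esub>, g)" using False inv_inv[OF ab(1)] by auto
    then have "y b (inv\<^bsub>G\<^esub> a) m = 0" for m using Verl_compD(2)[OF y] by blast
    then have "dimc C (V k) \<bullet> loop G C b (inv\<^bsub>G\<^esub> a) (V m) (y b (inv\<^bsub>G\<^esub> a) m) (V k) = 0"
      if "m \<in> Ideg C I V (inv\<^bsub>G\<^esub> a)" for m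
      using loop_0[OF ab(2) inv_closed[OF ab(1)] _ k, of "V m"] that by (simp add: Ideg_iff)
    then have "(\<Sum>m\<in>Ideg C I V (inv\<^bsub>G\<^esub> a).
      dimc C (V k) \<bullet> loop G C b (inv\<^bsub>G\<^esub> a) (V m) (y b (inv\<^bsub>G\<^esub> a) m) (V k)) = 0"
      by (intro sum.neutral) blast
    then show ?thesis by (simp only: s_tilde_def if_cancel)
  qed (auto simp: s_tilde_def)
  then show ?thesis using False by auto
qed

lemma Iinv_D: "k \<in> Iinv C I V a b \<Longrightarrow> k \<in> I \<and> V k \<in> deg C b \<and> isomorphic C (actO C a (V k)) (V k)"
  by (auto simp: Iinv_def Ideg_def)

lemma Iinv_one: "Iinv C I V \<one>\<^bsub>G\<^esub> b = Ideg C I V b"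
  by (auto simp: Iinv_def act_one(1) isomorphic_refl)

lemma s_op_in:
  assumes g: "g \<in> carrier G" and y: "y \<in> Verl_comp G C I V \<one>\<^bsub>G\<^esub> g"
  shows "s_op G C I V D y \<in> Verl_comp G C I V (inv\<^bsub>G\<^esub> g) \<one>\<^bsub>G\<^esub>"
proof -
  have "(\<Sum>m\<in>Ideg C I V g. loop G C \<one>\<^bsub>G\<^esub> g (V m) (y \<one>\<^bsub>G\<^esub> g m) (V k)) \<in> Hom C (V k) (actO C (inv\<^bsub>G\<^esub> g) (V k))"
    if "V k \<in> deg C \<one>\<^bsub>G\<^esub>" for k
    using Verl_one[OF Verl_compD(1)[OF y] g] that by (intro sum_in loop_in g) (auto simp: Ideg_iff)
  then show ?thesis
    using g
    by (auto simp: Verl_comp_def Verl_def s_op_def vscl_def s_tilde_eq[OF g y] dest!: Iinv_D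
        intro!: scl_in) (auto simp: Ideg_iff)
qed

text \<open>The scalar \<open>\<sigma>\<^sub>i\<^sub>k\<close> of the inner loop; it exists by
  Schur's lemma when both labels have degree one.\<close>

definition loop_scalar :: "'i \<Rightarrow> 'i \<Rightarrow> complex" where
  "loop_scalar i k = (SOME c. loop G C \<one>\<^bsub>G\<^esub> \<one>\<^bsub>G\<^esub> (V i) (Idm C (V i)) (V k) = c \<bullet> Idm C (V k))"

lemma loop_loop_scalar:
  assumes "i \<in> Ideg C I V \<one>\<^bsub>G\<^esub>" "k \<in> Ideg C I V \<one>\<^bsub>G\<^esub>"
  shows "loop G C \<one>\<^bsub>G\<^esub> \<one>\<^bsub>G\<^esub> (V i) (Idm C (V i)) (V k) = loop_scalar i k \<bullet> Idm C (V k)"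
proof -
  have "loop G C \<one>\<^bsub>G\<^esub> \<one>\<^bsub>G\<^esub> (V i) (Idm C (V i)) (V k) \<in> Hom C (V k) (V k)"
    using loop_in[OF one_closed, of "V i" "V k" "Idm C (V i)"] assms by (simp add: Ideg_iff Idm_in act_one(1))
  moreover have "k \<in> I" using assms by (simp add: Ideg_iff)
  ultimately have "\<exists>c. loop G C \<one>\<^bsub>G\<^esub> \<one>\<^bsub>G\<^esub> (V i) (Idm C (V i)) (V k) = c \<bullet> Idm C (V k)"
    using schur[OF V_simple] by blast
  then show ?thesis unfolding loop_scalar_def by (rule someI_ex)
qed

lemma s_idm_basis:
  assumes i: "i \<in> Ideg C I V \<one>\<^bsub>G\<^esub>" and k: "k \<in> Ideg C I V \<one>\<^bsub>G\<^esub>"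
  shows "s_op G C I V D (idm_basis i) \<one>\<^bsub>G\<^esub> \<one>\<^bsub>G\<^esub> k = (inverse D * dimc C (V k) * loop_scalar i k) \<bullet> Idm C (V k)"
proof -
  let ?o = "\<one>\<^bsub>G\<^esub>"
  have "(\<Sum>m\<in>Ideg C I V ?o. loop G C ?o ?o (V m) (idm_basis i ?o ?o m) (V k)) =
    (\<Sum>m\<in>Ideg C I V ?o. if m = i then loop_scalar i k \<bullet> Idm C (V k) else 0)"
    using k by (intro sum.cong refl) (auto simp: idm_basis_apply loop_loop_scalar[OF i k] Ideg_iff intro!: loop_0)
  also have "\<dots> = loop_scalar i k \<bullet> Idm C (V k)" using i by simp
  finally show ?thesis
    using k by (simp add: s_op_def vscl_def s_tilde_eq[OF one_closed idm_basis_in[OF i]] Iinv_one scl_scl mult.assoc)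
qed

lemma vform_s_idm_basis:
  assumes "i \<in> Ideg C I V \<one>\<^bsub>G\<^esub>" "k \<in> Ideg C I V \<one>\<^bsub>G\<^esub>"
  shows "vform G C I V i0 (s_op G C I V D (idm_basis i)) (idm_basis k) = inverse D * dimc C (V k) * loop_scalar i k"
  using s_op_in[OF one_closed idm_basis_in[OF assms(1)], of D] by (intro vform_idm_basis s_idm_basis assms) simp

text \<open>Tensoring with the unit object does not change a loop, so \<open>loop_scalar i0 k\<close> acts as one on every
  loop around \<open>V k\<close>; by modularity one of these loops is nonzero.\<close>

lemma modular_unit:
  assumes mod: "modular G C I V" and k: "k \<in> Ideg C I V \<one>\<^bsub>G\<^esub>"
  shows "dimc C (V k) \<noteq> 0" "loop_scalar i0 k = 1"
proof -
  let ?o = "\<one>\<^bsub>G\<^esub>"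
  have kd: "V k \<in> deg C ?o" using k by (simp add: Ideg_iff)
  \<comment> \<open>A preimage of \<open>\<lambda>\<^sub>k\<close> under \<open>s_tilde\<close> has
    a nonzero image at \<open>k\<close>, so both the dimension factor and some loop around
    \<open>V k\<close> are nonzero.\<close>
  have "idm_basis k \<in> s_tilde G C I V ` Verl G C I V"
    using bij_betw_imp_surj_on[OF mod[unfolded modular_def]] Verl_compD(1)[OF idm_basis_in[OF k]] by blast
  then obtain z where z: "z \<in> Verl G C I V" "s_tilde G C I V z = idm_basis k" by (elim imageE) simp
  have "s_tilde G C I V z ?o ?o k \<noteq> 0"
    unfolding z(2) using V_nonzero[of k] k by (simp add: idm_basis_apply Ideg_iff)
  then have nz: "(\<Sum>m\<in>Ideg C I V ?o. dimc C (V k) \<bullet> loop G C ?o ?o (V m) (z ?o ?o m) (V k)) \<noteq> 0"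
    using k by (simp add: s_tilde_def Iinv_one)
  show "dimc C (V k) \<noteq> 0"
  proof
    assume "dimc C (V k) = 0"
    then show False using nz by simp
  qed
  have "\<exists>m\<in>Ideg C I V ?o. loop G C ?o ?o (V m) (z ?o ?o m) (V k) \<noteq> 0"
  proof (rule ccontr)
    assume "\<not> ?thesis"
    then have "(\<Sum>m\<in>Ideg C I V ?o. dimc C (V k) \<bullet> loop G C ?o ?o (V m) (z ?o ?o m) (V k)) = 0"
      by (intro sum.neutral) simp
    then show False using nz by contradiction
  qed
  then obtain m where m: "m \<in> Ideg C I V ?o" "loop G C ?o ?o (V m) (z ?o ?o m) (V k) \<noteq> 0" by blast
  let ?f = "z ?o ?o m" and ?Y = "V m"
  have Y: "?Y \<in> deg C ?o" and f: "?f \<in> Hom C ?Y ?Y" using m Verl_one[OF z(1)] by (simp_all add: Ideg_iff)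
  have uY: "unit C \<boxtimes> ?Y \<in> deg C ?o" using deg_tn[OF one_closed one_closed unit_deg Y] by simp
  note l = is_iso_in[OF lun_iso[of ?Y]] inv_mor_in[OF lun_iso[of ?Y]]
  let ?l = "lun C ?Y" and ?k = "inv_mor C (unit C \<boxtimes> ?Y) ?Y (lun C ?Y)"
  have uf: "Idm C (unit C) \<boxtimes>\<^sub>m ?f \<in> Hom C (unit C \<boxtimes> ?Y) (unit C \<boxtimes> ?Y)" by (rule tn_in[OF Idm_in f])
  \<comment> \<open>The left unit constraint conjugates \<open>z\<close> at \<open>m\<close>,
    tensored with the identity of the unit, back to \<open>z\<close> at \<open>m\<close>; cyclicity
    then identifies the loops coloured by \<open>unit C \<boxtimes> V m\<close> and by
    \<open>V m\<close>.\<close>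
  have "?k \<cdot> (?f \<cdot> ?l) = ?k \<cdot> (?l \<cdot> (Idm C (unit C) \<boxtimes>\<^sub>m ?f))" using lun_nat[OF f] by simp
  also have "\<dots> = Idm C (unit C) \<boxtimes>\<^sub>m ?f"
    using cmp_assoc[OF l(2,1) uf] inv_mor_left[OF lun_iso[of ?Y]] Idm_left[OF uf] by simp
  finally have e: "Idm C (unit C) \<boxtimes>\<^sub>m ?f = ?k \<cdot> (?f \<cdot> ?l)" by simp
  have "loop G C ?o ?o (unit C \<boxtimes> ?Y) (Idm C (unit C) \<boxtimes>\<^sub>m ?f) (V k) = loop G C ?o ?o ?Y ((?f \<cdot> ?l) \<cdot> ?k) (V k)"
    unfolding e by (rule loop_cyclic[OF one_closed uY Y kd cmp_in[OF f l(1)] l(2)])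
  also have "(?f \<cdot> ?l) \<cdot> ?k = ?f"
    using cmp_assoc[OF f l] inv_mor_right[OF lun_iso[of ?Y]] Idm_right[OF f] by simp
  finally have "loop_scalar i0 k \<bullet> loop G C ?o ?o ?Y ?f (V k) = 1 \<bullet> loop G C ?o ?o ?Y ?f (V k)"
    using loop_tn[OF one_closed unit_deg Y kd f, of "loop_scalar i0 k"] loop_loop_scalar[OF i0_Ideg k] by simp
  then have "(loop_scalar i0 k - 1) \<bullet> loop G C ?o ?o ?Y ?f (V k) = 0"
    using scl_add_left[of "loop_scalar i0 k" "- 1" "loop G C ?o ?o ?Y ?f (V k)"] by (simp add: scl_minus_left)
  then show "loop_scalar i0 k = 1" using m(2) by simp
qed

lemma s_vtimes_idm_basis:
  assumes i: "i \<in> Ideg C I V \<one>\<^bsub>G\<^esub>" and g: "g \<in> carrier G" and x: "x \<in> Verl_comp G C I V \<one>\<^bsub>G\<^esub> g"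
    and k: "k \<in> Ideg C I V \<one>\<^bsub>G\<^esub>"
  shows "s_op G C I V D (vtimes G C I V (idm_basis i) x) a b k = loop_scalar i k \<bullet> s_op G C I V D x a b k"
proof -
  let ?o = "\<one>\<^bsub>G\<^esub>" and ?L = "vtimes G C I V (idm_basis i) x"
  let ?l = "\<lambda>Y f. loop G C ?o g Y f (V k)"
  let ?c = "\<lambda>j m. cls C I V ?o (V i \<boxtimes> V j) (Idm C (V i) \<boxtimes>\<^sub>m x ?o g j) m"
  note xV = Verl_compD(1)[OF x] and LV = vtimes_idm_basis_in[OF i g x]
  have kd: "V k \<in> deg C ?o" and idg: "V i \<in> deg C ?o" using k i by (simp_all add: Ideg_iff)
  have xj: "x ?o g j \<in> Hom C (V j) (V j)" "V j \<in> deg C g" "V i \<boxtimes> V j \<in> deg C g"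
    if "j \<in> Ideg C I V g" for j
    using Verl_one[OF xV g that] that deg_tn[OF one_closed g idg, of "V j"] g by (simp_all add: Ideg_iff)
  have "(\<Sum>m\<in>Ideg C I V g. ?l (V m) (?L ?o g m)) = (\<Sum>m\<in>Ideg C I V g. \<Sum>j\<in>Ideg C I V g. ?l (V m) (?c j m))"
  proof (rule sum.cong[OF refl])
    fix m assume m: "m \<in> Ideg C I V g"
    show "?l (V m) (?L ?o g m) = (\<Sum>j\<in>Ideg C I V g. ?l (V m) (?c j m))"
      unfolding vtimes_idm_basis[OF i xV g m]
      using xj m by (intro loop_sum g kd cls_in tn_in Idm_in) (simp_all add: Ideg_iff)
  qed
  \<comment> \<open>For fixed \<open>j\<close> the sum over the labels \<open>m\<close> reassembles
    the loop coloured by \<open>V i \<boxtimes> V j\<close>, to which multiplicativity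
    applies.\<close>
  also have "\<dots> = (\<Sum>j\<in>Ideg C I V g. \<Sum>m\<in>Ideg C I V g. ?l (V m) (?c j m))" by (rule sum.swap)
  also have "\<dots> = (\<Sum>j\<in>Ideg C I V g. loop_scalar i k \<bullet> ?l (V j) (x ?o g j))"
  proof (rule sum.cong[OF refl])
    fix j assume j: "j \<in> Ideg C I V g"
    show "(\<Sum>m\<in>Ideg C I V g. ?l (V m) (?c j m)) = loop_scalar i k \<bullet> ?l (V j) (x ?o g j)"
      using loop_cls[OF g xj(3)[OF j] kd tn_in[OF Idm_in[of "V i"] xj(1)[OF j]]]
        loop_tn[OF g idg xj(2)[OF j] kd xj(1)[OF j] loop_loop_scalar[OF i k]] by simp
  qed
  also have "\<dots> = loop_scalar i k \<bullet> (\<Sum>j\<in>Ideg C I V g. ?l (V j) (x ?o g j))" by (simp add: scl_sum_right)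
  finally show ?thesis
    by (simp add: s_op_def vscl_def s_tilde_eq[OF g LV] s_tilde_eq[OF g x] scl_scl mult_ac)
qed

text \<open>The operator is constrained only on one component and its eigenvalues are given only on
  basis vectors. Each invariant label carries a line of morphisms, so \<open>y\<close> is a finite
  sum of multiples of basis vectors; as linearity is given for two summands, induction runs over the
  support.\<close>

lemma linear_operator_diagonal:
  assumes h: "h \<in> carrier G" and T: "linear_operator_on C (Verl_comp G C I V h \<one>\<^bsub>G\<^esub>) T"
    and lam: "generic_basis G C I V lam"
    and eig: "\<And>k. k \<in> Iinv C I V h \<one>\<^bsub>G\<^esub> \<Longrightarrow>
      T (single h \<one>\<^bsub>G\<^esub> k (lam h k)) = vscl C (q k) (single h \<one>\<^bsub>G\<^esub> k (lam h k))"
    and y: "y \<in> Verl_comp G C I V h \<one>\<^bsub>G\<^esub>" "\<And>k. k \<notin> Iinv C I V h \<one>\<^bsub>G\<^esub> \<Longrightarrow> y h \<one>\<^bsub>G\<^esub> k = 0"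
  shows "T y = (\<lambda>a b k. q k \<bullet> y a b k)"
proof -
  let ?o = "\<one>\<^bsub>G\<^esub>" and ?V = "Verl_comp G C I V h \<one>\<^bsub>G\<^esub>"
  let ?r = "\<lambda>A a b k. if k \<in> A then y a b k else 0"
  have rin: "?r A \<in> ?V" for A using y(1) by (auto simp: Verl_comp_def Verl_def split: if_splits)
  have s: "single h ?o k (lam h k) \<in> ?V" "\<exists>c. single h ?o k (y h ?o k) = vscl C c (single h ?o k (lam h k))"
    if k: "k \<in> Iinv C I V h ?o" for k
  proof -
    have k': "k \<in> I" "V k \<in> deg C ?o" "isomorphic C (actO C h (V k)) (V k)" "k \<in> Ideg C I V ?o"
      using Iinv_D[OF k] by (auto simp: Ideg_iff)
    then have l: "lam h k \<in> Hom C (V k) (actO C h (V k))" "lam h k \<noteq> 0"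
      using lam h unfolding generic_basis_def by blast+
    show "single h ?o k (lam h k) \<in> ?V"
      using l k' h by (auto simp: Verl_comp_def Verl_def single_def)
    have "y h ?o k \<in> Hom C (V k) (actO C h (V k))" using VerlD[OF Verl_compD(1)[OF y(1)]] k' h by simp
    then obtain c where c: "y h ?o k = c \<bullet> lam h k"
      using hom_proportional[OF V_simple[OF k'(1)] k'(3) l] by blast
    have "single h ?o k (y h ?o k) = vscl C c (single h ?o k (lam h k))"
      unfolding c by (auto simp: single_def vscl_def fun_eq_iff)
    then show "\<exists>c. single h ?o k (y h ?o k) = vscl C c (single h ?o k (lam h k))" by blast
  qed
  have add: "T (vadd u v) = vadd (T u) (T v)" and scl: "T (vscl C c u) = vscl C c (T u)"
    if "u \<in> ?V" "v \<in> ?V" for u v c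
    using T that unfolding linear_operator_on_def by blast+
  have sc: "vscl C c u \<in> ?V" if "u \<in> ?V" for c u
    using that by (auto simp: Verl_comp_def Verl_def vscl_def intro: scl_in split: if_splits)
  have "T (?r A) = (\<lambda>a b k. q k \<bullet> ?r A a b k)" if "finite A" "A \<subseteq> Iinv C I V h ?o" for A
    using that
  proof (induction A rule: finite_induct)
    case empty
    \<comment> \<open>That the operator maps 0 to 0 comes from compatibility with scaling by
      0.\<close>
    have "T (?r {}) = vscl C 0 (T (?r {}))" using scl[OF rin rin, of 0 "{}"] by (simp add: vscl_def)
    then show ?case by (simp add: vscl_def)
  next
    case (insert k A)
    let ?s = "single h ?o k (y h ?o k)"
    have k: "k \<in> Iinv C I V h ?o" using insert by simp
    obtain c where c: "?s = vscl C c (single h ?o k (lam h k))" using s(2)[OF k] by blast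
    have sV: "?s \<in> ?V" unfolding c by (rule sc[OF s(1)[OF k]])
    have "T ?s = vscl C c (vscl C (q k) (single h ?o k (lam h k)))"
      unfolding c scl[OF s(1)[OF k] s(1)[OF k]] eig[OF k] ..
    also have "\<dots> = vscl C (q k) ?s" unfolding c by (simp add: vscl_def scl_scl mult.commute)
    finally have Ts: "T ?s = vscl C (q k) ?s" .
    have split: "(if m \<in> insert k A then y a b m else 0) = vadd ?s (?r A) a b m" for a b m
      using insert.hyps(2) Verl_compD(2)[OF y(1), of a b m] by (auto simp: vadd_def single_def)
    have "T (?r (insert k A)) = vadd (vscl C (q k) ?s) (\<lambda>a b k. q k \<bullet> ?r A a b k)"
      unfolding split add[OF sV rin] Ts using insert by simp
    also have "\<dots> = (\<lambda>a b m. q m \<bullet> vadd ?s (?r A) a b m)"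
      by (auto simp: vadd_def vscl_def single_def fun_eq_iff scl_add_right)
    finally show ?case unfolding split .
  qed
  from this[of "Iinv C I V h ?o"] have "T (?r (Iinv C I V h ?o)) = (\<lambda>a b k. q k \<bullet> ?r (Iinv C I V h ?o) a b k)"
    by (simp add: Iinv_def)
  moreover have "(if k \<in> Iinv C I V h ?o then y a b k else 0) = y a b k" for a b k
    using y(2)[of k] Verl_compD(2)[OF y(1), of a b k] by (cases "(a, b) = (h, ?o)") auto
  ultimately show ?thesis by simp
qed

end

theorem lemma6p5:
  fixes G :: "('g, 'y) monoid_scheme"
    and C :: "('g, 'o, 'm::ab_group_add, 'z) equivariant_cat_scheme"
    and I :: "'i set" and V :: "'i \<Rightarrow> 'o" and i0 i :: 'i
    and lam :: "'g \<Rightarrow> 'i \<Rightarrow> 'm" and D :: complex and g :: 'g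
    and s L\<^sub>i D\<^sub>i :: "('g \<Rightarrow> 'g \<Rightarrow> 'i \<Rightarrow> 'm) \<Rightarrow> ('g \<Rightarrow> 'g \<Rightarrow> 'i \<Rightarrow> 'm)"
    and el :: "'i \<Rightarrow> ('g \<Rightarrow> 'g \<Rightarrow> 'i \<Rightarrow> 'm)"
  assumes "equivariant_fusion_category C G"
    and "simple_reps C I V i0"
    and "modular G C I V"
    and "D\<^sup>2 = p_plus G C I V * p_minus G C I V"
    and "generic_basis G C I V lam"
    and "g \<in> carrier G"
    and "i \<in> Ideg C I V \<one>\<^bsub>G\<^esub>"
  defines "s \<equiv> s_op G C I V D"
    and "el \<equiv> \<lambda>k. single \<one>\<^bsub>G\<^esub> \<one>\<^bsub>G\<^esub> k (lam \<one>\<^bsub>G\<^esub> k)"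
    and "L\<^sub>i \<equiv> vtimes G C I V (el i)"
  assumes "linear_operator_on C (Verl_comp G C I V (inv\<^bsub>G\<^esub> g) \<one>\<^bsub>G\<^esub>) D\<^sub>i"
    and "\<forall>k\<in>Iinv C I V (inv\<^bsub>G\<^esub> g) \<one>\<^bsub>G\<^esub>.
      D\<^sub>i (single (inv\<^bsub>G\<^esub> g) \<one>\<^bsub>G\<^esub> k (lam (inv\<^bsub>G\<^esub> g) k)) =
      vscl C (vform G C I V i0 (s (el i)) (el k) / vform G C I V i0 (s (el i0)) (el k))
        (single (inv\<^bsub>G\<^esub> g) \<one>\<^bsub>G\<^esub> k (lam (inv\<^bsub>G\<^esub> g) k))"
  shows "\<forall>x\<in>Verl_comp G C I V \<one>\<^bsub>G\<^esub> g. s (L\<^sub>i x) = D\<^sub>i (s x)"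
proof
  interpret equivariant_fusion_category C G by fact
  interpret W: verlinde C G I V i0 by unfold_locales fact
  fix x assume x: "x \<in> Verl_comp G C I V \<one>\<^bsub>G\<^esub> g"
  let ?h = "inv\<^bsub>G\<^esub> g" and ?o = "\<one>\<^bsub>G\<^esub>"
  let ?q = "\<lambda>k. vform G C I V i0 (s (el i)) (el k) / vform G C I V i0 (s (el i0)) (el k)"
  note g = \<open>g \<in> carrier G\<close> and i = \<open>i \<in> Ideg C I V \<one>\<^bsub>G\<^esub>\<close>
  have el: "el k = W.idm_basis k" if "k \<in> Ideg C I V ?o" for k
    using that assms(5) by (simp add: el_def W.idm_basis_def generic_basis_def W.Ideg_iff)
  \<comment> \<open>The factor \<open>inverse D * dimc C (V k)\<close> is common to numerator and
    denominator and nonzero; the remaining denominator is \<open>loop_scalar i0 k\<close>, which is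
    1.\<close>
  have q: "?q k = W.loop_scalar i k" if k: "k \<in> Ideg C I V ?o" and D: "D \<noteq> 0" for k
    using W.vform_s_idm_basis[OF i k, of D] W.vform_s_idm_basis[OF W.i0_Ideg k, of D] W.modular_unit[OF assms(3) k] D
    by (simp add: s_def el[OF i] el[OF k] el[OF W.i0_Ideg])
  have sx: "s x \<in> Verl_comp G C I V ?h ?o" unfolding s_def by (rule W.s_op_in[OF g x])
  \<comment> \<open>By its definition \<open>s_tilde\<close> is 0 at labels that are not invariant,
    so \<open>s x\<close> lies in the span of the prescribed eigenvectors.\<close>
  have sx0: "s x a b k = 0" if "k \<notin> Iinv C I V ?h ?o" for a b k
    using that by (simp add: s_def s_op_def vscl_def W.s_tilde_eq[OF g x])
  have Ds: "D\<^sub>i (s x) = (\<lambda>a b k. scl C (?q k) (s x a b k))"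
    by (rule W.linear_operator_diagonal[OF _ assms(11,5) _ sx]) (use g assms(12) sx0 in auto)
  show "s (L\<^sub>i x) = D\<^sub>i (s x)"
  proof (intro ext)
    fix a b k
    show "s (L\<^sub>i x) a b k = D\<^sub>i (s x) a b k"
    proof (cases "k \<in> Ideg C I V ?o \<and> D \<noteq> 0")
      case True
      then show ?thesis
        unfolding Ds using q W.s_vtimes_idm_basis[OF i g x, of k D a b] by (simp add: s_def L\<^sub>i_def el[OF i])
    next
      \<comment> \<open>Both sides vanish here: outside degree one by the support of
        \<open>s_tilde\<close>, and for \<open>D = 0\<close> because \<open>inverse 0 = 0\<close>
        makes \<open>s\<close> zero.\<close>
      case False
      have Lx: "L\<^sub>i x \<in> Verl_comp G C I V ?o g"
        unfolding L\<^sub>i_def el[OF i] by (rule W.vtimes_idm_basis_in[OF i g x])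
      have "s y a b k = 0" if "y \<in> Verl_comp G C I V ?o g" for y
        using False by (auto simp: s_def s_op_def vscl_def W.s_tilde_eq[OF g that] Iinv_def)
      then show ?thesis unfolding Ds using x Lx by simp
    qed
  qed
qed

end
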